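(* Let $\omega \in L^1(\mathbb{R}^2) \cap L^\infty(\mathbb{R}^2)$ have compact support, and let $u = K\ast \omega$, so that $\mathrm{div}(u) = 0$ and $\mathrm{curl}(u)= \omega$. Then, for every $r>0$, $$\frac{1}{|B_r(0)|}\int_{B_r(0)} \int_{\mathbb{R}^2} |u(x+h)-u(x)|^2\, dx \, dh = 2\int_{\mathbb{R}^2}\int_{|h|\le r} \Sigma\left(\frac{|h|}{r}\right)\, \omega(x)\,\omega(x+h) \, dh\, dx ,$$ where, for $0<\rho\le 1$, $\Sigma(\rho):= \frac{1}{4\pi}\left(|\log(\rho^2)| - 1 + \rho^2\right) \ge 0$. In particular, it follows that $$\frac{1}{|B_r(0)|}\int_{B_r(0)} \int_{\mathbb{R}^2} |u(x+h)-u(x)|^2\, dx \, dh \le \int_{\mathbb{R}^2} \int_{B_r(0)} \left|\log\left(\frac{|h|}{r}\right)\right| |\omega(x)|\, |\omega(x+h)| \, dh \, dx.$$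
   Context: $B_r(x)$ is the ball of radius $r$ around $x$ in $\mathbb{R}^2$. The kernel $K:\mathbb{R}^2\setminus\{0\}\to\mathbb{R}^2$ is $K(x) = \frac{1}{2\pi}\frac{x^\perp}{|x|^2}$ with $x^\perp = (-x_2,x_1)$, and $u(x) = (K\ast\omega)(x) = \int_{\mathbb{R}^2} K(x-y)\omega(y)\,dy$. Here $\mathrm{curl}(u)=\partial_1u_2-\partial_2u_1$ in the sense of distributions. *)

theory Defs
  imports "HOL-Analysis.Analysis"
begin

definition perp :: "real^2 \<Rightarrow> real^2" where
  "perp x = vector [- x $ 2, x $ 1]"

text \<open>The kernel is only meant on the punctured plane; the value at the origin is irrelevant
  (it is \<open>0\<close>, since \<open>1 / 0 = 0\<close>).\<close>

definition biot_savart_kernel :: "real^2 \<Rightarrow> real^2" where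
  "biot_savart_kernel x = (1 / (2 * pi)) *\<^sub>R ((1 / (norm x)\<^sup>2) *\<^sub>R perp x)"

definition biot_savart :: "(real^2 \<Rightarrow> real) \<Rightarrow> real^2 \<Rightarrow> real^2" where
  "biot_savart \<omega> x = (LINT y|lebesgue. \<omega> y *\<^sub>R biot_savart_kernel (x - y))"

text \<open>The support of a function defined up to null sets: the complement of the largest open set
  on which it vanishes almost everywhere.\<close>

definition ess_support :: "(real^2 \<Rightarrow> real) \<Rightarrow> (real^2) set" where
  "ess_support f = - \<Union>{U. open U \<and> (AE x in lebesgue. x \<in> U \<longrightarrow> f x = 0)}"

definition partial_deriv :: "2 \<Rightarrow> (real^2 \<Rightarrow> real) \<Rightarrow> real^2 \<Rightarrow> real" where
  "partial_deriv i f x = frechet_derivative f (at x) (axis i 1)"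

primrec times_cont_diff :: "nat \<Rightarrow> (real^2 \<Rightarrow> real) \<Rightarrow> bool" where
  "times_cont_diff 0 f \<longleftrightarrow> continuous_on UNIV f"
| "times_cont_diff (Suc k) f \<longleftrightarrow>
     (\<forall>x. f differentiable (at x)) \<and> (\<forall>i. times_cont_diff k (partial_deriv i f))"

definition test_function :: "(real^2 \<Rightarrow> real) \<Rightarrow> bool" where
  "test_function \<phi> \<longleftrightarrow> (\<forall>k. times_cont_diff k \<phi>) \<and> compact (closure {x. \<phi> x \<noteq> 0})"

definition locally_integrable :: "(real^2 \<Rightarrow> 'b::euclidean_space) \<Rightarrow> bool" where
  "locally_integrable f \<longleftrightarrow> (\<forall>S. compact S \<longrightarrow> set_integrable lebesgue S f)"

text \<open>Distributions are represented by their action on test functions; \<open>distr_of f\<close> is only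
  meaningful for locally integrable \<open>f\<close>.\<close>

type_synonym distr = "(real^2 \<Rightarrow> real) \<Rightarrow> real"

definition distr_of :: "(real^2 \<Rightarrow> real) \<Rightarrow> distr" where
  "distr_of f \<phi> = (LINT x|lebesgue. f x * \<phi> x)"

definition distr_partial :: "2 \<Rightarrow> distr \<Rightarrow> distr" where
  "distr_partial i T \<phi> = - T (partial_deriv i \<phi>)"

definition distr_div :: "(real^2 \<Rightarrow> real^2) \<Rightarrow> distr" where
  "distr_div u \<phi> =
     distr_partial 1 (distr_of (\<lambda>x. u x $ 1)) \<phi> + distr_partial 2 (distr_of (\<lambda>x. u x $ 2)) \<phi>"

definition distr_curl :: "(real^2 \<Rightarrow> real^2) \<Rightarrow> distr" where
  "distr_curl u \<phi> =
     distr_partial 1 (distr_of (\<lambda>x. u x $ 2)) \<phi> - distr_partial 2 (distr_of (\<lambda>x. u x $ 1)) \<phi>"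

text \<open>Only used for \<open>0 < \<rho> \<le> 1\<close>, except at the single point \<open>\<rho> = 0\<close> under an integral.\<close>

definition Sigma_weight :: "real \<Rightarrow> real" where
  "Sigma_weight \<rho> = 1 / (4 * pi) * (\<bar>ln (\<rho>\<^sup>2)\<bar> - 1 + \<rho>\<^sup>2)"

end

theory Submission
  imports Defs "HOL-Real_Asymp.Real_Asymp"
begin

text \<open>
  Everything rests on one identity: integrating the radial derivative of a function \<open>F\<close> against
  \<open>1 / \<bar>x\<bar>\<^sup>2\<close> over the plane gives \<open>- 2 \<pi> F(0)\<close>. It follows from the fundamental theorem of calculus on
  the rays \<open>x = t (1, s)\<close>, since in the coordinates \<open>(s, t)\<close> the measure \<open>dx / \<bar>x\<bar>\<^sup>2\<close> becomes
  \<open>ds / (1 + s\<^sup>2) dt / \<bar>t\<bar>\<close>. For test functions it is the weak form of \<open>curl u = \<omega>\<close>; for differences of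
  logarithms it evaluates the correlation \<open>\<integral> K(x) \<bullet> (K(x - p) - K(x - q)) dx\<close>, which yields
  \<open>\<integral> \<bar>u(x + h) - u(x)\<bar>\<^sup>2 dx = \<integral> \<omega> (\<Psi>(\<cdot> + h) + \<Psi>(\<cdot> - h) - 2 \<Psi>) / (2 \<pi>)\<close> with \<open>\<Psi> = ln \<bar>\<cdot>\<bar> * \<omega>\<close>; and for
  truncated logarithms it gives the mean of \<open>ln\<close> over a disc. Averaging over \<open>h\<close> therefore replaces
  the second difference of \<open>\<Psi>\<close> by convolution with the excess of that mean over the central
  value, which is \<open>\<Sigma>\<close> up to a constant.
\<close>

section \<open>Slope coordinates and the radial derivative\<close>

text \<open>The obstacle is decay. The velocity falls off only like 1/|x|, so in general it is not
  square integrable and |u(x + h) - u(x)|^2 may not be expanded under the integral; nor is the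
  product of two translates of the kernel integrable at infinity. Increments of u and of the kernel
  gain one power, and every identity is arranged so that one factor is an increment: integrands are
  then O(|x|^-3) at infinity and Fubini applies. This is why the correlation is computed for a
  difference of two kernels. Slope coordinates take the place of polar ones because Tonelli and a
  linear substitution in one variable suffice to introduce them. The weight comes from the disc: the
  mean of ln|x - y| over B_r(0) exceeds ln|y| by 2 \<pi> \<Sigma>(|y|/r) for 0 < |y| < r and by
  nothing for larger |y|, ln being harmonic away from its pole. The second difference of \<Psi>
  contains such a mean twice, whence the factor 2 in the theorem.\<close>

definition ray_dir :: "real \<Rightarrow> real^2" where
  "ray_dir s = axis 1 1 + s *\<^sub>R axis 2 1"

lemma ray_dir_nth [simp]: "ray_dir s $ 1 = 1" "ray_dir s $ 2 = s"
  by (simp_all add: ray_dir_def axis_def)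

lemma norm_sq_vec2: "(norm (x::real^2))\<^sup>2 = (x$1)\<^sup>2 + (x$2)\<^sup>2"
  by (simp add: norm_vec_def L2_set_def sum_2)

lemma inner_vec2: "(x::real^2) \<bullet> y = x$1 * y$1 + x$2 * y$2"
  by (simp add: inner_vec_def sum_2)

lemma norm_ray_dir_sq [simp]: "(norm (ray_dir s))\<^sup>2 = 1 + s\<^sup>2"
  by (simp add: norm_sq_vec2)

lemma ray_dir_nonzero [simp]: "ray_dir s \<noteq> 0"
  by (metis ray_dir_nth(1) zero_index zero_neq_one)

lemma ray_dir_measurable [measurable]: "ray_dir \<in> borel_measurable borel"
  unfolding ray_dir_def by measurable

text \<open>The two measures agree on boxes, whose preimages are products of intervals. The type
  \<open>real^2\<close> is not a product type, so this is what gives access to Tonelli and Fubini in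
  the two coordinates.\<close>

lemma lborel_vec2:
  "(lborel :: (real^2) measure) =
     distr (lborel \<Otimes>\<^sub>M lborel) borel (\<lambda>p. fst p *\<^sub>R axis 1 1 + snd p *\<^sub>R axis 2 1)"
    (is "_ = distr _ _ ?T")
proof (rule lborel_eqI)
  fix l u :: "real^2"
  assume le: "\<And>b. b \<in> Basis \<Longrightarrow> l \<bullet> b \<le> u \<bullet> b"
  have le': "l $ i \<le> u $ i" for i
    using le[of "axis i 1"] by (simp add: axis_in_Basis_iff inner_axis)
  have T: "?T \<in> lborel \<Otimes>\<^sub>M lborel \<rightarrow>\<^sub>M borel"
    by measurable
  have pre: "?T -` box l u \<inter> space (lborel \<Otimes>\<^sub>M lborel) = box (l$1) (u$1) \<times> box (l$2) (u$2)"
    by (auto simp: space_pair_measure mem_box_cart forall_2 axis_def)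
  have B: "(\<Prod>b\<in>Basis. (u - l) \<bullet> b) = (u$1 - l$1) * (u$2 - l$2)"
  proof -
    have "(\<Prod>b\<in>Basis. (u - l) \<bullet> b) = (\<Prod>i\<in>UNIV. (u - l) $ i)"
      unfolding Basis_vec_def
      by (simp add: UNION_singleton_eq_range inner_axis)
         (subst prod.reindex, auto simp: inj_on_def axis_eq_axis inner_axis)
    then show ?thesis by (simp add: UNIV_2)
  qed
  have "emeasure (distr (lborel \<Otimes>\<^sub>M lborel) borel ?T) (box l u)
      = emeasure (lborel \<Otimes>\<^sub>M lborel) (box (l$1) (u$1) \<times> box (l$2) (u$2))"
    by (subst emeasure_distr[OF T]) (simp_all add: pre del: box_real)
  also have "\<dots> = ennreal ((u$1 - l$1) * (u$2 - l$2))"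
    using le'[of 1] le'[of 2]
    by (simp add: lborel.emeasure_pair_measure_Times ennreal_mult)
  finally show "emeasure (distr (lborel \<Otimes>\<^sub>M lborel) borel ?T) (box l u) = (\<Prod>b\<in>Basis. (u - l) \<bullet> b)"
    unfolding B .
qed simp

text \<open>At fixed abscissa t \<noteq> 0 the substitution y = t s contributes the factor |t|; the
  line t = 0 is null. The slope ends up as the outer variable, so that later arguments treat one
  line through the origin at a time.\<close>

lemma nn_integral_slope:
  fixes f :: "real^2 \<Rightarrow> ennreal"
  assumes [measurable]: "f \<in> borel_measurable borel"
  shows "(\<integral>\<^sup>+x. f x \<partial>lborel) = (\<integral>\<^sup>+s. \<integral>\<^sup>+t. ennreal \<bar>t\<bar> * f (t *\<^sub>R ray_dir s) \<partial>lborel \<partial>lborel)"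
proof -
  have "(\<integral>\<^sup>+x. f x \<partial>lborel) = (\<integral>\<^sup>+p. f (fst p *\<^sub>R axis 1 1 + snd p *\<^sub>R axis 2 1) \<partial>(lborel \<Otimes>\<^sub>M lborel))"
    by (subst lborel_vec2, subst nn_integral_distr) simp_all
  also have "\<dots> = (\<integral>\<^sup>+t. \<integral>\<^sup>+y. f (t *\<^sub>R axis 1 1 + y *\<^sub>R axis 2 1) \<partial>lborel \<partial>lborel)"
    by (subst lborel.nn_integral_fst[symmetric]) simp_all
  also have "\<dots> = (\<integral>\<^sup>+t. \<integral>\<^sup>+s. ennreal \<bar>t\<bar> * f (t *\<^sub>R ray_dir s) \<partial>lborel \<partial>lborel)"
  proof (rule nn_integral_cong_AE)
    have "(\<integral>\<^sup>+y. f (t *\<^sub>R axis 1 1 + y *\<^sub>R axis 2 1) \<partial>lborel)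
        = (\<integral>\<^sup>+s. ennreal \<bar>t\<bar> * f (t *\<^sub>R ray_dir s) \<partial>lborel)" if "t \<noteq> 0" for t
      by (subst nn_integral_real_affine[OF _ that, of _ 0])
         (simp_all add: nn_integral_cmult ray_dir_def scaleR_add_right)
    then show "AE t in lborel. (\<integral>\<^sup>+y. f (t *\<^sub>R axis 1 1 + y *\<^sub>R axis 2 1) \<partial>lborel)
        = (\<integral>\<^sup>+s. ennreal \<bar>t\<bar> * f (t *\<^sub>R ray_dir s) \<partial>lborel)"
      using AE_lborel_singleton[of "0::real"] by auto
  qed
  also have "\<dots> = (\<integral>\<^sup>+s. \<integral>\<^sup>+t. ennreal \<bar>t\<bar> * f (t *\<^sub>R ray_dir s) \<partial>lborel \<partial>lborel)"
    by (rule lborel_pair.Fubini') measurable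
  finally show ?thesis .
qed

text \<open>Absolute integrability of the transformed function is the nonnegative identity applied
  to |f|; Fubini then carries the signed integral through the same substitution.\<close>

lemma integrable_slope:
  fixes f :: "real^2 \<Rightarrow> real"
  assumes "integrable lborel f"
  shows "AE s in lborel. integrable lborel (\<lambda>t. \<bar>t\<bar> * f (t *\<^sub>R ray_dir s))"
    and "integral\<^sup>L lborel f = (\<integral>s. \<integral>t. \<bar>t\<bar> * f (t *\<^sub>R ray_dir s) \<partial>lborel \<partial>lborel)"
proof -
  have [measurable]: "f \<in> borel_measurable borel"
    using assms by auto
  define g where "g = (\<lambda>p. \<bar>snd p\<bar> * f (snd p *\<^sub>R ray_dir (fst p)))"
  have [measurable]: "g \<in> borel_measurable (lborel \<Otimes>\<^sub>M lborel)"
    unfolding g_def by measurable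
  have "(\<integral>\<^sup>+p. norm (g p) \<partial>(lborel \<Otimes>\<^sub>M lborel)) = (\<integral>\<^sup>+x. norm (f x) \<partial>lborel)"
    by (subst nn_integral_slope, measurable, subst lborel.nn_integral_fst[symmetric])
       (simp_all add: g_def abs_mult ennreal_mult)
  then have g: "integrable (lborel \<Otimes>\<^sub>M lborel) g"
    using assms by (simp add: integrable_iff_bounded)
  show "AE s in lborel. integrable lborel (\<lambda>t. \<bar>t\<bar> * f (t *\<^sub>R ray_dir s))"
    using lborel_pair.AE_integrable_fst'[OF g] by (simp add: g_def)
  let ?T = "\<lambda>p. fst p *\<^sub>R axis 1 1 + snd p *\<^sub>R axis 2 1 :: real^2"
  have Tm: "?T \<in> lborel \<Otimes>\<^sub>M lborel \<rightarrow>\<^sub>M borel"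
    by measurable
  have fT: "integrable (lborel \<Otimes>\<^sub>M lborel) (\<lambda>p. f (?T p))"
    using assms by (subst (asm) lborel_vec2) (simp add: integrable_distr_eq[OF Tm])
  have "integral\<^sup>L lborel f = (\<integral>p. f (?T p) \<partial>(lborel \<Otimes>\<^sub>M lborel))"
    by (subst lborel_vec2) (simp add: integral_distr[OF Tm])
  also have "\<dots> = (\<integral>t. \<integral>y. f (t *\<^sub>R axis 1 1 + y *\<^sub>R axis 2 1) \<partial>lborel \<partial>lborel)"
    using lborel_pair.integral_fst'[OF fT] by simp
  also have "\<dots> = (\<integral>t. \<integral>s. g (s, t) \<partial>lborel \<partial>lborel)"
  proof (rule integral_cong_AE)
    have "(\<integral>y. f (t *\<^sub>R axis 1 1 + y *\<^sub>R axis 2 1) \<partial>lborel) = (\<integral>s. g (s, t) \<partial>lborel)" if "t \<noteq> 0" for t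
      by (subst lborel_integral_real_affine[OF that, of _ 0])
         (simp add: g_def ray_dir_def scaleR_add_right)
    then show "AE t in lborel. (\<integral>y. f (t *\<^sub>R axis 1 1 + y *\<^sub>R axis 2 1) \<partial>lborel) = (\<integral>s. g (s, t) \<partial>lborel)"
      using AE_lborel_singleton[of "0::real"] by auto
  qed measurable
  also have "\<dots> = (\<integral>s. \<integral>t. g (s, t) \<partial>lborel \<partial>lborel)"
    using lborel_pair.Fubini_integral[of "\<lambda>s t. g (s, t)"] g by simp
  finally show "integral\<^sup>L lborel f = (\<integral>s. \<integral>t. \<bar>t\<bar> * f (t *\<^sub>R ray_dir s) \<partial>lborel \<partial>lborel)"
    by (simp add: g_def)
qed

text \<open>The measure ds / (1 + s^2) is d\<theta> for s = tan \<theta>. The total is \<pi> and not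
  2 \<pi>, since t runs over both signs and each slope stands for a whole line.\<close>

lemma nn_integral_inverse_one_plus_sq:
  "(\<integral>\<^sup>+x. ennreal (1 / (1 + x\<^sup>2)) \<partial>lborel) = ennreal pi"
proof -
  have half: "(\<integral>\<^sup>+x. ennreal (1 / (1 + x\<^sup>2)) * indicator {0..} x \<partial>lborel) = ennreal (pi / 2)"
  proof -
    have "(\<integral>\<^sup>+x. ennreal (1 / (1 + x\<^sup>2)) * indicator {0..} x \<partial>lborel) = ennreal (pi / 2 - arctan 0)"
      by (rule nn_integral_FTC_atLeast)
         (use DERIV_arctan tendsto_arctan_at_top in \<open>auto simp: inverse_eq_divide\<close>)
    then show ?thesis by simp
  qed
  have "(\<integral>\<^sup>+x. ennreal (1 / (1 + x\<^sup>2)) * indicator {..<0} x \<partial>lborel)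
      = (\<integral>\<^sup>+x. ennreal (1 / (1 + x\<^sup>2)) * indicator {0<..} x \<partial>lborel)"
    by (subst nn_integral_real_affine[of _ "-1" 0]) (auto intro!: nn_integral_cong split: split_indicator)
  also have "\<dots> = (\<integral>\<^sup>+x. ennreal (1 / (1 + x\<^sup>2)) * indicator {0..} x \<partial>lborel)"
    using AE_lborel_singleton[of "0::real"]
    by (intro nn_integral_cong_AE) (auto split: split_indicator)
  finally have half': "(\<integral>\<^sup>+x. ennreal (1 / (1 + x\<^sup>2)) * indicator {..<0} x \<partial>lborel) = ennreal (pi / 2)"
    using half by simp
  have "(\<integral>\<^sup>+x. ennreal (1 / (1 + x\<^sup>2)) \<partial>lborel)
      = (\<integral>\<^sup>+x. ennreal (1 / (1 + x\<^sup>2)) * indicator {0..} x + ennreal (1 / (1 + x\<^sup>2)) * indicator {..<0} x \<partial>lborel)"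
    by (intro nn_integral_cong) (auto split: split_indicator)
  also have "\<dots> = ennreal (pi / 2) + ennreal (pi / 2)"
    by (subst nn_integral_add) (auto simp: half half')
  also have "\<dots> = ennreal pi"
    by (subst ennreal_plus[symmetric]) auto
  finally show ?thesis .
qed

lemma integral_inverse_one_plus_sq:
  "integral\<^sup>L lborel (\<lambda>x. 1 / (1 + x\<^sup>2)) = pi"
  by (subst integral_eq_nn_integral) (auto simp: nn_integral_inverse_one_plus_sq)

text \<open>Polar coordinates for radial integrands: on the line of slope s, rescaling t by c =
  |\<open>ray_dir s\<close>| extracts 1 / c^2 = 1 / (1 + s^2). The integral over both signs of t is
  twice the radial one, so \<pi> replaces 2 \<pi>.\<close>

lemma nn_integral_radial:
  fixes f :: "real \<Rightarrow> real"
  assumes [measurable]: "f \<in> borel_measurable borel"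
  shows "(\<integral>\<^sup>+x. ennreal (f (norm (x::real^2))) \<partial>lborel)
       = ennreal pi * (\<integral>\<^sup>+t. ennreal \<bar>t\<bar> * ennreal (f \<bar>t\<bar>) \<partial>lborel)"
proof -
  define I where "I = (\<integral>\<^sup>+t. ennreal \<bar>t\<bar> * ennreal (f \<bar>t\<bar>) \<partial>lborel)"
  have "(\<integral>\<^sup>+t. ennreal \<bar>t\<bar> * ennreal (f (norm (t *\<^sub>R ray_dir s))) \<partial>lborel) = ennreal (1 / (1 + s\<^sup>2)) * I" for s
  proof -
    define c where "c = norm (ray_dir s)"
    have c: "c > 0" "c\<^sup>2 = 1 + s\<^sup>2"
      by (simp_all add: c_def)
    have "I = ennreal c * (\<integral>\<^sup>+t. ennreal \<bar>c * t\<bar> * ennreal (f \<bar>c * t\<bar>) \<partial>lborel)"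
      unfolding I_def using c by (subst nn_integral_real_affine[of _ c 0]) auto
    also have "(\<integral>\<^sup>+t. ennreal \<bar>c * t\<bar> * ennreal (f \<bar>c * t\<bar>) \<partial>lborel)
        = (\<integral>\<^sup>+t. ennreal c * (ennreal \<bar>t\<bar> * ennreal (f (norm (t *\<^sub>R ray_dir s)))) \<partial>lborel)"
      using c by (intro nn_integral_cong) (simp add: c_def[symmetric] abs_mult ennreal_mult mult_ac)
    also have "\<dots> = ennreal c * (\<integral>\<^sup>+t. ennreal \<bar>t\<bar> * ennreal (f (norm (t *\<^sub>R ray_dir s))) \<partial>lborel)"
      by (rule nn_integral_cmult) measurable
    finally have "ennreal (1 / (1 + s\<^sup>2)) * I = ennreal (1 / (1 + s\<^sup>2)) * ennreal (c\<^sup>2) *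
        (\<integral>\<^sup>+t. ennreal \<bar>t\<bar> * ennreal (f (norm (t *\<^sub>R ray_dir s))) \<partial>lborel)"
      using c(1) unfolding power2_eq_square[of c] by (simp only: ennreal_mult less_imp_le mult.assoc)
    also have "ennreal (1 / (1 + s\<^sup>2)) * ennreal (c\<^sup>2) = 1"
      unfolding c(2) using c by (subst ennreal_mult[symmetric]) (auto simp: add_nonneg_eq_0_iff)
    finally show ?thesis by simp
  qed
  then have "(\<integral>\<^sup>+x. ennreal (f (norm (x::real^2))) \<partial>lborel) = (\<integral>\<^sup>+s. ennreal (1 / (1 + s\<^sup>2)) * I \<partial>lborel)"
    by (subst nn_integral_slope) simp_all
  also have "\<dots> = ennreal pi * I"
    by (subst nn_integral_multc) (auto simp: nn_integral_inverse_one_plus_sq)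
  finally show ?thesis unfolding I_def .
qed

text \<open>The exceptional set \<open>S\<close> leaves room for corners, where a ray crosses a
  circle, and for the parameter 0, where a quotient by t carries no information.\<close>

lemma integral_half_line_derivative:
  fixes f f' :: "real \<Rightarrow> real"
  assumes cont: "continuous_on UNIV f" and S: "finite S"
    and deriv: "\<And>t. t \<notin> S \<Longrightarrow> (f has_real_derivative f' t) (at t)"
    and int: "integrable lborel f'" and lim: "(f \<longlongrightarrow> 0) at_top"
  shows "(\<integral>t. indicator {0..} t * f' t \<partial>lborel) = - f 0"
proof -
  have fin: "(LINT t:{0..b}|lborel. f' t) = f b - f 0" if "b \<ge> 0" for b
  proof -
    have "(f' has_integral (f b - f 0)) {0..b}"
      using that deriv S
      by (intro fundamental_theorem_of_calculus_interior_strong[of S])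
         (auto simp: has_real_derivative_iff_has_vector_derivative intro: continuous_on_subset[OF cont])
    moreover have "set_integrable lborel {0..b} f'"
      using int unfolding set_integrable_def by (rule integrable_mult_indicator[rotated]) simp
    ultimately show ?thesis
      by (metis has_integral_set_lebesgue integral_unique set_borel_integral_eq_integral(2))
  qed
  have "set_integrable lborel {0..} f'"
    using int unfolding set_integrable_def by (rule integrable_mult_indicator[rotated]) simp
  then have "((\<lambda>b. LINT t:{0..b}|lborel. f' t) \<longlongrightarrow> (LINT t:{0..}|lborel. f' t)) at_top"
    by (intro tendsto_set_lebesgue_integral_at_top) auto
  moreover have "((\<lambda>b. LINT t:{0..b}|lborel. f' t) \<longlongrightarrow> 0 - f 0) at_top"
    by (rule Lim_transform_eventually[where f="\<lambda>b. f b - f 0"])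
       (rule tendsto_diff[OF lim tendsto_const], rule eventually_mono[OF eventually_ge_at_top[of 0]], simp add: fin)
  ultimately have "(LINT t:{0..}|lborel. f' t) = 0 - f 0"
    by (rule tendsto_unique[OF trivial_limit_at_top_linorder])
  then show ?thesis
    by (simp add: set_lebesgue_integral_def)
qed

text \<open>The Jacobian |t| against a factor 1 / t leaves a sign. With this sign the two half-lines
  contribute - f 0 each instead of cancelling.\<close>

lemma integral_sgn_derivative:
  fixes f f' :: "real \<Rightarrow> real"
  assumes cont: "continuous_on UNIV f" and S: "finite S"
    and deriv: "\<And>t. t \<notin> S \<Longrightarrow> (f has_real_derivative f' t) (at t)"
    and int: "integrable lborel f'" and lim: "(f \<longlongrightarrow> 0) at_top" "(f \<longlongrightarrow> 0) at_bot"
  shows "(\<integral>t. sgn t * f' t \<partial>lborel) = - 2 * f 0"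
proof -
  \<comment> \<open>Reflection makes the negative half-line an instance of the half-line statement,
    for the function t \<mapsto> f (- t).\<close>
  let ?h = "\<lambda>t. - f' (- t)"
  have hi: "integrable lborel ?h"
    using lborel_integrable_real_affine[OF int, of "-1" 0] by simp
  have "(\<integral>t. indicator {0..} t * ?h t \<partial>lborel) = - f (- 0)"
  proof (rule integral_half_line_derivative[where S="uminus ` S" and f="\<lambda>t. f (- t)"])
    show "continuous_on UNIV (\<lambda>t. f (- t))"
      by (intro continuous_on_compose2[OF cont] continuous_intros) auto
    show "((\<lambda>t. f (- t)) \<longlongrightarrow> 0) at_top"
      by (rule filterlim_compose[OF lim(2) filterlim_uminus_at_bot_at_top])
    fix t assume "t \<notin> uminus ` S"
    then have "- t \<notin> S" by force
    then show "((\<lambda>t. f (- t)) has_real_derivative ?h t) (at t)"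
      using deriv DERIV_mirror[of f "f' (- t)" t] by simp
  qed (use S hi in auto)
  then have neg: "(\<integral>t. indicator {0..} t * ?h t \<partial>lborel) = - f 0" by simp
  have pos: "(\<integral>t. indicator {0..} t * f' t \<partial>lborel) = - f 0"
    by (rule integral_half_line_derivative[OF cont S deriv int lim(1)])
  have i1: "integrable lborel (\<lambda>t. indicator {0..} t * f' t)"
    using integrable_mult_indicator[OF _ int, of "{0..}"] by simp
  have i2: "integrable lborel (\<lambda>t. indicator {..0} t * f' t)"
    using integrable_mult_indicator[OF _ int, of "{..0}"] by simp
  have "(\<integral>t. indicator {..0} t * f' t \<partial>lborel) = (\<integral>t. indicator {0..} t * f' (- t) \<partial>lborel)"
    by (subst lborel_integral_real_affine[of "-1" _ 0]) (auto intro!: Bochner_Integration.integral_cong split: split_indicator)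
  also have "\<dots> = f 0"
    using neg by simp
  finally have neg': "(\<integral>t. indicator {..0} t * f' t \<partial>lborel) = f 0" .
  have "(\<integral>t. sgn t * f' t \<partial>lborel)
      = (\<integral>t. indicator {0..} t * f' t - indicator {..0} t * f' t \<partial>lborel)"
  proof (rule integral_cong_AE)
    show "AE t in lborel. sgn t * f' t = indicator {0..} t * f' t - indicator {..0} t * f' t"
      using AE_lborel_singleton[of "0::real"] by (auto simp: sgn_if split: split_indicator)
  qed (use int in measurable)
  also have "\<dots> = - 2 * f 0"
    using i1 i2 by (simp add: pos neg')
  finally show ?thesis .
qed

text \<open>Here \<open>q\<close> stands for x \<bullet> \<nabla>F(x), so \<open>q / t\<close> is
  the derivative along the ray, and |t| q / |x|^2 equals sgn t / (1 + s^2) times it. The conditions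
  are imposed for almost every slope because the logarithms to be inserted are singular at points
  away from the origin, each lying on at most one of the lines.\<close>

lemma integral_radial_derivative:
  fixes F q :: "real^2 \<Rightarrow> real"
  assumes int: "integrable lborel (\<lambda>x. q x / (norm x)\<^sup>2)"
    and cont: "AE s in lborel. continuous_on UNIV (\<lambda>t. F (t *\<^sub>R ray_dir s))"
    and deriv: "AE s in lborel. \<exists>S. finite S \<and>
      (\<forall>t. t \<notin> S \<longrightarrow> ((\<lambda>t. F (t *\<^sub>R ray_dir s)) has_real_derivative q (t *\<^sub>R ray_dir s) / t) (at t))"
    and top: "AE s in lborel. ((\<lambda>t. F (t *\<^sub>R ray_dir s)) \<longlongrightarrow> 0) at_top"
    and bot: "AE s in lborel. ((\<lambda>t. F (t *\<^sub>R ray_dir s)) \<longlongrightarrow> 0) at_bot"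
  shows "(\<integral>x. q x / (norm x)\<^sup>2 \<partial>lborel) = - 2 * pi * F 0"
proof -
  let ?g = "\<lambda>s t. \<bar>t\<bar> * (q (t *\<^sub>R ray_dir s) / (norm (t *\<^sub>R ray_dir s))\<^sup>2)"
  have [measurable]: "(\<lambda>x. q x / (norm x)\<^sup>2) \<in> borel_measurable borel"
    using int by auto
  have "(\<integral>x. q x / (norm x)\<^sup>2 \<partial>lborel) = (\<integral>s. \<integral>t. ?g s t \<partial>lborel \<partial>lborel)"
    by (rule integrable_slope(2)[OF int])
  also have "\<dots> = (\<integral>s. 1 / (1 + s\<^sup>2) * (- 2 * F 0) \<partial>lborel)"
  proof (rule integral_cong_AE)
    show "(\<lambda>s. \<integral>t. ?g s t \<partial>lborel) \<in> borel_measurable lborel"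
      by measurable
    show "AE s in lborel. (\<integral>t. ?g s t \<partial>lborel) = 1 / (1 + s\<^sup>2) * (- 2 * F 0)"
      using integrable_slope(1)[OF int] cont deriv top bot
    proof eventually_elim
      case (elim s)
      let ?f' = "\<lambda>t. q (t *\<^sub>R ray_dir s) / t"
      have g: "?g s t = 1 / (1 + s\<^sup>2) * (sgn t * ?f' t)" for t
        by (simp add: power_mult_distrib sgn_if power2_eq_square[of t])
      have f': "?f' t = (1 + s\<^sup>2) * (sgn t * ?g s t)" for t
        using sum_power2_gt_zero_iff[of 1 s]
        unfolding g by (simp add: sgn_if)
      \<comment> \<open>Fubini controls only the weighted derivative; multiplying back by sgn t and
        1 + s^2 makes \<open>?f'\<close> integrable on this ray.\<close>
      have "integrable lborel (\<lambda>t. sgn t * ?g s t)"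
      proof (rule Bochner_Integration.integrable_bound[OF elim(1)])
        show "(\<lambda>t. sgn t * ?g s t) \<in> borel_measurable lborel"
          by (rule borel_measurable_times[OF _ borel_measurable_integrable[OF elim(1)]]) measurable
      qed (auto simp: abs_mult sgn_if)
      then have "integrable lborel ?f'"
        unfolding f' by (rule integrable_mult_right)
      with elim(2-5) have "(\<integral>t. sgn t * ?f' t \<partial>lborel) = - 2 * F (0 *\<^sub>R ray_dir s)"
        by (elim exE conjE, intro integral_sgn_derivative) auto
      then show ?case
        unfolding g by (simp only: integral_mult_right_zero scaleR_zero_left)
    qed
  qed measurable
  also have "\<dots> = - 2 * pi * F 0"
    by (simp only: integral_mult_left_zero integral_inverse_one_plus_sq)
  finally show ?thesis .
qed

section \<open>Estimates for the Biot--Savart kernel\<close>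

lemma ball_borel [measurable]: "ball c r \<in> sets borel" "cball c r \<in> sets borel"
  for c :: "'a::metric_space"
  by (auto intro: borel_open borel_closed)

section \<open>Invariance of Lebesgue measure under reflections and translations\<close>

lemma distr_lborel_reflect:
  fixes c :: "'a::euclidean_space"
  shows "distr lborel borel (\<lambda>x. c - x) = lborel"
  by (subst lborel_affine[of "-1" c]) (auto simp: density_1)

lemma distr_lborel_translate:
  fixes c :: "'a::euclidean_space"
  shows "distr lborel borel (\<lambda>x. x + c) = lborel"
  by (subst lborel_affine[of 1 c]) (auto simp: density_1 add.commute)

lemma nn_integral_reflect:
  fixes c :: "'a::euclidean_space"
  assumes "f \<in> borel_measurable borel"
  shows "(\<integral>\<^sup>+x. f (c - x) \<partial>lborel) = (\<integral>\<^sup>+x. f x \<partial>lborel)"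
  using assms by (subst (2) distr_lborel_reflect[of c, symmetric]) (simp add: nn_integral_distr)

lemma integral_reflect:
  fixes c :: "'a::euclidean_space" and f :: "'a \<Rightarrow> 'b::{banach, second_countable_topology}"
  assumes "f \<in> borel_measurable borel"
  shows "(\<integral>x. f (c - x) \<partial>lborel) = (\<integral>x. f x \<partial>lborel)"
  using assms by (subst (2) distr_lborel_reflect[of c, symmetric]) (simp add: integral_distr)

lemma integral_translate:
  fixes c :: "'a::euclidean_space" and f :: "'a \<Rightarrow> 'b::{banach, second_countable_topology}"
  assumes "f \<in> borel_measurable borel"
  shows "(\<integral>x. f (x + c) \<partial>lborel) = (\<integral>x. f x \<partial>lborel)"
  using assms by (subst (2) distr_lborel_translate[of c, symmetric]) (simp add: integral_distr)

lemma integrable_translate: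
  fixes c :: "'a::euclidean_space" and f :: "'a \<Rightarrow> 'b::{banach, second_countable_topology}"
  assumes "integrable lborel f"
  shows "integrable lborel (\<lambda>x. f (x + c))"
  using assms by (intro integrable_distr[of "\<lambda>x. x + c" lborel borel]) (simp_all add: distr_lborel_translate)

lemma AE_translate:
  fixes c :: "'a::euclidean_space"
  assumes "AE x in lborel. P x"
  shows "AE x in lborel. P (x + c)"
proof -
  obtain N where N: "N \<in> null_sets lborel" "{x. \<not> P x} \<subseteq> N"
    using assms by (auto simp: eventually_ae_filter)
  have "emeasure lborel ((\<lambda>x. x + c) -` N) = emeasure (distr lborel borel (\<lambda>x. x + c)) N"
    using N(1) by (subst emeasure_distr) auto
  then have "(\<lambda>x. x + c) -` N \<in> null_sets lborel"
    using N(1) measurable_sets[of "\<lambda>x. x + c" lborel borel N]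
    by (auto simp: distr_lborel_translate null_sets_def)
  then show ?thesis
    using N(2) by (auto simp: eventually_ae_filter intro!: bexI[of _ "(\<lambda>x. x + c) -` N"])
qed

section \<open>Size of the kernel and of its increments\<close>

lemma perp_nth [simp]: "perp x $ 1 = - x $ 2" "perp x $ 2 = x $ 1"
  by (simp_all add: perp_def)

lemma biot_savart_kernel_nth:
  "biot_savart_kernel x $ 1 = - x $ 2 / (2 * pi * (norm x)\<^sup>2)"
  "biot_savart_kernel x $ 2 = x $ 1 / (2 * pi * (norm x)\<^sup>2)"
  by (simp_all add: biot_savart_kernel_def)

lemma biot_savart_kernel_inner:
  "biot_savart_kernel x \<bullet> biot_savart_kernel y = x \<bullet> y / (4 * pi\<^sup>2 * (norm x)\<^sup>2 * (norm y)\<^sup>2)"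
proof -
  have "u / (2 * pi * a) * (v / (2 * pi * b)) = u * v / (4 * pi\<^sup>2 * a * b)" for u v a b
    by (simp add: power2_eq_square)
  then show ?thesis
    by (simp only: inner_vec2 biot_savart_kernel_nth add_divide_distrib minus_mult_minus)
qed

lemma norm_biot_savart_kernel: "norm (biot_savart_kernel x) = 1 / (2 * pi * norm x)"
proof -
  have "(norm (biot_savart_kernel x))\<^sup>2 = (1 / (2 * pi * norm x))\<^sup>2"
    unfolding power2_norm_eq_inner[of "biot_savart_kernel x"] biot_savart_kernel_inner
    by (cases "x = 0") (simp_all add: dot_square_norm power_divide power_mult_distrib power2_eq_square)
  then show ?thesis
    by (simp add: power2_eq_iff_nonneg)
qed

lemma norm_biot_savart_kernel_le: "norm (biot_savart_kernel x) \<le> 1 / norm x"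
  using pi_gt3 by (cases "x = 0") (auto simp: norm_biot_savart_kernel divide_simps)

text \<open>Up to a quarter turn and the factor 1 / (2 \<pi>), the kernel is the inversion x /
  |x|^2, which scales the distance of two points by exactly 1 / (|x| |y|). The two denominators are
  the source of the extra power of decay of increments.\<close>

lemma norm_biot_savart_kernel_diff:
  assumes "x \<noteq> 0" "y \<noteq> 0"
  shows "norm (biot_savart_kernel x - biot_savart_kernel y) = norm (x - y) / (2 * pi * norm x * norm y)"
proof -
  \<comment> \<open>To be read with a = |x|^2, b = |y|^2, c = x \<bullet> y and P = 4
    \<pi>^2.\<close>
  have field: "a / (P * a * a) - c / (P * b * a) - (c / (P * a * b) - b / (P * b * b)) = (b + a - 2 * c) / (P * a * b)"
    if "a \<noteq> 0" "b \<noteq> 0" "P \<noteq> 0" for a b c P :: real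
    using that by (simp add: divide_simps)
  have "(norm (biot_savart_kernel x - biot_savart_kernel y))\<^sup>2
      = ((norm y)\<^sup>2 + (norm x)\<^sup>2 - 2 * (x \<bullet> y)) / (4 * pi\<^sup>2 * (norm x)\<^sup>2 * (norm y)\<^sup>2)"
    unfolding power2_norm_eq_inner[of "biot_savart_kernel x - biot_savart_kernel y"]
      inner_diff_left inner_diff_right biot_savart_kernel_inner dot_square_norm[of x] dot_square_norm[of y]
      inner_commute[of y x]
    by (rule field) (use assms in auto)
  also have "\<dots> = (norm (x - y) / (2 * pi * norm x * norm y))\<^sup>2"
    by (simp add: power_divide power_mult_distrib power2_norm_eq_inner inner_diff_left inner_diff_right inner_commute)
  finally show ?thesis
    by (simp add: power2_eq_iff_nonneg)
qed

lemma norm_biot_savart_kernel_diff_le: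
  assumes "x \<noteq> 0" "y \<noteq> 0"
  shows "norm (biot_savart_kernel x - biot_savart_kernel y) \<le> norm (x - y) / (norm x * norm y)"
proof -
  define c where "c = norm (x - y) / (norm x * norm y)"
  have "c * 1 \<le> c * (2 * pi)"
    using pi_gt3 by (intro mult_left_mono) (auto simp: c_def)
  then have "c / (2 * pi) \<le> c"
    by (subst pos_divide_le_eq) auto
  then show ?thesis
    unfolding norm_biot_savart_kernel_diff[OF assms] c_def by (simp add: mult_ac)
qed

lemma biot_savart_kernel_measurable [measurable]: "biot_savart_kernel \<in> borel_measurable borel"
proof -
  have "biot_savart_kernel = (\<lambda>x. (1 / (2 * pi)) *\<^sub>R ((1 / (norm x)\<^sup>2) *\<^sub>R
      ((- (x \<bullet> axis 2 1)) *\<^sub>R axis 1 1 + (x \<bullet> axis 1 1) *\<^sub>R axis 2 1)))"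
    unfolding inner_axis by (auto simp: fun_eq_iff biot_savart_kernel_def vec_eq_iff forall_2 axis_def)
  moreover have "\<dots> \<in> borel_measurable borel"
    by measurable
  ultimately show ?thesis by (metis (no_types))
qed

section \<open>Planar integrals of negative powers of the norm\<close>

lemma inverse_norm_locally_integrable:
  "(\<integral>\<^sup>+x. indicator (ball 0 1) (x::real^2) * ennreal (1 / norm x) \<partial>lborel) < \<infinity>"
proof -
  let ?f = "\<lambda>t::real. if t < 1 then 1 / t else 0"
  have "(\<integral>\<^sup>+x. indicator (ball 0 1) (x::real^2) * ennreal (1 / norm x) \<partial>lborel)
      = (\<integral>\<^sup>+x. ennreal (?f (norm (x::real^2))) \<partial>lborel)"
    by (intro nn_integral_cong) (auto split: split_indicator)
  also have "\<dots> = ennreal pi * (\<integral>\<^sup>+t. ennreal \<bar>t\<bar> * ennreal (?f \<bar>t\<bar>) \<partial>lborel)"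
    by (rule nn_integral_radial) measurable
  also have "(\<integral>\<^sup>+t. ennreal \<bar>t\<bar> * ennreal (?f \<bar>t\<bar>) \<partial>lborel) \<le> (\<integral>\<^sup>+t. indicator {-1..1::real} t \<partial>lborel)"
    by (intro nn_integral_mono) (auto split: split_indicator simp flip: ennreal_mult)
  then have "ennreal pi * (\<integral>\<^sup>+t. ennreal \<bar>t\<bar> * ennreal (?f \<bar>t\<bar>) \<partial>lborel) \<le> ennreal pi * 2"
    by (intro mult_left_mono) auto
  also have "\<dots> < \<infinity>"
    by (simp add: ennreal_mult_less_top)
  finally show ?thesis .
qed

lemma cubic_decay_integrable:
  "(\<integral>\<^sup>+x. ennreal (1 / (1 + norm (x::real^2)) ^ 3) \<partial>lborel) < \<infinity>"
proof -
  have "(\<integral>\<^sup>+x. ennreal (1 / (1 + norm (x::real^2)) ^ 3) \<partial>lborel)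
      = ennreal pi * (\<integral>\<^sup>+t. ennreal \<bar>t\<bar> * ennreal (1 / (1 + \<bar>t\<bar>) ^ 3) \<partial>lborel)"
    by (rule nn_integral_radial) measurable
  also have "(\<integral>\<^sup>+t. ennreal \<bar>t\<bar> * ennreal (1 / (1 + \<bar>t\<bar>) ^ 3) \<partial>lborel)
      \<le> (\<integral>\<^sup>+t. ennreal (1 / (1 + t\<^sup>2)) \<partial>lborel)"
  proof (intro nn_integral_mono)
    fix t :: real
    have pos: "0 < 1 + t\<^sup>2"
      by (simp add: add_pos_nonneg)
    \<comment> \<open>Of the expanded cube only |t| + |t|^3 is kept, which leads to the arctangent
      integral.\<close>
    have "(1 + \<bar>t\<bar>) ^ 3 = \<bar>t\<bar> * (1 + \<bar>t\<bar>\<^sup>2) + 1 + 2 * \<bar>t\<bar> + 3 * \<bar>t\<bar>\<^sup>2"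
      by (simp add: power2_eq_square power3_eq_cube algebra_simps)
    then have "\<bar>t\<bar> * (1 + t\<^sup>2) \<le> (1 + \<bar>t\<bar>) ^ 3"
      by simp
    then have "\<bar>t\<bar> * (1 / (1 + \<bar>t\<bar>) ^ 3) \<le> 1 / (1 + t\<^sup>2)"
      using pos by (simp add: divide_simps)
    then show "ennreal \<bar>t\<bar> * ennreal (1 / (1 + \<bar>t\<bar>) ^ 3) \<le> ennreal (1 / (1 + t\<^sup>2))"
      by (simp flip: ennreal_mult)
  qed
  then have "ennreal pi * (\<integral>\<^sup>+t. ennreal \<bar>t\<bar> * ennreal (1 / (1 + \<bar>t\<bar>) ^ 3) \<partial>lborel) \<le> ennreal pi * ennreal pi"
    unfolding nn_integral_inverse_one_plus_sq by (intro mult_left_mono) auto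
  also have "\<dots> < \<infinity>"
    by (simp add: ennreal_mult_less_top)
  finally show ?thesis .
qed

lemma emeasure_ball_finite: "emeasure lborel (ball (c::'a::euclidean_space) R) < \<infinity>"
  using emeasure_bounded_finite[of "ball c R"] by simp

text \<open>The integrand is split at |x - y| = 1: the near part is bounded by a reflected copy of
  the integral over the unit ball, independent of x, and the far part by the area of the
  ball.\<close>

lemma newtonian_bound:
  "\<exists>A\<ge>0. \<forall>x. (\<integral>\<^sup>+y. indicator (ball 0 R) y * ennreal (1 / norm (x - (y::real^2))) \<partial>lborel) \<le> ennreal A"
proof -
  let ?I = "\<integral>\<^sup>+x. indicator (ball 0 1) (x::real^2) * ennreal (1 / norm x) \<partial>lborel"
  let ?B = "emeasure lborel (ball (0::real^2) R)"
  have bound: "(\<integral>\<^sup>+y. indicator (ball 0 R) y * ennreal (1 / norm (x - (y::real^2))) \<partial>lborel) \<le> ?I + ?B" for x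
  proof -
    have "(\<integral>\<^sup>+y. indicator (ball 0 R) y * ennreal (1 / norm (x - (y::real^2))) \<partial>lborel)
        \<le> (\<integral>\<^sup>+y. indicator (ball 0 1) (x - y) * ennreal (1 / norm (x - y)) + indicator (ball 0 R) y \<partial>lborel)"
    proof (intro nn_integral_mono)
      fix y :: "real^2"
      show "indicator (ball 0 R) y * ennreal (1 / norm (x - y))
          \<le> indicator (ball 0 1) (x - y) * ennreal (1 / norm (x - y)) + indicator (ball 0 R) y"
      proof (cases "norm (x - y) < 1")
        case True
        then show ?thesis by (auto split: split_indicator)
      next
        case False
        then have "ennreal (1 / norm (x - y)) \<le> ennreal 1"
          by (intro ennreal_leI) (simp add: divide_simps)
        with False show ?thesis by (auto split: split_indicator)
      qed
    qed
    also have "\<dots> = (\<integral>\<^sup>+y. indicator (ball 0 1) (x - y) * ennreal (1 / norm (x - y)) \<partial>lborel) + ?B"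
      by (subst nn_integral_add) auto
    also have "(\<integral>\<^sup>+y. indicator (ball 0 1) (x - y) * ennreal (1 / norm (x - y)) \<partial>lborel) = ?I"
      by (rule nn_integral_reflect[where f="\<lambda>x. indicator (ball 0 1) x * ennreal (1 / norm x)"]) measurable
    finally show ?thesis .
  qed
  have "?I + ?B < \<infinity>"
    using inverse_norm_locally_integrable emeasure_ball_finite[of "0::real^2" R] by simp
  then obtain A where "A \<ge> 0" "?I + ?B = ennreal A"
    by (cases "?I + ?B") auto
  then show ?thesis using bound by auto
qed

lemma newtonian_decay:
  "\<exists>A\<ge>0. \<forall>x. (\<integral>\<^sup>+y. indicator (ball 0 R) y * ennreal (1 / norm (x - (y::real^2))) \<partial>lborel)
     \<le> ennreal (A / (1 + norm x))"
proof -
  let ?L = "\<lambda>x. \<integral>\<^sup>+y. indicator (ball 0 R) y * ennreal (1 / norm (x - (y::real^2))) \<partial>lborel"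
  obtain A where A: "A \<ge> 0" "\<And>x. ?L x \<le> ennreal A"
    using newtonian_bound[of R] by blast
  define V where "V = measure lborel (ball (0::real^2) R)"
  have V: "emeasure lborel (ball (0::real^2) R) = ennreal V"
    unfolding V_def by (rule emeasure_eq_ennreal_measure) (use emeasure_ball_finite[of "0::real^2" R] in auto)
  have V0: "V \<ge> 0" by (simp add: V_def)
  \<comment> \<open>For |x| > M and |y| < R one has 1 + |x| \<le> 4 |x - y|, whence the 4 in
    \<open>A'\<close>. Inside radius M the constant bound A is kept, at the cost of the factor 1 +
    M.\<close>
  define M where "M = 1 + 2 * \<bar>R\<bar>"
  define A' where "A' = A * (1 + M) + 4 * V"
  have "?L x \<le> ennreal (A' / (1 + norm x))" for x
  proof (cases "norm x \<le> M")
    case True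
    have "A * (1 + norm x) \<le> A * (1 + M)"
      using True A by (intro mult_left_mono) auto
    then have "A * (1 + norm x) \<le> A'"
      using V0 by (simp add: A'_def)
    then have "A \<le> A' / (1 + norm x)"
      by (subst pos_le_divide_eq) (auto simp: add_pos_nonneg)
    then show ?thesis
      using A(2)[of x] ennreal_leI order_trans by blast
  next
    case False
    have "?L x \<le> (\<integral>\<^sup>+y. indicator (ball 0 R) (y::real^2) * ennreal (4 / (1 + norm x)) \<partial>lborel)"
    proof (intro nn_integral_mono)
      fix y :: "real^2"
      have "1 / norm (x - y) \<le> 4 / (1 + norm x)" if "norm y < R"
      proof -
        have "norm x \<le> norm (x - y) + norm y"
          by (metis diff_add_cancel norm_triangle_ineq)
        with that False have "1 + norm x \<le> 4 * norm (x - y)" "norm (x - y) > 0" by (auto simp: M_def)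
        then show ?thesis by (simp add: divide_simps add_pos_nonneg)
      qed
      then show "indicator (ball 0 R) y * ennreal (1 / norm (x - y)) \<le> indicator (ball 0 R) y * ennreal (4 / (1 + norm x))"
        by (auto split: split_indicator intro!: ennreal_leI)
    qed
    also have "\<dots> = ennreal (V * (4 / (1 + norm x)))"
      using V0 by (subst nn_integral_multc) (auto simp add: V simp flip: ennreal_mult)
    also have "\<dots> \<le> ennreal (A' / (1 + norm x))"
      using A V0 by (intro ennreal_leI) (auto simp: A'_def M_def divide_right_mono)
    finally show ?thesis .
  qed
  moreover have "A' \<ge> 0"
    using A V0 by (simp add: A'_def M_def)
  ultimately show ?thesis by blast
qed

text \<open>For large |x| the distance formula for the kernel gives |h| over two factors of size
  |x|. For bounded x the two singular terms are estimated separately. The constant is uniform over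
  |h| \<le> r because an average over h follows.\<close>

lemma kernel_difference_decay:
  "\<exists>A\<ge>0. \<forall>x h. norm h \<le> r \<longrightarrow>
     (\<integral>\<^sup>+y. indicator (ball 0 R) y * ennreal (norm (biot_savart_kernel (x + h - y) - biot_savart_kernel (x - y))) \<partial>lborel)
     \<le> ennreal (A / (1 + norm x)\<^sup>2)"
proof -
  let ?N = "\<lambda>x. \<integral>\<^sup>+y. indicator (ball 0 R) y * ennreal (1 / norm (x - (y::real^2))) \<partial>lborel"
  let ?L = "\<lambda>x h. \<integral>\<^sup>+y. indicator (ball 0 R) y * ennreal (norm (biot_savart_kernel (x + h - y) - biot_savart_kernel (x - y))) \<partial>lborel"
  obtain A where A: "A \<ge> 0" "\<And>x. ?N x \<le> ennreal A"
    using newtonian_bound[of R] by blast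
  define V where "V = measure lborel (ball (0::real^2) R)"
  have V: "emeasure lborel (ball (0::real^2) R) = ennreal V"
    unfolding V_def by (rule emeasure_eq_ennreal_measure) (use emeasure_ball_finite[of "0::real^2" R] in auto)
  have V0: "V \<ge> 0" by (simp add: V_def)
  define M where "M = 1 + 2 * (\<bar>R\<bar> + \<bar>r\<bar>)"
  \<comment> \<open>Far out, |x - y| and |x + h - y| are both at least (1 + |x|) / 4, so the two
    denominators give 16; the other term pays for (1 + |x|)^2 on the bounded region.\<close>
  define A' where "A' = 2 * A * (1 + M)\<^sup>2 + 16 * \<bar>r\<bar> * V"
  have "?L x h \<le> ennreal (A' / (1 + norm x)\<^sup>2)" if h: "norm h \<le> r" for x h
  proof (cases "norm x \<le> M")
    case True
    have "?L x h \<le> (\<integral>\<^sup>+y. indicator (ball 0 R) y * ennreal (1 / norm (x + h - y))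
        + indicator (ball 0 R) y * ennreal (1 / norm (x - y)) \<partial>lborel)"
    proof (intro nn_integral_mono)
      fix y :: "real^2"
      have "norm (biot_savart_kernel (x + h - y) - biot_savart_kernel (x - y)) \<le> 1 / norm (x + h - y) + 1 / norm (x - y)"
        by (rule order_trans[OF norm_triangle_ineq4]) (intro add_mono norm_biot_savart_kernel_le)
      then show "indicator (ball 0 R) y * ennreal (norm (biot_savart_kernel (x + h - y) - biot_savart_kernel (x - y)))
        \<le> indicator (ball 0 R) y * ennreal (1 / norm (x + h - y)) + indicator (ball 0 R) y * ennreal (1 / norm (x - y))"
        by (auto split: split_indicator simp flip: ennreal_plus intro!: ennreal_leI)
    qed
    also have "\<dots> = ?N (x + h) + ?N x"
      by (rule nn_integral_add) measurable
    also have "\<dots> \<le> ennreal A + ennreal A"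
      by (intro add_mono A)
    also have "\<dots> = ennreal (2 * A)"
      using A by (simp flip: ennreal_plus)
    also have "\<dots> \<le> ennreal (A' / (1 + norm x)\<^sup>2)"
    proof (rule ennreal_leI)
      have "(2 * A) * (1 + norm x)\<^sup>2 \<le> (2 * A) * (1 + M)\<^sup>2"
        using True A by (intro mult_left_mono power_mono) auto
      then have "(2 * A) * (1 + norm x)\<^sup>2 \<le> A'"
        using mult_nonneg_nonneg[of "16 * \<bar>r\<bar>" V] V0 unfolding A'_def by linarith
      then show "2 * A \<le> A' / (1 + norm x)\<^sup>2"
        by (subst pos_le_divide_eq) (auto simp: add_nonneg_eq_0_iff)
    qed
    finally show ?thesis .
  next
    case False
    have "?L x h \<le> (\<integral>\<^sup>+y. indicator (ball 0 R) (y::real^2) * ennreal (16 * \<bar>r\<bar> / (1 + norm x)\<^sup>2) \<partial>lborel)"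
    proof (intro nn_integral_mono)
      fix y :: "real^2"
      have "norm (biot_savart_kernel (x + h - y) - biot_savart_kernel (x - y)) \<le> 16 * \<bar>r\<bar> / (1 + norm x)\<^sup>2" if "norm y < R"
      proof -
        have "norm x \<le> norm (x - y) + norm y"
          by (metis diff_add_cancel norm_triangle_ineq)
        moreover have "norm x \<le> norm (x + h - y) + norm y + norm h"
          using norm_triangle_ineq4[of "x + h - y" h] norm_triangle_ineq[of "x - y" y] by simp
        ultimately have *: "(1 + norm x) / 4 \<le> norm (x - y)" "(1 + norm x) / 4 \<le> norm (x + h - y)"
          using that False h by (auto simp: M_def)
        have pos: "1 + norm x > 0" by (simp add: add_pos_nonneg)
        then have nz: "x + h - y \<noteq> 0" "x - y \<noteq> 0"
          using * by auto
        have "norm (biot_savart_kernel (x + h - y) - biot_savart_kernel (x - y))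
            \<le> norm ((x + h - y) - (x - y)) / (norm (x + h - y) * norm (x - y))"
          by (rule norm_biot_savart_kernel_diff_le[OF nz])
        also have "\<dots> \<le> \<bar>r\<bar> / ((1 + norm x) / 4 * ((1 + norm x) / 4))"
          using h * pos by (intro frac_le mult_mono mult_pos_pos) auto
        also have "\<dots> = 16 * \<bar>r\<bar> / (1 + norm x)\<^sup>2"
          by (simp add: power2_eq_square)
        finally show ?thesis .
      qed
      then show "indicator (ball 0 R) y * ennreal (norm (biot_savart_kernel (x + h - y) - biot_savart_kernel (x - y)))
         \<le> indicator (ball 0 R) y * ennreal (16 * \<bar>r\<bar> / (1 + norm x)\<^sup>2)"
        by (auto split: split_indicator intro!: ennreal_leI)
    qed
    also have "\<dots> = ennreal (V * (16 * \<bar>r\<bar> / (1 + norm x)\<^sup>2))"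
      using V0 by (subst nn_integral_multc) (auto simp add: V simp flip: ennreal_mult)
    also have "\<dots> \<le> ennreal (A' / (1 + norm x)\<^sup>2)"
      using A V0 by (intro ennreal_leI) (auto simp: A'_def M_def intro!: divide_right_mono)
    finally show ?thesis .
  qed
  moreover have "A' \<ge> 0"
    using A V0 by (simp add: A'_def M_def)
  ultimately show ?thesis by blast
qed

section \<open>The kernel correlation and the mean value of the logarithm\<close>

text \<open>A line of finite slope through the origin can meet p only if its slope is p_2 / p_1, so
  all slopes but at most one avoid p.\<close>

lemma AE_ray_avoids:
  assumes "p \<noteq> (0::real^2)"
  shows "AE s in lborel. \<forall>t. t *\<^sub>R ray_dir s \<noteq> p"
proof -
  have "s = p $ 2 / p $ 1" if "t *\<^sub>R ray_dir s = p" for s t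
    using that assms by (cases "p $ 1 = 0") (auto simp: vec_eq_iff forall_2 field_simps)
  then show ?thesis
    using AE_lborel_singleton[of "p $ 2 / p $ 1"] by (auto elim!: eventually_mono)
qed

section \<open>Logarithms of the distance along a line\<close>

lemma norm_add_scaleR_sq:
  fixes a e :: "'a::real_inner"
  shows "(norm (a + t *\<^sub>R e))\<^sup>2 = (norm a)\<^sup>2 + 2 * t * (a \<bullet> e) + t\<^sup>2 * (norm e)\<^sup>2"
  unfolding power2_norm_eq_inner
  by (simp add: inner_add_left inner_add_right inner_commute power2_eq_square algebra_simps)

lemma DERIV_norm_sq:
  fixes a e :: "'a::real_inner"
  shows "((\<lambda>t. (norm (a + t *\<^sub>R e))\<^sup>2) has_real_derivative 2 * (e \<bullet> (a + t *\<^sub>R e))) (at t)"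
  unfolding norm_add_scaleR_sq
  by (auto intro!: derivative_eq_intros simp: inner_add_right inner_commute power2_norm_eq_inner)

text \<open>Along a line the squared norm is a quadratic polynomial, so derivatives and limits of
  the logarithm need no square root. The case x = 0 rests on the convention that \<open>ln 0\<close>
  is 0.\<close>

lemma ln_norm_eq: "ln (norm x) = ln ((norm x)\<^sup>2) / 2"
  by (cases "x = 0") (simp_all add: ln_realpow)

lemma DERIV_ln_norm:
  fixes a e :: "'a::real_inner"
  assumes "a + t *\<^sub>R e \<noteq> 0"
  shows "((\<lambda>t. ln (norm (a + t *\<^sub>R e))) has_real_derivative e \<bullet> (a + t *\<^sub>R e) / (norm (a + t *\<^sub>R e))\<^sup>2) (at t)"
proof -
  have "0 < (norm (a + t *\<^sub>R e))\<^sup>2" using assms by simp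
  from DERIV_cdivide[OF DERIV_chain2[OF DERIV_ln_divide[OF this] DERIV_norm_sq], of 2]
  show ?thesis
    unfolding ln_norm_eq by (rule DERIV_cong) simp
qed

text \<open>Both squared norms are quadratics in t with the same leading coefficient |e|^2, so their
  ratio tends to 1.\<close>

lemma ln_norm_diff_tendsto:
  fixes p q e :: "'a::real_inner"
  assumes "e \<noteq> 0"
  shows "((\<lambda>t. ln (norm (p + t *\<^sub>R e)) - ln (norm (q + t *\<^sub>R e))) \<longlongrightarrow> 0) at_top"
proof -
  have "norm e > 0" using assms by simp
  then show ?thesis
    unfolding ln_norm_eq norm_add_scaleR_sq by real_asymp
qed

text \<open>The term x controls large arguments and 1 / x small ones. As 1 / |x| is locally
  integrable in the plane, logarithms inherit integrability from the Newtonian bounds.\<close>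

lemma abs_ln_le:
  fixes x :: real
  assumes "x \<ge> 0"
  shows "\<bar>ln x\<bar> \<le> x + 1 / x"
proof (cases "x = 0")
  case False
  with assms have x: "x > 0" by simp
  have "1 / x > 0" using x by simp
  moreover have "- ln x \<le> 1 / x - 1"
    using ln_le_minus_one[of "1 / x"] x by (simp add: ln_div)
  moreover have "ln x \<le> x - 1"
    using x by (rule ln_le_minus_one)
  ultimately show ?thesis
    using x unfolding abs_le_iff by linarith
qed simp

text \<open>With F(x) = ln|x - q| - ln|x - p| the integrand is - x \<bullet> \<nabla>F / (4 \<pi>^2
  |x|^2), which the radial identity evaluates as F(0) / (2 \<pi>). A single translate of the kernel
  would not do: the product would decay only like |x|^-2, and ln|x - p| is unbounded along
  rays.\<close>

lemma integral_kernel_inner_difference: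
  assumes p: "p \<noteq> 0" and q: "q \<noteq> 0"
    and int: "integrable lborel (\<lambda>x. biot_savart_kernel x \<bullet> (biot_savart_kernel (x - p) - biot_savart_kernel (x - q)))"
  shows "(\<integral>x. biot_savart_kernel x \<bullet> (biot_savart_kernel (x - p) - biot_savart_kernel (x - q)) \<partial>lborel)
     = (ln (norm q) - ln (norm p)) / (2 * pi)"
proof -
  define F where "F x = ln (norm (x - q)) - ln (norm (x - p))" for x :: "real^2"
  define Q where "Q x = x \<bullet> ((1 / (norm (x - q))\<^sup>2) *\<^sub>R (x - q) - (1 / (norm (x - p))\<^sup>2) *\<^sub>R (x - p))" for x
  have eq: "biot_savart_kernel x \<bullet> (biot_savart_kernel (x - p) - biot_savart_kernel (x - q))
      = - (1 / (4 * pi\<^sup>2)) * (Q x / (norm x)\<^sup>2)" for x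
  proof -
    have K: "biot_savart_kernel x \<bullet> biot_savart_kernel y = 1 / (4 * pi\<^sup>2) * ((x \<bullet> ((1 / (norm y)\<^sup>2) *\<^sub>R y)) / (norm x)\<^sup>2)" for y
      by (simp add: biot_savart_kernel_inner)
    have "1 / c * (A / n) - 1 / c * (B / n) = - (1 / c) * ((B - A) / n)" for A B c n :: real
      by (simp add: diff_divide_distrib right_diff_distrib)
    then show ?thesis
      unfolding inner_diff_right[of "biot_savart_kernel x"] K Q_def
        inner_diff_right[of x "(1 / (norm (x - q))\<^sup>2) *\<^sub>R (x - q)"] .
  qed
  have ray: "F (t *\<^sub>R e) = ln (norm (- q + t *\<^sub>R e)) - ln (norm (- p + t *\<^sub>R e))" for t e
    by (simp add: F_def)
  have avoid: "AE s in lborel. (\<forall>t. t *\<^sub>R ray_dir s \<noteq> p) \<and> (\<forall>t. t *\<^sub>R ray_dir s \<noteq> q)"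
    using AE_ray_avoids[OF p] AE_ray_avoids[OF q] by eventually_elim simp
  have "(\<integral>x. Q x / (norm x)\<^sup>2 \<partial>lborel) = - 2 * pi * F 0"
  proof (rule integral_radial_derivative)
    have "integrable lborel (\<lambda>x. - (4 * pi\<^sup>2) * (- (1 / (4 * pi\<^sup>2)) * (Q x / (norm x)\<^sup>2)))"
      using int unfolding eq by (rule integrable_mult_right)
    then show "integrable lborel (\<lambda>x. Q x / (norm x)\<^sup>2)" by simp
    have deriv: "((\<lambda>t. F (t *\<^sub>R e)) has_real_derivative e \<bullet> (t *\<^sub>R e - q) / (norm (t *\<^sub>R e - q))\<^sup>2 - e \<bullet> (t *\<^sub>R e - p) / (norm (t *\<^sub>R e - p))\<^sup>2) (at t)"
      if "t *\<^sub>R e \<noteq> p" "t *\<^sub>R e \<noteq> q" for t e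
      unfolding ray
      using DERIV_diff[OF DERIV_ln_norm[of "- q" t e] DERIV_ln_norm[of "- p" t e]] that by simp
    show "AE s in lborel. continuous_on UNIV (\<lambda>t. F (t *\<^sub>R ray_dir s))"
      using avoid
      by eventually_elim (use DERIV_isCont[OF deriv] in \<open>auto intro!: continuous_at_imp_continuous_on\<close>)
    show "AE s in lborel. \<exists>S. finite S \<and>
      (\<forall>t. t \<notin> S \<longrightarrow> ((\<lambda>t. F (t *\<^sub>R ray_dir s)) has_real_derivative Q (t *\<^sub>R ray_dir s) / t) (at t))"
      using avoid
    proof eventually_elim
      case (elim s)
      have "((\<lambda>t. F (t *\<^sub>R ray_dir s)) has_real_derivative Q (t *\<^sub>R ray_dir s) / t) (at t)" if "t \<notin> {0}" for t
      proof -
        let ?e = "ray_dir s"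
        have "Q (t *\<^sub>R ?e) / t = ?e \<bullet> ((1 / (norm (t *\<^sub>R ?e - q))\<^sup>2) *\<^sub>R (t *\<^sub>R ?e - q)
            - (1 / (norm (t *\<^sub>R ?e - p))\<^sup>2) *\<^sub>R (t *\<^sub>R ?e - p))"
          using that unfolding Q_def inner_scaleR_left by simp
        with deriv[of t ?e] elim show ?thesis
          by (simp add: inner_diff_right[of ?e "(1 / _) *\<^sub>R _"])
      qed
      then show ?case by blast
    qed
    show "AE s in lborel. ((\<lambda>t. F (t *\<^sub>R ray_dir s)) \<longlongrightarrow> 0) at_top"
      unfolding ray by (intro always_eventually allI ln_norm_diff_tendsto) simp
    show "AE s in lborel. ((\<lambda>t. F (t *\<^sub>R ray_dir s)) \<longlongrightarrow> 0) at_bot"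
    proof (intro always_eventually allI)
      fix s
      \<comment> \<open>The backward half of a line is the forward half for the opposite
        direction.\<close>
      have "((\<lambda>t. F ((- t) *\<^sub>R ray_dir s)) \<longlongrightarrow> 0) at_top"
        using ln_norm_diff_tendsto[of "- ray_dir s" "- q" "- p"] unfolding ray by simp
      then show "((\<lambda>t. F (t *\<^sub>R ray_dir s)) \<longlongrightarrow> 0) at_bot"
        by (simp add: filterlim_at_bot_mirror)
    qed
  qed
  then show ?thesis
    unfolding eq integral_mult_right_zero by (simp add: F_def field_simps power2_eq_square)
qed

text \<open>This profile is selected for its gradient, - 2 x / r^2 inside the disc and 0 outside:
  the radial derivative divided by |x|^2 is a multiple of the indicator of the disc.\<close>

definition bump :: "real \<Rightarrow> real^2 \<Rightarrow> real" where
  "bump r x = max 0 (1 - (norm x)\<^sup>2 / r\<^sup>2)"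

text \<open>This is 2 \<pi> \<Sigma>(|x| / r) for 0 < |x| \<le> r, and the \<open>min\<close>
  extends it by 0 outside. Away from the origin its radial derivative x \<bullet> \<nabla> is -
  \<open>bump r\<close>, which ties it to the kernel.\<close>

definition log_excess :: "real \<Rightarrow> real^2 \<Rightarrow> real" where
  "log_excess r x = - (ln (min 1 ((norm x)\<^sup>2 / r\<^sup>2)) + 1 - min 1 ((norm x)\<^sup>2 / r\<^sup>2)) / 2"

lemma bump_measurable [measurable]: "bump r \<in> borel_measurable borel"
  unfolding bump_def[abs_def] by measurable

lemma log_excess_measurable [measurable]: "log_excess r \<in> borel_measurable borel"
  unfolding log_excess_def[abs_def] by measurable

lemma sq_ge_one_iff:
  assumes "r > 0" "a \<ge> 0"
  shows "1 \<le> a\<^sup>2 / r\<^sup>2 \<longleftrightarrow> r \<le> (a::real)"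
  using assms by (simp add: le_divide_eq power2_le_iff_abs_le abs_le_square_iff[symmetric])

lemma bump_outside: "r > 0 \<Longrightarrow> r \<le> norm x \<Longrightarrow> bump r x = 0"
  using sq_ge_one_iff[of r "norm x"] by (simp add: bump_def)

lemma log_excess_outside: "r > 0 \<Longrightarrow> r \<le> norm x \<Longrightarrow> log_excess r x = 0"
  using sq_ge_one_iff[of r "norm x"] by (simp add: log_excess_def min_absorb1)

lemma bump_le_indicator: "r > 0 \<Longrightarrow> \<bar>bump r x\<bar> \<le> indicator (ball 0 r) x"
  by (cases "norm x < r") (auto simp: bump_outside, auto simp: bump_def)

lemma integrable_inverse_norm:
  "integrable lborel (\<lambda>x. indicator (ball 0 r) x * (1 / norm (x - (y::real^2))))"
proof -
  obtain A where A: "A \<ge> 0" "\<And>x. (\<integral>\<^sup>+y. indicator (ball 0 r) y * ennreal (1 / norm (x - (y::real^2))) \<partial>lborel) \<le> ennreal A"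
    using newtonian_bound[of r] by blast
  have "(\<integral>\<^sup>+x. ennreal (norm (indicator (ball 0 r) x * (1 / norm (x - y)))) \<partial>lborel)
      = (\<integral>\<^sup>+x. indicator (ball 0 r) x * ennreal (1 / norm (y - x)) \<partial>lborel)"
    by (intro nn_integral_cong) (auto split: split_indicator simp: norm_minus_commute)
  also have "\<dots> < \<infinity>"
    using A(2)[of y] by (rule order_le_less_trans) simp
  finally show ?thesis
    by (intro integrableI_bounded) auto
qed

lemma integrable_indicator_ball: "integrable lborel (indicator (ball (0::'a::euclidean_space) r) :: 'a \<Rightarrow> real)"
  using emeasure_ball_finite[of "0::'a" r] by (intro integrable_real_indicator) auto

lemma integrable_ln_norm:
  "integrable lborel (\<lambda>x. indicator (ball 0 r) x * ln (norm (x - (y::real^2))))"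
proof (rule Bochner_Integration.integrable_bound)
  show "integrable lborel (\<lambda>x. (\<bar>r\<bar> + norm y) * indicator (ball 0 r) x + indicator (ball 0 r) x * (1 / norm (x - y)))"
    by (intro Bochner_Integration.integrable_add integrable_mult_right integrable_indicator_ball integrable_inverse_norm)
  have "norm (indicator (ball 0 r) x * ln (norm (x - y)))
      \<le> norm ((\<bar>r\<bar> + norm y) * indicator (ball 0 r) x + indicator (ball 0 r) x * (1 / norm (x - y)))" for x
  proof (cases "norm x < r")
    case True
    have "norm (x - y) \<le> \<bar>r\<bar> + norm y"
      using norm_triangle_ineq4[of x y] True by auto
    then show ?thesis
      using True abs_ln_le[of "norm (x - y)"] by auto
  qed auto
  then show "AE x in lborel. norm (indicator (ball 0 r) x * ln (norm (x - y)))
      \<le> norm ((\<bar>r\<bar> + norm y) * indicator (ball 0 r) x + indicator (ball 0 r) x * (1 / norm (x - y)))"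
    by simp
qed measurable

text \<open>A line crosses a circle at the roots of a quadratic with leading coefficient |e|^2
  \<noteq> 0. These parameters are the possible corners of the truncated functions along the
  line.\<close>

lemma finite_ray_sphere:
  fixes a e :: "'a::real_inner"
  assumes "e \<noteq> 0"
  shows "finite {t. (norm (a + t *\<^sub>R e))\<^sup>2 = c}"
proof -
  let ?p = "[:(norm a)\<^sup>2 - c, 2 * (a \<bullet> e), (norm e)\<^sup>2:]"
  have "{t. (norm (a + t *\<^sub>R e))\<^sup>2 = c} = {t. poly ?p t = 0}"
    unfolding norm_add_scaleR_sq by (auto simp: algebra_simps power2_eq_square)
  moreover have "?p \<noteq> 0" using assms by simp
  ultimately show ?thesis using poly_roots_finite by metis
qed

text \<open>As a function of the squared norm w the profile is piecewise affine with its only corner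
  at w = r^2, so the chain rule applies off that value.\<close>

lemma DERIV_bump:
  assumes "r > 0" "(norm (a + t *\<^sub>R e))\<^sup>2 \<noteq> r\<^sup>2"
  shows "((\<lambda>t. bump r (a + t *\<^sub>R e)) has_real_derivative
    - (2 / r\<^sup>2) * indicator (ball 0 r) (a + t *\<^sub>R e) * (e \<bullet> (a + t *\<^sub>R e))) (at t)"
proof -
  let ?w = "\<lambda>t. (norm (a + t *\<^sub>R e))\<^sup>2"
  have ind: "indicator (ball 0 r) (a + t *\<^sub>R e) = (if ?w t < r\<^sup>2 then 1 else 0 :: real)"
    using assms by (auto simp: indicator_def power2_less_imp_less intro: power_strict_mono)
  have "((\<lambda>w. max 0 (1 - w / r\<^sup>2)) has_real_derivative (if ?w t < r\<^sup>2 then - 1 / r\<^sup>2 else 0)) (at (?w t))"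
  proof (cases "?w t < r\<^sup>2")
    case True
    have "((\<lambda>w. 1 - w / r\<^sup>2) has_real_derivative - 1 / r\<^sup>2) (at (?w t))"
      using assms by (auto intro!: derivative_eq_intros simp: field_simps eval_nat_numeral)
    then show ?thesis
      using True assms
      by (auto elim!: has_field_derivative_transform_within_open[where S="{..<r\<^sup>2}"] simp: max_def divide_simps)
  next
    case False
    with assms(2) have gt: "r\<^sup>2 < ?w t" by linarith
    have "((\<lambda>w. 0) has_real_derivative 0) (at (?w t))"
      by simp
    then have "((\<lambda>w. max 0 (1 - w / r\<^sup>2)) has_real_derivative 0) (at (?w t))"
      by (rule has_field_derivative_transform_within_open[where S="{r\<^sup>2<..}"])
         (use gt assms in \<open>auto simp: max_absorb1\<close>)
    then show ?thesis using False by simp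
  qed
  from DERIV_chain2[OF this DERIV_norm_sq] show ?thesis
    unfolding bump_def ind by (rule DERIV_cong) simp
qed

lemma DERIV_log_excess:
  assumes "r > 0" "(norm (a + t *\<^sub>R e))\<^sup>2 \<noteq> r\<^sup>2" "a + t *\<^sub>R e \<noteq> 0"
  shows "((\<lambda>t. log_excess r (a + t *\<^sub>R e)) has_real_derivative
    - bump r (a + t *\<^sub>R e) * (e \<bullet> (a + t *\<^sub>R e)) / (norm (a + t *\<^sub>R e))\<^sup>2) (at t)"
proof -
  let ?w = "\<lambda>t. (norm (a + t *\<^sub>R e))\<^sup>2"
  have pos: "0 < ?w t" "0 < r\<^sup>2" using assms by auto
  have "((\<lambda>w. - (ln (min 1 (w / r\<^sup>2)) + 1 - min 1 (w / r\<^sup>2)) / 2) has_real_derivative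
      - max 0 (1 - ?w t / r\<^sup>2) / (2 * ?w t)) (at (?w t))"
  proof (cases "?w t < r\<^sup>2")
    case True
    have "((\<lambda>w. - (ln (w / r\<^sup>2) + 1 - w / r\<^sup>2) / 2) has_real_derivative - (1 - ?w t / r\<^sup>2) / (2 * ?w t)) (at (?w t))"
      using pos by (auto intro!: derivative_eq_intros simp: field_simps)
    moreover have "max 0 (1 - ?w t / r\<^sup>2) = 1 - ?w t / r\<^sup>2"
      using True pos by (simp add: divide_simps)
    ultimately show ?thesis
      using True assms
      by (auto elim!: has_field_derivative_transform_within_open[where S="{..<r\<^sup>2}"] simp: min_def divide_simps)
  next
    case False
    with assms(2) have gt: "r\<^sup>2 < ?w t" by linarith
    have "((\<lambda>w. 0) has_real_derivative 0) (at (?w t))"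
      by simp
    then have "((\<lambda>w. - (ln (min 1 (w / r\<^sup>2)) + 1 - min 1 (w / r\<^sup>2)) / 2) has_real_derivative 0) (at (?w t))"
      by (rule has_field_derivative_transform_within_open[where S="{r\<^sup>2<..}"])
         (use gt assms in \<open>auto simp: min_absorb1\<close>)
    moreover have "- max 0 (1 - ?w t / r\<^sup>2) / (2 * ?w t) = 0"
      using False pos by (simp add: divide_simps)
    ultimately show ?thesis by (simp only:)
  qed
  from DERIV_chain2[OF this DERIV_norm_sq] show ?thesis
    unfolding bump_def log_excess_def by (rule DERIV_cong) (simp add: field_simps)
qed

text \<open>The radial derivative identity is applied twice to the same integral: to the function
  \<open>log_excess r\<close>, along rays from \<open>y\<close>, and to \<open>x \<mapsto> ln \<bar>x - y\<bar> * bump r x\<close>, along rays from \<open>0\<close>.\<close>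

lemma integrable_bump_kernel:
  assumes r: "r > 0" and y: "y \<noteq> 0"
  shows "integrable lborel (\<lambda>x. bump r x * (x \<bullet> (x - y)) / ((norm x)\<^sup>2 * (norm (x - y))\<^sup>2))"
proof (rule Bochner_Integration.integrable_bound)
  \<comment> \<open>From |y| \<le> |x| + |x - y| one gets 1 / (|x| |x - y|) \<le> (1 / |y|) (1 / |x|
    + 1 / |x - y|), which separates the two singularities; here y \<noteq> 0 enters.\<close>
  let ?g = "\<lambda>x. (1 / norm y) * (indicator (ball 0 r) x * (1 / norm (x - 0)) + indicator (ball 0 r) x * (1 / norm (x - y)))"
  show "integrable lborel ?g"
    by (intro integrable_mult_right Bochner_Integration.integrable_add integrable_inverse_norm)
  have "norm (bump r x * (x \<bullet> (x - y)) / ((norm x)\<^sup>2 * (norm (x - y))\<^sup>2)) \<le> norm (?g x)" for x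
  proof (cases "x = 0 \<or> x = y \<or> norm x \<ge> r")
    case True
    then show ?thesis using r by (auto simp: bump_outside)
  next
    case False
    then have nz: "norm x > 0" "norm (x - y) > 0" "norm y > 0" "norm x < r"
      using y by auto
    have b: "\<bar>bump r x\<bar> \<le> 1"
      using bump_le_indicator[OF r, of x] by (auto split: split_indicator_asm)
    have "norm y \<le> norm x + norm (x - y)"
      using norm_triangle_ineq4[of x "x - y"] by simp
    then have "1 / (norm x * norm (x - y)) \<le> (1 / norm y) * (1 / norm x + 1 / norm (x - y))"
      using nz by (simp add: field_simps)
    moreover have "norm (bump r x * (x \<bullet> (x - y)) / ((norm x)\<^sup>2 * (norm (x - y))\<^sup>2)) \<le> 1 / (norm x * norm (x - y))"
    proof -
      have "\<bar>bump r x\<bar> * \<bar>x \<bullet> (x - y)\<bar> \<le> 1 * (norm x * norm (x - y))"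
        using b by (intro mult_mono Cauchy_Schwarz_ineq2) auto
      then show ?thesis
        using nz by (simp add: abs_mult divide_simps power2_eq_square mult_ac)
    qed
    ultimately show ?thesis
      using nz by simp
  qed
  then show "AE x in lborel. norm (bump r x * (x \<bullet> (x - y)) / ((norm x)\<^sup>2 * (norm (x - y))\<^sup>2)) \<le> norm (?g x)"
    by simp
qed measurable

lemma filterlim_ray_norm:
  "eventually (\<lambda>t. norm (a + t *\<^sub>R ray_dir s) \<ge> r) at_top"
  "eventually (\<lambda>t. norm (a + t *\<^sub>R ray_dir s) \<ge> r) at_bot"
proof -
  have ge: "norm (a + t *\<^sub>R ray_dir s) \<ge> r" if "\<bar>t\<bar> \<ge> norm a + r" for t
  proof -
    have "1 \<le> norm (ray_dir s)"
      using norm_ray_dir_sq[of s] by (smt (verit) zero_le_power2 norm_ge_zero power2_le_imp_le one_power2)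
    then have "\<bar>t\<bar> * 1 \<le> norm (t *\<^sub>R ray_dir s)"
      using mult_left_mono[of 1 "norm (ray_dir s)" "\<bar>t\<bar>"] by simp
    moreover have "norm (t *\<^sub>R ray_dir s) \<le> norm (a + t *\<^sub>R ray_dir s) + norm a"
      using norm_triangle_ineq4[of "a + t *\<^sub>R ray_dir s" a] by simp
    ultimately show ?thesis using that by linarith
  qed
  show "eventually (\<lambda>t. norm (a + t *\<^sub>R ray_dir s) \<ge> r) at_top"
    using eventually_ge_at_top[of "norm a + r"] by eventually_elim (rule ge, linarith)
  show "eventually (\<lambda>t. norm (a + t *\<^sub>R ray_dir s) \<ge> r) at_bot"
    using eventually_le_at_bot[of "- (norm a + r)"] by eventually_elim (rule ge, linarith)
qed

text \<open>The gradient of \<open>log_excess r\<close> is - \<open>bump r x\<close> x / |x|^2. With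
  the origin moved to y, the integrand is therefore minus the radial derivative of x \<mapsto>
  \<open>log_excess r (y + x)\<close> over |x|^2, and the value at the new origin gives the
  result.\<close>

lemma integral_bump_kernel:
  assumes r: "r > 0" and y: "y \<noteq> 0"
  shows "(\<integral>x. bump r x * (x \<bullet> (x - y)) / ((norm x)\<^sup>2 * (norm (x - y))\<^sup>2) \<partial>lborel) = 2 * pi * log_excess r y"
proof -
  let ?J = "\<lambda>x. bump r x * (x \<bullet> (x - y)) / ((norm x)\<^sup>2 * (norm (x - y))\<^sup>2)"
  let ?Q = "\<lambda>x. - (bump r (y + x) * (x \<bullet> (y + x)) / (norm (y + x))\<^sup>2)"
  have QJ: "?Q x / (norm x)\<^sup>2 = - ?J (x + y)" for x
    by (simp add: inner_commute add.commute mult.commute)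
  have "AE s in lborel. \<forall>t. t *\<^sub>R ray_dir s \<noteq> - y"
    using y by (intro AE_ray_avoids) simp
  then have avoid: "AE s in lborel. \<forall>t. y + t *\<^sub>R ray_dir s \<noteq> 0"
    by eventually_elim (metis add.commute eq_neg_iff_add_eq_0)
  have "(\<integral>x. ?Q x / (norm x)\<^sup>2 \<partial>lborel) = - 2 * pi * log_excess r (y + 0)"
  proof (rule integral_radial_derivative)
    show "integrable lborel (\<lambda>x. ?Q x / (norm x)\<^sup>2)"
      unfolding QJ using integrable_bump_kernel[OF r y] by (intro Bochner_Integration.integrable_minus integrable_translate)
    show "AE s in lborel. continuous_on UNIV (\<lambda>t. log_excess r (y + t *\<^sub>R ray_dir s))"
      using avoid
    proof eventually_elim
      case (elim s)
      have pos: "0 < min 1 ((norm (y + t *\<^sub>R ray_dir s))\<^sup>2 / r\<^sup>2)" for t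
        using elim r by simp
      show ?case
        unfolding log_excess_def
        by (intro continuous_intros ballI) (use r pos in \<open>auto simp: less_imp_neq[THEN not_sym]\<close>)
    qed
    show "AE s in lborel. \<exists>S. finite S \<and> (\<forall>t. t \<notin> S \<longrightarrow>
       ((\<lambda>t. log_excess r (y + t *\<^sub>R ray_dir s)) has_real_derivative ?Q (t *\<^sub>R ray_dir s) / t) (at t))"
      using avoid
    proof eventually_elim
      case (elim s)
      let ?S = "insert 0 {t. (norm (y + t *\<^sub>R ray_dir s))\<^sup>2 = r\<^sup>2}"
      have "((\<lambda>t. log_excess r (y + t *\<^sub>R ray_dir s)) has_real_derivative ?Q (t *\<^sub>R ray_dir s) / t) (at t)"
        if "t \<notin> ?S" for t
        using DERIV_log_excess[OF r, of y t "ray_dir s"] elim that by simp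
      moreover have "finite ?S"
        using finite_ray_sphere[of "ray_dir s" y "r\<^sup>2"] by simp
      ultimately show ?case by blast
    qed
    show "AE s in lborel. ((\<lambda>t. log_excess r (y + t *\<^sub>R ray_dir s)) \<longlongrightarrow> 0) at_top"
      by (intro always_eventually allI tendsto_eventually eventually_mono[OF filterlim_ray_norm(1)[of r]] log_excess_outside r)
    show "AE s in lborel. ((\<lambda>t. log_excess r (y + t *\<^sub>R ray_dir s)) \<longlongrightarrow> 0) at_bot"
      by (intro always_eventually allI tendsto_eventually eventually_mono[OF filterlim_ray_norm(2)[of r]] log_excess_outside r)
  qed
  moreover have "(\<integral>x. ?J (x + y) \<partial>lborel) = (\<integral>x. ?J x \<partial>lborel)"
    by (rule integral_translate[where f="?J"]) measurable
  ultimately show ?thesis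
    unfolding QJ by simp
qed

text \<open>The product rule splits the radial derivative of ln|x - y| \<open>bump r x\<close> in
  two. Divided by |x|^2, the part with the derivative of the logarithm integrates to 2 \<pi>
  \<open>log_excess r y\<close>, and the part with the derivative of the bump to - 2 / r^2 times the
  integral sought. The total is - 2 \<pi> ln|y|, since the bump is 1 at 0.\<close>

lemma integral_ln_norm_ball:
  assumes r: "r > 0" and y: "y \<noteq> 0"
  shows "(\<integral>x. indicator (ball 0 r) x * ln (norm (x - y)) \<partial>lborel) = pi * r\<^sup>2 * (ln (norm y) + log_excess r y)"
proof -
  let ?J = "\<lambda>x. bump r x * (x \<bullet> (x - y)) / ((norm x)\<^sup>2 * (norm (x - y))\<^sup>2)"
  let ?L = "\<lambda>x. indicator (ball 0 r) x * ln (norm (x - y))"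
  \<comment> \<open>The arguments are written \<open>- y + x\<close> and \<open>0 + x\<close> so
    that along a ray they have the shape \<open>a + t *\<^sub>R e\<close> of the derivative
    rules.\<close>
  let ?F = "\<lambda>x. ln (norm (- y + x)) * bump r (0 + x)"
  let ?Q = "\<lambda>x. bump r x * (x \<bullet> (x - y)) / (norm (x - y))\<^sup>2 - (2 / r\<^sup>2) * (norm x)\<^sup>2 * ?L x"
  have QJ: "?Q x / (norm x)\<^sup>2 = ?J x - (2 / r\<^sup>2) * ?L x" if "x \<noteq> 0" for x
    using that by (simp add: diff_divide_distrib mult.commute)
  then have QJ_AE: "AE x in lborel. ?Q x / (norm x)\<^sup>2 = ?J x - (2 / r\<^sup>2) * ?L x"
    by (intro eventually_mono[OF AE_lborel_singleton[of "0::real^2"]])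
  have int: "integrable lborel (\<lambda>x. ?J x - (2 / r\<^sup>2) * ?L x)"
    by (intro Bochner_Integration.integrable_diff integrable_mult_right integrable_bump_kernel integrable_ln_norm r y)
  have avoid: "AE s in lborel. \<forall>t. - y + t *\<^sub>R ray_dir s \<noteq> 0"
    using AE_ray_avoids[OF y] by simp
  have "(\<integral>x. ?Q x / (norm x)\<^sup>2 \<partial>lborel) = - 2 * pi * ?F 0"
  proof (rule integral_radial_derivative[where F="?F" and q="?Q"])
    show "integrable lborel (\<lambda>x. ?Q x / (norm x)\<^sup>2)"
      using int by (rule Bochner_Integration.integrable_cong_AE_imp) (use QJ_AE in auto)
    show "AE s in lborel. continuous_on UNIV (\<lambda>t. ?F (t *\<^sub>R ray_dir s))"
      using avoid unfolding bump_def
      by eventually_elim (use r in \<open>auto intro!: continuous_intros\<close>)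
    show "AE s in lborel. \<exists>S. finite S \<and> (\<forall>t. t \<notin> S \<longrightarrow>
       ((\<lambda>t. ?F (t *\<^sub>R ray_dir s)) has_real_derivative ?Q (t *\<^sub>R ray_dir s) / t) (at t))"
      using avoid
    proof eventually_elim
      case (elim s)
      let ?S = "insert 0 {t. (norm (0 + t *\<^sub>R ray_dir s))\<^sup>2 = r\<^sup>2}"
      have "((\<lambda>t. ?F (t *\<^sub>R ray_dir s)) has_real_derivative ?Q (t *\<^sub>R ray_dir s) / t) (at t)"
        if "t \<notin> ?S" for t
      proof -
        have "t \<noteq> 0" "(norm (0 + t *\<^sub>R ray_dir s))\<^sup>2 \<noteq> r\<^sup>2" "- y + t *\<^sub>R ray_dir s \<noteq> 0"
          using that elim by auto
        from DERIV_mult[OF DERIV_ln_norm[OF this(3)] DERIV_bump[OF r this(2)]] this(1)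
        show ?thesis
          by (elim DERIV_cong)
             (simp add: power_mult_distrib power2_norm_eq_inner diff_divide_distrib power2_eq_square[of t] mult_ac)
      qed
      moreover have "finite ?S"
        using finite_ray_sphere[of "ray_dir s" 0 "r\<^sup>2"] by simp
      ultimately show ?case by blast
    qed
    have zero: "?F x = 0" if "norm (0 + x) \<ge> r" for x
      using bump_outside[OF r, of "0 + x"] that by simp
    show "AE s in lborel. ((\<lambda>t. ?F (t *\<^sub>R ray_dir s)) \<longlongrightarrow> 0) at_top"
      by (intro always_eventually allI tendsto_eventually eventually_mono[OF filterlim_ray_norm(1)[of r]] zero)
    show "AE s in lborel. ((\<lambda>t. ?F (t *\<^sub>R ray_dir s)) \<longlongrightarrow> 0) at_bot"
      by (intro always_eventually allI tendsto_eventually eventually_mono[OF filterlim_ray_norm(2)[of r]] zero)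
  qed
  also have "?F 0 = ln (norm y)"
    by (simp add: bump_def)
  finally have "(\<integral>x. ?Q x / (norm x)\<^sup>2 \<partial>lborel) = - 2 * pi * ln (norm y)" .
  moreover have "(\<integral>x. ?Q x / (norm x)\<^sup>2 \<partial>lborel) = (\<integral>x. ?J x - (2 / r\<^sup>2) * ?L x \<partial>lborel)"
    by (rule integral_cong_AE) (use QJ_AE in auto)
  moreover have "\<dots> = 2 * pi * log_excess r y - (2 / r\<^sup>2) * (\<integral>x. ?L x \<partial>lborel)"
    using integrable_bump_kernel[OF r y] integrable_ln_norm[of r y]
    by (subst Bochner_Integration.integral_diff) (auto simp: integral_bump_kernel[OF r y])
  ultimately have "(2 / r\<^sup>2) * (\<integral>x. ?L x \<partial>lborel) = 2 * pi * (ln (norm y) + log_excess r y)"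
    by (simp add: algebra_simps)
  then show ?thesis
    using r by (simp add: field_simps)
qed

section \<open>The angular derivative and test functions\<close>

lemma linear_perp: "linear perp"
  by (rule linearI) (simp_all add: vec_eq_iff forall_2)

lemma perp_measurable [measurable]: "perp \<in> borel_measurable borel"
  by (intro borel_measurable_continuous_onI linear_continuous_on linear_conv_bounded_linear[THEN iffD1] linear_perp)

lemma norm_perp [simp]: "norm (perp x) = norm x"
  by (simp add: norm_vec_def L2_set_def sum_2 add.commute)

definition rot :: "real \<Rightarrow> real^2 \<Rightarrow> real^2" where
  "rot \<theta> x = cos \<theta> *\<^sub>R x + sin \<theta> *\<^sub>R perp x"

lemma rot_0 [simp]: "rot 0 x = x" and rot_2pi [simp]: "rot (2 * pi) x = x"
  by (simp_all add: rot_def)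

lemma rot_rot: "rot a (rot b x) = rot (a + b) x"
  by (simp add: rot_def vec_eq_iff forall_2 cos_add sin_add algebra_simps)

lemma norm_rot [simp]: "norm (rot \<theta> x) = norm x"
proof -
  have "(norm (rot \<theta> x))\<^sup>2 = ((cos \<theta>)\<^sup>2 + (sin \<theta>)\<^sup>2) * (norm x)\<^sup>2"
  proof -
    have "(c * a + s * - b)\<^sup>2 + (c * b + s * a)\<^sup>2 = (c\<^sup>2 + s\<^sup>2) * (a\<^sup>2 + b\<^sup>2)" for a b c s :: real
      by (simp add: power2_eq_square algebra_simps)
    from this[of "cos \<theta>" "x $ 1" "sin \<theta>" "x $ 2"] show ?thesis
      by (simp only: norm_sq_vec2 rot_def vector_add_component vector_scaleR_component perp_nth real_scaleR_def)
  qed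
  then show ?thesis by (simp add: power2_eq_iff_nonneg)
qed

lemma linear_rot: "linear (rot \<theta>)"
  by (rule linearI) (simp_all add: rot_def vec_eq_iff forall_2 algebra_simps)

lemma rot_measurable [measurable]: "(\<lambda>p. rot (fst p) (snd p)) \<in> borel_measurable (borel \<Otimes>\<^sub>M borel)"
  unfolding rot_def by measurable

lemma rot_measurable' [measurable]: "rot \<theta> \<in> borel_measurable borel"
  unfolding rot_def[abs_def] by measurable

text \<open>The preimage of a box is its image under the inverse rotation, an orthogonal map, so its
  measure is that of the box.\<close>

lemma distr_lborel_rot: "distr lborel borel (rot \<theta>) = lborel"
proof (rule lborel_eqI[symmetric])
  fix l u :: "real^2"
  assume le: "\<And>b. b \<in> Basis \<Longrightarrow> l \<bullet> b \<le> u \<bullet> b"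
  have vim: "rot \<theta> -` box l u = rot (- \<theta>) ` box l u"
  proof (rule set_eqI)
    fix x
    show "x \<in> rot \<theta> -` box l u \<longleftrightarrow> x \<in> rot (- \<theta>) ` box l u"
      by (auto simp: rot_rot intro!: image_eqI[of x "rot (- \<theta>)" "rot \<theta> x"])
  qed
  have orth: "orthogonal_transformation (rot (- \<theta>))"
    by (simp add: orthogonal_transformation linear_rot)
  have "rot (- \<theta>) ` box l u \<in> lmeasurable" "measure lebesgue (rot (- \<theta>) ` box l u) = measure lebesgue (box l u)"
    by (rule measurable_orthogonal_image[OF orth] measure_orthogonal_image[OF orth]; simp)+
  then have "emeasure lebesgue (rot (- \<theta>) ` box l u) = ennreal (measure lebesgue (box l u))"
    by (simp add: emeasure_eq_measure2)
  moreover have "rot \<theta> -` box l u \<in> sets borel"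
    using measurable_sets_borel[OF rot_measurable', of "box l u" \<theta>] by simp
  ultimately have "emeasure lborel (rot \<theta> -` box l u) = ennreal (measure lborel (box l u))"
    by (simp add: vim)
  then show "emeasure (distr lborel borel (rot \<theta>)) (box l u) = (\<Prod>b\<in>Basis. (u - l) \<bullet> b)"
    using le by (simp add: emeasure_distr measure_lborel_box)
qed simp

lemma DERIV_rot:
  assumes "\<And>y. (\<phi> has_derivative (\<lambda>v. v \<bullet> g y)) (at y)"
  shows "((\<lambda>\<theta>. \<phi> (rot \<theta> x)) has_real_derivative perp (rot \<theta> x) \<bullet> g (rot \<theta> x)) (at \<theta>)"
proof -
  have "((\<lambda>\<theta>. rot \<theta> x) has_vector_derivative (- sin \<theta>) *\<^sub>R x + cos \<theta> *\<^sub>R perp x) (at \<theta>)"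
    unfolding rot_def has_vector_derivative_def
    by (auto intro!: derivative_eq_intros simp: algebra_simps)
  moreover have "(- sin \<theta>) *\<^sub>R x + cos \<theta> *\<^sub>R perp x = perp (rot \<theta> x)"
    by (simp add: rot_def vec_eq_iff forall_2)
  ultimately have "((\<lambda>\<theta>. rot \<theta> x) has_vector_derivative perp (rot \<theta> x)) (at \<theta>)"
    by simp
  then have "((\<phi> \<circ> (\<lambda>\<theta>. rot \<theta> x)) has_vector_derivative (perp (rot \<theta> x) \<bullet> g (rot \<theta> x))) (at \<theta>)"
    using diff_chain_at[of "\<lambda>\<theta>. rot \<theta> x" "\<lambda>t. t *\<^sub>R perp (rot \<theta> x)" \<theta> \<phi> "\<lambda>v. v \<bullet> g (rot \<theta> x)"] assms
    by (simp add: has_vector_derivative_def o_def)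
  then show ?thesis
    by (simp add: has_real_derivative_iff_has_vector_derivative o_def)
qed

text \<open>Averaging over rotations, which preserve the integral, turns the angular derivative into
  the integral of a derivative over a full period.\<close>

lemma integral_angular_derivative:
  assumes \<phi>: "\<And>y. (\<phi> has_derivative (\<lambda>v. v \<bullet> g y)) (at y)" and g: "continuous_on UNIV g"
    and int: "integrable lborel (\<lambda>x. (perp x \<bullet> g x) / (norm x)\<^sup>2)"
  shows "(\<integral>x. (perp x \<bullet> g x) / (norm x)\<^sup>2 \<partial>lborel) = 0"
proof -
  define q where "q x = (perp x \<bullet> g x) / (norm x)\<^sup>2" for x
  have [measurable]: "g \<in> borel_measurable borel"
    using g by (rule borel_measurable_continuous_onI)
  have [measurable]: "q \<in> borel_measurable borel"
    unfolding q_def[abs_def] by measurable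
  have q: "integrable lborel q"
    using int by (simp add: q_def[abs_def])
  \<comment> \<open>One full period is cut out. By rotation invariance every slice has the same
    finite L^1 norm, so the function is integrable on the product and the two integrals may be
    exchanged.\<close>
  let ?g = "\<lambda>p. indicator {0..2*pi} (fst p) * q (rot (fst p) (snd p))"
  have rot_nn: "(\<integral>\<^sup>+x. ennreal (norm (q (rot \<theta> x))) \<partial>lborel) = (\<integral>\<^sup>+x. ennreal (norm (q x)) \<partial>lborel)" for \<theta>
    by (subst (2) distr_lborel_rot[of \<theta>, symmetric]) (simp add: nn_integral_distr)
  have rot_int: "(\<integral>x. q (rot \<theta> x) \<partial>lborel) = (\<integral>x. q x \<partial>lborel)" for \<theta>
    by (subst (2) distr_lborel_rot[of \<theta>, symmetric]) (simp add: integral_distr)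
  have fin: "(\<integral>\<^sup>+x. ennreal (norm (q x)) \<partial>lborel) < \<infinity>"
    using q by (simp add: integrable_iff_bounded)
  have "integrable (lborel \<Otimes>\<^sub>M lborel) ?g"
  proof (rule integrableI_bounded)
    have "(\<integral>\<^sup>+p. ennreal (norm (?g p)) \<partial>(lborel \<Otimes>\<^sub>M lborel))
        = (\<integral>\<^sup>+\<theta>. \<integral>\<^sup>+x. indicator {0..2*pi} \<theta> * ennreal (norm (q (rot \<theta> x))) \<partial>lborel \<partial>lborel)"
      by (subst lborel.nn_integral_fst[symmetric])
         (auto simp: abs_mult intro!: nn_integral_cong split: split_indicator)
    also have "\<dots> = (\<integral>\<^sup>+\<theta>. indicator {0..2*pi} \<theta> * (\<integral>\<^sup>+x. ennreal (norm (q x)) \<partial>lborel) \<partial>lborel)"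
      by (subst nn_integral_cmult) (auto simp: rot_nn[simplified])
    also have "\<dots> = ennreal (2 * pi) * (\<integral>\<^sup>+x. ennreal (norm (q x)) \<partial>lborel)"
      by (subst nn_integral_multc) auto
    also have "\<dots> < \<infinity>"
      using fin by (simp add: ennreal_mult_less_top)
    finally show "(\<integral>\<^sup>+p. ennreal (norm (?g p)) \<partial>(lborel \<Otimes>\<^sub>M lborel)) < \<infinity>" .
  qed measurable
  then have "(\<integral>x. \<integral>\<theta>. indicator {0..2*pi} \<theta> * q (rot \<theta> x) \<partial>lborel \<partial>lborel)
      = (\<integral>\<theta>. \<integral>x. indicator {0..2*pi} \<theta> * q (rot \<theta> x) \<partial>lborel \<partial>lborel)"
    using lborel_pair.Fubini_integral[of "\<lambda>\<theta> x. ?g (\<theta>, x)"] by (simp add: case_prod_beta')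
  also have "\<dots> = 2 * pi * (\<integral>x. q x \<partial>lborel)"
    by (simp add: rot_int)
  finally have "2 * pi * (\<integral>x. q x \<partial>lborel) = (\<integral>x. \<integral>\<theta>. indicator {0..2*pi} \<theta> * q (rot \<theta> x) \<partial>lborel \<partial>lborel)" ..
  also have "\<dots> = (\<integral>x. 0 \<partial>(lborel :: (real^2) measure))"
  proof (rule Bochner_Integration.integral_cong[OF refl])
    fix x :: "real^2"
    let ?d = "\<lambda>\<theta>. perp (rot \<theta> x) \<bullet> g (rot \<theta> x)"
    have cont: "continuous_on {0..2*pi} ?d"
    proof -
      have "continuous_on A (\<lambda>\<theta>. rot \<theta> x)" for A
        unfolding rot_def by (intro continuous_intros)
      moreover have "continuous_on A (\<lambda>\<theta>. perp (rot \<theta> x))" for A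
        using linear_compose[OF linear_rot linear_perp]
        by (intro continuous_on_compose2[OF linear_continuous_on[of perp UNIV]] calculation)
           (auto simp: linear_perp linear_conv_bounded_linear[symmetric])
      ultimately show ?thesis
        by (intro continuous_on_inner continuous_on_compose2[OF g]) auto
    qed
    \<comment> \<open>The weight 1 / |x|^2 is constant on the orbit of x, so only the derivative of
      \<phi> along this closed orbit has to be integrated.\<close>
    have "(?d has_integral (\<phi> (rot (2*pi) x) - \<phi> (rot 0 x))) {0..2*pi}"
      using DERIV_rot[OF \<phi>, of x]
      by (intro fundamental_theorem_of_calculus)
         (auto simp: has_real_derivative_iff_has_vector_derivative intro: has_vector_derivative_at_within)
    then have "(LINT \<theta>:{0..2*pi}|lborel. ?d \<theta>) = 0"
      using borel_integrable_atLeastAtMost'[OF cont]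
      by (simp add: set_borel_integral_eq_integral(2) integral_unique)
    then have "(\<integral>\<theta>. indicator {0..2*pi} \<theta> * ?d \<theta> / (norm x)\<^sup>2 \<partial>lborel) = 0"
      by (simp add: set_lebesgue_integral_def)
    then show "(\<integral>\<theta>. indicator {0..2*pi} \<theta> * q (rot \<theta> x) \<partial>lborel) = 0"
      by (simp add: q_def)
  qed
  finally show ?thesis
    by (simp add: q_def)
qed

text \<open>The gradient inherits the support: on the open complement of the closed support \<phi>
  is locally 0, and uniqueness of derivatives makes \<open>g\<close> vanish there. \<open>g\<close>
  packages the partial derivatives as one continuous field.\<close>

lemma test_function_gradient:
  assumes "test_function \<phi>"
  obtains g R where "\<And>x. (\<phi> has_derivative (\<lambda>v. v \<bullet> g x)) (at x)" "continuous_on UNIV g"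
    "\<And>x. norm x \<ge> R \<Longrightarrow> \<phi> x = 0" "\<And>x. norm x \<ge> R \<Longrightarrow> g x = 0" "\<And>x i. g x $ i = partial_deriv i \<phi> x" "R > 0"
proof -
  have "times_cont_diff (Suc 0) \<phi>"
    using assms unfolding test_function_def by blast
  then have d: "\<phi> differentiable (at x)" and c: "continuous_on UNIV (partial_deriv i \<phi>)" for x i
    by auto
  define g where "g x = (\<chi> i. partial_deriv i \<phi> x)" for x
  have der: "(\<phi> has_derivative (\<lambda>v. v \<bullet> g x)) (at x)" for x
  proof -
    have fr: "(\<phi> has_derivative frechet_derivative \<phi> (at x)) (at x)"
      using d frechet_derivative_works by blast
    then have lin: "linear (frechet_derivative \<phi> (at x))"
      by (rule has_derivative_linear)
    have "frechet_derivative \<phi> (at x) v = v \<bullet> g x" for v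
    proof -
      have "v = (v $ 1) *\<^sub>R axis 1 1 + (v $ 2) *\<^sub>R axis 2 1"
        by (simp add: vec_eq_iff forall_2 axis_def)
      then have "frechet_derivative \<phi> (at x) v = frechet_derivative \<phi> (at x) ((v $ 1) *\<^sub>R axis 1 1 + (v $ 2) *\<^sub>R axis 2 1)"
        by simp
      also have "\<dots> = v \<bullet> g x"
        using lin by (simp add: linear_add linear_scale inner_vec2 g_def partial_deriv_def)
      finally show ?thesis .
    qed
    then have "frechet_derivative \<phi> (at x) = (\<lambda>v. v \<bullet> g x)" by auto
    with fr show ?thesis by simp
  qed
  obtain R where R: "R > 0" "closure {x. \<phi> x \<noteq> 0} \<subseteq> ball 0 R"
    using assms bounded_subset_ballD[of "closure {x. \<phi> x \<noteq> 0}" 0]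
    by (auto simp: test_function_def compact_imp_bounded)
  have zero: "\<phi> x = 0" if "norm x \<ge> R" for x
    using R(2) closure_subset[of "{x. \<phi> x \<noteq> 0}"] that by force
  have gzero: "g x = 0" if "norm x \<ge> R" for x
  proof -
    have x: "x \<in> - closure {x. \<phi> x \<noteq> 0}"
      using R(2) that by auto
    have "((\<lambda>x. 0) has_derivative (\<lambda>v. v \<bullet> g x)) (at x)"
      by (rule has_derivative_transform_within_open[OF der _ x])
         (use closure_subset[of "{x. \<phi> x \<noteq> 0}"] in auto)
    then have "(\<lambda>v. v \<bullet> g x) = (\<lambda>v. 0)"
      using has_derivative_unique has_derivative_const by blast
    then have "g x \<bullet> g x = 0" by meson
    then show ?thesis by simp
  qed
  have "continuous_on UNIV g"
    unfolding g_def using c by (intro continuous_on_vec_lambda)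
  with der zero gzero R(1) show ?thesis
    by (intro that[of g R]) (auto simp: g_def)
qed

text \<open>Compact support is recast as quadratic decay, the form shared with the velocity
  increments, so that one pairing statement serves both.\<close>

lemma continuous_compact_support_decay:
  fixes g :: "'a::euclidean_space \<Rightarrow> 'b::real_normed_vector"
  assumes g: "continuous_on UNIV g" and R: "\<And>x. norm x \<ge> R \<Longrightarrow> g x = 0"
  shows "\<exists>B\<ge>0. \<forall>x. norm (g x) \<le> B / (1 + norm x)\<^sup>2"
proof -
  have "compact (g ` cball 0 \<bar>R\<bar>)"
    by (intro compact_continuous_image continuous_on_subset[OF g]) auto
  then obtain M where M: "\<And>x. x \<in> cball 0 \<bar>R\<bar> \<Longrightarrow> norm (g x) \<le> M"
    by (meson bounded_iff compact_imp_bounded imageI)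
  have M0: "M \<ge> 0" using M[of 0] norm_ge_zero[of "g 0"] by (simp del: norm_ge_zero)
  have "norm (g x) \<le> (M * (1 + \<bar>R\<bar>)\<^sup>2) / (1 + norm x)\<^sup>2" for x
  proof (cases "norm x \<ge> R")
    case True
    then show ?thesis using R M0 by simp
  next
    case False
    then have "norm (g x) * (1 + norm x)\<^sup>2 \<le> M * (1 + \<bar>R\<bar>)\<^sup>2"
      using M[of x] M0 by (intro mult_mono power_mono) auto
    then show ?thesis
      by (subst pos_le_divide_eq) (auto simp: add_nonneg_eq_0_iff)
  qed
  then show ?thesis using M0 by (intro exI[of _ "M * (1 + \<bar>R\<bar>)\<^sup>2"]) auto
qed

section \<open>Velocity and potential of a bounded vorticity\<close>

abbreviation (input) K :: "real^2 \<Rightarrow> real^2" where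
  "K \<equiv> biot_savart_kernel"

text \<open>Near y the singularity is locally integrable; far away the integrand is at most 2 / (1 +
  |x|)^3. This is the absolute convergence behind the exchange of integrals against fields of
  quadratic decay.\<close>

lemma kernel_quadratic_decay_integrable:
  "(\<integral>\<^sup>+x. ennreal (1 / norm (x - y)) * ennreal (1 / (1 + norm (x::real^2))\<^sup>2) \<partial>lborel) < \<infinity>"
proof -
  \<comment> \<open>For |x| \<ge> 1 + 2 |y| one has 1 + |x| \<le> 2 |x - y|.\<close>
  define \<rho> where "\<rho> = 1 + 2 * norm y"
  obtain A where A: "A \<ge> 0" "\<And>x. (\<integral>\<^sup>+y. indicator (ball 0 \<rho>) y * ennreal (1 / norm (x - (y::real^2))) \<partial>lborel) \<le> ennreal A"
    using newtonian_bound[of \<rho>] by blast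
  have "(\<integral>\<^sup>+x. ennreal (1 / norm (x - y)) * ennreal (1 / (1 + norm x)\<^sup>2) \<partial>lborel)
      \<le> (\<integral>\<^sup>+x. indicator (ball 0 \<rho>) x * ennreal (1 / norm (y - x)) + 2 * ennreal (1 / (1 + norm x) ^ 3) \<partial>lborel)"
  proof (intro nn_integral_mono)
    fix x :: "real^2"
    have pos: "0 < 1 + norm x" by (simp add: add_pos_nonneg)
    show "ennreal (1 / norm (x - y)) * ennreal (1 / (1 + norm x)\<^sup>2)
      \<le> indicator (ball 0 \<rho>) x * ennreal (1 / norm (y - x)) + 2 * ennreal (1 / (1 + norm x) ^ 3)"
    proof (cases "norm x < \<rho>")
      case True
      have "1 / (1 + norm x)\<^sup>2 \<le> 1"
        using pos by (simp add: divide_le_eq one_le_power)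
      then have "ennreal (1 / norm (x - y)) * ennreal (1 / (1 + norm x)\<^sup>2) \<le> ennreal (1 / norm (x - y)) * ennreal 1"
        by (intro mult_left_mono ennreal_leI) auto
      also have "\<dots> \<le> ennreal (1 / norm (y - x)) + 2 * ennreal (1 / (1 + norm x) ^ 3)"
        by (simp add: norm_minus_commute)
      finally show ?thesis using True by simp
    next
      case False
      have "norm x \<le> norm (x - y) + norm y"
        by (metis diff_add_cancel norm_triangle_ineq)
      with False have le: "1 + norm x \<le> 2 * norm (x - y)"
        by (simp add: \<rho>_def)
      then have "1 / norm (x - y) \<le> 2 / (1 + norm x)"
        using pos by (simp add: divide_simps)
      then have "1 / norm (x - y) * (1 / (1 + norm x)\<^sup>2) \<le> 2 / (1 + norm x) * (1 / (1 + norm x)\<^sup>2)"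
        by (intro mult_right_mono) auto
      also have "\<dots> = 2 * (1 / (1 + norm x) ^ 3)"
        by (simp add: power2_eq_square power3_eq_cube)
      finally have "ennreal (1 / norm (x - y) * (1 / (1 + norm x)\<^sup>2)) \<le> ennreal (2 * (1 / (1 + norm x) ^ 3))"
        by (rule ennreal_leI)
      also have "ennreal (1 / norm (x - y) * (1 / (1 + norm x)\<^sup>2)) = ennreal (1 / norm (x - y)) * ennreal (1 / (1 + norm x)\<^sup>2)"
        by (rule ennreal_mult) auto
      also have "ennreal (2 * (1 / (1 + norm x) ^ 3)) = 2 * ennreal (1 / (1 + norm x) ^ 3)"
        by (subst ennreal_mult) auto
      finally show ?thesis
        using False by simp
    qed
  qed
  also have "\<dots> = (\<integral>\<^sup>+x. indicator (ball 0 \<rho>) x * ennreal (1 / norm (y - x)) \<partial>lborel)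
      + 2 * (\<integral>\<^sup>+x. ennreal (1 / (1 + norm (x::real^2)) ^ 3) \<partial>lborel)"
    by (subst nn_integral_add) (auto simp: nn_integral_cmult)
  also have "\<dots> < \<infinity>"
    using A(2)[of y] cubic_decay_integrable
    by (auto simp: ennreal_mult_less_top intro: order_le_less_trans)
  finally show ?thesis .
qed

text \<open>The vorticity of the theorem is Lebesgue measurable and matters only up to null sets.
  The locale fixes a Borel function for which bound and support hold at every point, so that all
  integrals live on \<open>lborel\<close> and product measurability is automatic.\<close>

locale bounded_vorticity =
  fixes w :: "real^2 \<Rightarrow> real" and C R :: real
  assumes w_measurable [measurable]: "w \<in> borel_measurable borel"
    and C_nonneg: "C \<ge> 0"
    and w_bound: "\<And>x. \<bar>w x\<bar> \<le> C * indicator (ball 0 R) x"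
begin

definition vel :: "real^2 \<Rightarrow> real^2" where
  "vel x = (\<integral>y. w y *\<^sub>R K (x - y) \<partial>lborel)"

text \<open>The potential \<Psi> of the overview. It carries no factor 1 / (2 \<pi>), which is
  therefore explicit in the identities for the velocity.\<close>

definition pot :: "real^2 \<Rightarrow> real" where
  "pot y = (\<integral>z. w z * ln (norm (z - y)) \<partial>lborel)"

text \<open>The amount by which the mean of \<open>pot\<close> over the disc of radius r about y
  exceeds \<open>pot y\<close>.\<close>

definition excess :: "real \<Rightarrow> real^2 \<Rightarrow> real" where
  "excess r y = (\<integral>z. w z * log_excess r (z - y) \<partial>lborel)"

lemma vel_measurable [measurable]: "vel \<in> borel_measurable borel"
  unfolding vel_def[abs_def] by measurable

lemma pot_measurable [measurable]: "pot \<in> borel_measurable borel"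
  unfolding pot_def[abs_def] by measurable

lemma excess_measurable [measurable]: "excess r \<in> borel_measurable borel"
  unfolding excess_def[abs_def] by measurable

lemma nn_integral_w_le:
  assumes [measurable]: "f \<in> borel_measurable borel"
  shows "(\<integral>\<^sup>+y. ennreal \<bar>w y\<bar> * f y \<partial>lborel) \<le> ennreal C * (\<integral>\<^sup>+y. indicator (ball 0 R) y * f y \<partial>lborel)"
proof -
  have "ennreal \<bar>w y\<bar> * f y \<le> ennreal C * (indicator (ball 0 R) y * f y)" for y
  proof -
    have "ennreal \<bar>w y\<bar> \<le> ennreal (C * indicator (ball 0 R) y)"
      by (intro ennreal_leI w_bound)
    also have "\<dots> = ennreal C * indicator (ball 0 R) y"
      by (auto split: split_indicator)
    finally have "ennreal \<bar>w y\<bar> * f y \<le> (ennreal C * indicator (ball 0 R) y) * f y"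
      by (rule mult_right_mono) simp
    then show ?thesis by (simp add: mult.assoc)
  qed
  then have "(\<integral>\<^sup>+y. ennreal \<bar>w y\<bar> * f y \<partial>lborel) \<le> (\<integral>\<^sup>+y. ennreal C * (indicator (ball 0 R) y * f y) \<partial>lborel)"
    by (intro nn_integral_mono)
  also have "\<dots> = ennreal C * (\<integral>\<^sup>+y. indicator (ball 0 R) y * f y \<partial>lborel)"
    by (rule nn_integral_cmult) measurable
  finally show ?thesis .
qed

lemma nn_integral_kernel_decay:
  "\<exists>A\<ge>0. \<forall>x. (\<integral>\<^sup>+y. ennreal \<bar>w y\<bar> * ennreal (norm (K (x - y))) \<partial>lborel) \<le> ennreal (A / (1 + norm x))"
proof -
  obtain A where A: "A \<ge> 0" "\<And>x. (\<integral>\<^sup>+y. indicator (ball 0 R) y * ennreal (1 / norm (x - (y::real^2))) \<partial>lborel)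
     \<le> ennreal (A / (1 + norm x))"
    using newtonian_decay[of R] by blast
  have "(\<integral>\<^sup>+y. ennreal \<bar>w y\<bar> * ennreal (norm (K (x - y))) \<partial>lborel) \<le> ennreal (C * A / (1 + norm x))" for x
  proof -
    have "(\<integral>\<^sup>+y. ennreal \<bar>w y\<bar> * ennreal (norm (K (x - y))) \<partial>lborel)
        \<le> (\<integral>\<^sup>+y. ennreal \<bar>w y\<bar> * ennreal (1 / norm (x - y)) \<partial>lborel)"
      by (intro nn_integral_mono mult_left_mono ennreal_leI norm_biot_savart_kernel_le) auto
    also have "\<dots> \<le> ennreal C * (\<integral>\<^sup>+y. indicator (ball 0 R) y * ennreal (1 / norm (x - y)) \<partial>lborel)"
      by (rule nn_integral_w_le) measurable
    also have "\<dots> \<le> ennreal C * ennreal (A / (1 + norm x))"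
      by (intro mult_left_mono A) auto
    also have "\<dots> = ennreal (C * A / (1 + norm x))"
      using A(1) C_nonneg by (subst ennreal_mult[symmetric]) auto
    finally show ?thesis .
  qed
  then show ?thesis
    using A(1) C_nonneg by (intro exI[of _ "C * A"]) auto
qed

lemma nn_integral_kernel_diff_decay:
  "\<exists>A\<ge>0. \<forall>x h. norm h \<le> r \<longrightarrow>
     (\<integral>\<^sup>+y. ennreal \<bar>w y\<bar> * ennreal (norm (K (x + h - y) - K (x - y))) \<partial>lborel) \<le> ennreal (A / (1 + norm x)\<^sup>2)"
proof -
  obtain A where A: "A \<ge> 0" "\<And>x h. norm h \<le> r \<Longrightarrow>
     (\<integral>\<^sup>+y. indicator (ball 0 R) y * ennreal (norm (K (x + h - y) - K (x - y))) \<partial>lborel) \<le> ennreal (A / (1 + norm x)\<^sup>2)"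
    using kernel_difference_decay[of r R] by blast
  have "(\<integral>\<^sup>+y. ennreal \<bar>w y\<bar> * ennreal (norm (K (x + h - y) - K (x - y))) \<partial>lborel) \<le> ennreal (C * A / (1 + norm x)\<^sup>2)"
    if "norm h \<le> r" for x h
  proof -
    have "(\<integral>\<^sup>+y. ennreal \<bar>w y\<bar> * ennreal (norm (K (x + h - y) - K (x - y))) \<partial>lborel)
        \<le> ennreal C * (\<integral>\<^sup>+y. indicator (ball 0 R) y * ennreal (norm (K (x + h - y) - K (x - y))) \<partial>lborel)"
      by (rule nn_integral_w_le) measurable
    also have "\<dots> \<le> ennreal C * ennreal (A / (1 + norm x)\<^sup>2)"
      using that by (intro mult_left_mono A) auto
    also have "\<dots> = ennreal (C * A / (1 + norm x)\<^sup>2)"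
      using A(1) C_nonneg by (subst ennreal_mult[symmetric]) auto
    finally show ?thesis .
  qed
  then show ?thesis
    using A(1) C_nonneg by (intro exI[of _ "C * A"]) auto
qed

lemma integrable_kernel: "integrable lborel (\<lambda>y. w y *\<^sub>R K (x - y))"
proof (rule integrableI_bounded)
  obtain A where A: "A \<ge> 0" "\<And>x. (\<integral>\<^sup>+y. ennreal \<bar>w y\<bar> * ennreal (norm (K (x - y))) \<partial>lborel) \<le> ennreal (A / (1 + norm x))"
    using nn_integral_kernel_decay by blast
  have "(\<integral>\<^sup>+y. ennreal (norm (w y *\<^sub>R K (x - y))) \<partial>lborel) = (\<integral>\<^sup>+y. ennreal \<bar>w y\<bar> * ennreal (norm (K (x - y))) \<partial>lborel)"
    by (simp add: ennreal_mult)
  also have "\<dots> < \<infinity>"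
    using A(2)[of x] by (rule order_le_less_trans) simp
  finally show "(\<integral>\<^sup>+y. ennreal (norm (w y *\<^sub>R K (x - y))) \<partial>lborel) < \<infinity>" .
qed measurable

lemma vel_bounded: "\<exists>B\<ge>0. \<forall>x. norm (vel x) \<le> B"
proof -
  obtain A where A: "A \<ge> 0" "\<And>x. (\<integral>\<^sup>+y. ennreal \<bar>w y\<bar> * ennreal (norm (K (x - y))) \<partial>lborel) \<le> ennreal (A / (1 + norm x))"
    using nn_integral_kernel_decay by blast
  have "norm (vel x) \<le> A" for x
  proof -
    have "ennreal (norm (vel x)) \<le> (\<integral>\<^sup>+y. ennreal (norm (w y *\<^sub>R K (x - y))) \<partial>lborel)"
      unfolding vel_def by (rule integral_norm_bound_ennreal[OF integrable_kernel])
    also have "\<dots> = (\<integral>\<^sup>+y. ennreal \<bar>w y\<bar> * ennreal (norm (K (x - y))) \<partial>lborel)"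
      by (simp add: ennreal_mult)
    also have "\<dots> \<le> ennreal (A / (1 + norm x))" by (rule A(2))
    also have "\<dots> \<le> ennreal A"
      using A(1) by (intro ennreal_leI) (simp add: divide_le_eq mult_left_mono add_nonneg_eq_0_iff add_pos_nonneg distrib_left)
    finally show ?thesis using A(1) by simp
  qed
  then show ?thesis using A(1) by blast
qed

lemma vel_diff_eq: "vel (x + h) - vel x = (\<integral>y. w y *\<^sub>R (K (x + h - y) - K (x - y)) \<partial>lborel)"
  unfolding vel_def
  by (subst Bochner_Integration.integral_diff[OF integrable_kernel integrable_kernel, symmetric])
     (simp add: scaleR_diff_right)

lemma integrable_kernel_diff: "integrable lborel (\<lambda>y. w y *\<^sub>R (K (x + h - y) - K (x - y)))"
  using Bochner_Integration.integrable_diff[OF integrable_kernel integrable_kernel, of "x + h" x]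
  by (simp add: scaleR_diff_right)

text \<open>The difference is taken under the integral before norms are. Bounding the two velocities
  separately would give only 1 / (1 + |x|), which is not square integrable in the plane.\<close>

lemma vel_diff_decay:
  "\<exists>A\<ge>0. \<forall>x h. norm h \<le> r \<longrightarrow> norm (vel (x + h) - vel x) \<le> A / (1 + norm x)\<^sup>2"
proof -
  obtain A where A: "A \<ge> 0" "\<And>x h. norm h \<le> r \<Longrightarrow>
     (\<integral>\<^sup>+y. ennreal \<bar>w y\<bar> * ennreal (norm (K (x + h - y) - K (x - y))) \<partial>lborel) \<le> ennreal (A / (1 + norm x)\<^sup>2)"
    using nn_integral_kernel_diff_decay[of r] by blast
  have "norm (vel (x + h) - vel x) \<le> A / (1 + norm x)\<^sup>2" if "norm h \<le> r" for x h
  proof -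
    have "ennreal (norm (vel (x + h) - vel x)) \<le> (\<integral>\<^sup>+y. ennreal (norm (w y *\<^sub>R (K (x + h - y) - K (x - y)))) \<partial>lborel)"
      unfolding vel_diff_eq by (rule integral_norm_bound_ennreal[OF integrable_kernel_diff])
    also have "\<dots> = (\<integral>\<^sup>+y. ennreal \<bar>w y\<bar> * ennreal (norm (K (x + h - y) - K (x - y))) \<partial>lborel)"
      by (simp add: ennreal_mult)
    also have "\<dots> \<le> ennreal (A / (1 + norm x)\<^sup>2)" by (rule A(2)[OF that])
    finally show ?thesis using A(1) by simp
  qed
  then show ?thesis using A(1) by blast
qed

text \<open>Velocity and field together decay like (1 + |x|)^-3, so Fubini may move the vorticity
  outside. What remains is the kernel against \<open>v\<close>, which the radial and angular
  identities can evaluate.\<close>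

lemma pairing:
  assumes [measurable]: "v \<in> borel_measurable borel"
    and v: "\<And>x. norm (v x) \<le> B / (1 + norm x)\<^sup>2" and B: "B \<ge> 0"
  shows "integrable lborel (\<lambda>x. vel x \<bullet> v x)"
    and "integrable lborel (\<lambda>y. w y * (\<integral>x. K (x - y) \<bullet> v x \<partial>lborel))"
    and "(\<integral>x. vel x \<bullet> v x \<partial>lborel) = (\<integral>y. w y * (\<integral>x. K (x - y) \<bullet> v x \<partial>lborel) \<partial>lborel)"
proof -
  let ?f = "\<lambda>x y. w y * (K (x - y) \<bullet> v x)"
  obtain A where A: "A \<ge> 0" "\<And>x. (\<integral>\<^sup>+y. ennreal \<bar>w y\<bar> * ennreal (norm (K (x - y))) \<partial>lborel) \<le> ennreal (A / (1 + norm x))"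
    using nn_integral_kernel_decay by blast
  have "integrable (lborel \<Otimes>\<^sub>M lborel) (\<lambda>(x, y). ?f x y)"
  proof (rule integrableI_bounded)
    have "(\<integral>\<^sup>+p. ennreal (norm (case p of (x, y) \<Rightarrow> ?f x y)) \<partial>(lborel \<Otimes>\<^sub>M lborel))
        = (\<integral>\<^sup>+x. \<integral>\<^sup>+y. ennreal (norm (?f x y)) \<partial>lborel \<partial>lborel)"
      by (subst lborel.nn_integral_fst[symmetric]) auto
    also have "\<dots> \<le> (\<integral>\<^sup>+x. ennreal (A * B) * ennreal (1 / (1 + norm (x::real^2)) ^ 3) \<partial>lborel)"
    proof (intro nn_integral_mono)
      fix x :: "real^2"
      have "(\<integral>\<^sup>+y. ennreal (norm (?f x y)) \<partial>lborel)
          \<le> (\<integral>\<^sup>+y. (ennreal \<bar>w y\<bar> * ennreal (norm (K (x - y)))) * ennreal (B / (1 + norm x)\<^sup>2) \<partial>lborel)"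
      proof (intro nn_integral_mono)
        fix y
        have "norm (?f x y) \<le> \<bar>w y\<bar> * (norm (K (x - y)) * (B / (1 + norm x)\<^sup>2))"
          unfolding real_norm_def abs_mult
          by (intro mult_left_mono order_trans[OF Cauchy_Schwarz_ineq2] v) auto
        then have "ennreal (norm (?f x y)) \<le> ennreal (\<bar>w y\<bar> * (norm (K (x - y)) * (B / (1 + norm x)\<^sup>2)))"
          by (rule ennreal_leI)
        also have "\<dots> = (ennreal \<bar>w y\<bar> * ennreal (norm (K (x - y)))) * ennreal (B / (1 + norm x)\<^sup>2)"
          using B by (simp only: ennreal_mult abs_ge_zero norm_ge_zero mult_nonneg_nonneg divide_nonneg_nonneg zero_le_power2 mult.assoc)
        finally show "ennreal (norm (?f x y)) \<le> (ennreal \<bar>w y\<bar> * ennreal (norm (K (x - y)))) * ennreal (B / (1 + norm x)\<^sup>2)" .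
      qed
      also have "\<dots> = (\<integral>\<^sup>+y. ennreal \<bar>w y\<bar> * ennreal (norm (K (x - y))) \<partial>lborel) * ennreal (B / (1 + norm x)\<^sup>2)"
        by (rule nn_integral_multc) measurable
      also have "\<dots> \<le> ennreal (A / (1 + norm x)) * ennreal (B / (1 + norm x)\<^sup>2)"
        by (intro mult_right_mono A) auto
      also have "\<dots> = ennreal ((A * B) * (1 / (1 + norm x) ^ 3))"
        using A B by (subst ennreal_mult[symmetric]) (auto simp: power2_eq_square power3_eq_cube)
      also have "\<dots> = ennreal (A * B) * ennreal (1 / (1 + norm x) ^ 3)"
        using A B by (subst ennreal_mult) auto
      finally show "(\<integral>\<^sup>+y. ennreal (norm (?f x y)) \<partial>lborel) \<le> ennreal (A * B) * ennreal (1 / (1 + norm x) ^ 3)" .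
    qed
    also have "\<dots> = ennreal (A * B) * (\<integral>\<^sup>+x. ennreal (1 / (1 + norm (x::real^2)) ^ 3) \<partial>lborel)"
      by (rule nn_integral_cmult) measurable
    also have "\<dots> < \<infinity>"
      using cubic_decay_integrable by (simp add: ennreal_mult_less_top)
    finally show "(\<integral>\<^sup>+p. ennreal (norm (case p of (x, y) \<Rightarrow> ?f x y)) \<partial>(lborel \<Otimes>\<^sub>M lborel)) < \<infinity>" .
  qed measurable
  note f = this
  have inner: "(\<integral>y. ?f x y \<partial>lborel) = vel x \<bullet> v x" for x
    using integral_inner_left[where f="\<lambda>y. w y *\<^sub>R K (x - y)" and c="v x" and M=lborel] integrable_kernel[of x]
    by (simp add: vel_def)
  have outer: "(\<integral>x. ?f x y \<partial>lborel) = w y * (\<integral>x. K (x - y) \<bullet> v x \<partial>lborel)" for y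
    by simp
  show "integrable lborel (\<lambda>x. vel x \<bullet> v x)"
    using lborel_pair.integrable_fst[OF f] unfolding inner .
  show "integrable lborel (\<lambda>y. w y * (\<integral>x. K (x - y) \<bullet> v x \<partial>lborel))"
    using lborel_pair.integrable_snd[OF f] unfolding outer .
  show "(\<integral>x. vel x \<bullet> v x \<partial>lborel) = (\<integral>y. w y * (\<integral>x. K (x - y) \<bullet> v x \<partial>lborel) \<partial>lborel)"
    using lborel_pair.Fubini_integral[OF f] unfolding inner outer by simp
qed

text \<open>The integral of absolute values is bounded uniformly for y in a ball: this makes the
  potential locally bounded and also justifies the exchange of integrals when it is averaged over a
  disc.\<close>

lemma pot_bound:
  "\<exists>M\<ge>0. \<forall>y. norm y \<le> \<rho> \<longrightarrow> (\<integral>\<^sup>+z. ennreal (norm (w z * ln (norm (z - y)))) \<partial>lborel) \<le> ennreal M"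
proof -
  obtain A where A: "A \<ge> 0" "\<And>x. (\<integral>\<^sup>+y. indicator (ball 0 R) y * ennreal (1 / norm (x - (y::real^2))) \<partial>lborel) \<le> ennreal A"
    using newtonian_bound[of R] by blast
  define V where "V = measure lborel (ball (0::real^2) R)"
  have V: "emeasure lborel (ball (0::real^2) R) = ennreal V"
    unfolding V_def by (rule emeasure_eq_ennreal_measure) (use emeasure_ball_finite[of "0::real^2" R] in auto)
  have V0: "V \<ge> 0" by (simp add: V_def)
  \<comment> \<open>An upper bound for |z - y| when |z| < R and |y| \<le> \<rho>; it feeds the
    linear term of \<open>abs_ln_le\<close>.\<close>
  define c where "c = \<bar>R\<bar> + \<bar>\<rho>\<bar>"
  have c0: "c \<ge> 0" by (simp add: c_def)
  have "(\<integral>\<^sup>+z. ennreal (norm (w z * ln (norm (z - y)))) \<partial>lborel) \<le> ennreal (C * (c * V + A))" if y: "norm y \<le> \<rho>" for y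
  proof -
    have "(\<integral>\<^sup>+z. ennreal (norm (w z * ln (norm (z - y)))) \<partial>lborel)
        = (\<integral>\<^sup>+z. ennreal \<bar>w z\<bar> * ennreal \<bar>ln (norm (z - y))\<bar> \<partial>lborel)"
      by (simp add: abs_mult ennreal_mult)
    also have "\<dots> \<le> ennreal C * (\<integral>\<^sup>+z. indicator (ball 0 R) z * ennreal \<bar>ln (norm (z - y))\<bar> \<partial>lborel)"
      by (rule nn_integral_w_le) measurable
    also have "(\<integral>\<^sup>+z. indicator (ball 0 R) z * ennreal \<bar>ln (norm (z - y))\<bar> \<partial>lborel)
        \<le> (\<integral>\<^sup>+z. ennreal c * indicator (ball 0 R) z + indicator (ball 0 R) z * ennreal (1 / norm (y - z)) \<partial>lborel)"
    proof (intro nn_integral_mono)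
      fix z :: "real^2"
      have "\<bar>ln (norm (z - y))\<bar> \<le> c + 1 / norm (y - z)" if "norm z < R"
        using abs_ln_le[of "norm (z - y)"] norm_triangle_ineq4[of z y] that y
        by (simp add: c_def norm_minus_commute)
      then show "indicator (ball 0 R) z * ennreal \<bar>ln (norm (z - y))\<bar>
          \<le> ennreal c * indicator (ball 0 R) z + indicator (ball 0 R) z * ennreal (1 / norm (y - z))"
        using c0 by (auto split: split_indicator simp flip: ennreal_plus intro!: ennreal_leI)
    qed
    also have "\<dots> = ennreal c * ennreal V + (\<integral>\<^sup>+z. indicator (ball 0 R) z * ennreal (1 / norm (y - z)) \<partial>lborel)"
      by (subst nn_integral_add) (auto simp: nn_integral_cmult_indicator V)
    also have "\<dots> \<le> ennreal c * ennreal V + ennreal A"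
      by (intro add_left_mono A)
    also have "\<dots> = ennreal (c * V + A)"
      using c0 V0 A(1) by (simp add: ennreal_mult)
    finally have "(\<integral>\<^sup>+z. ennreal (norm (w z * ln (norm (z - y)))) \<partial>lborel) \<le> ennreal C * ennreal (c * V + A)"
      by (simp add: mult_left_mono)
    then show ?thesis
      using c0 V0 A(1) C_nonneg by (simp add: ennreal_mult)
  qed
  then show ?thesis
    using c0 V0 A(1) C_nonneg by (intro exI[of _ "C * (c * V + A)"]) auto
qed

lemma integrable_w_ln: "integrable lborel (\<lambda>z. w z * ln (norm (z - y)))"
proof (rule integrableI_bounded)
  obtain M where M: "\<And>y'. norm y' \<le> norm y \<Longrightarrow> (\<integral>\<^sup>+z. ennreal (norm (w z * ln (norm (z - y')))) \<partial>lborel) \<le> ennreal M"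
    using pot_bound[of "norm y"] by blast
  show "(\<integral>\<^sup>+z. ennreal (norm (w z * ln (norm (z - y)))) \<partial>lborel) < \<infinity>"
    using M[of y] by (auto intro: order_le_less_trans)
qed measurable

lemma pot_locally_bounded: "\<exists>M\<ge>0. \<forall>y. norm y \<le> \<rho> \<longrightarrow> \<bar>pot y\<bar> \<le> M"
proof -
  obtain M where M: "M \<ge> 0" "\<And>y. norm y \<le> \<rho> \<Longrightarrow> (\<integral>\<^sup>+z. ennreal (norm (w z * ln (norm (z - y)))) \<partial>lborel) \<le> ennreal M"
    using pot_bound[of \<rho>] by blast
  have "\<bar>pot y\<bar> \<le> M" if "norm y \<le> \<rho>" for y
  proof -
    have "ennreal (norm (pot y)) \<le> (\<integral>\<^sup>+z. ennreal (norm (w z * ln (norm (z - y)))) \<partial>lborel)"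
      unfolding pot_def by (rule integral_norm_bound_ennreal[OF integrable_w_ln])
    also have "\<dots> \<le> ennreal M" by (rule M(2)[OF that])
    finally show ?thesis using M(1) by simp
  qed
  then show ?thesis using M(1) by blast
qed

end

section \<open>Square norms of velocity increments and their disc averages\<close>

context bounded_vorticity
begin

text \<open>Inserting the integral for the increment and exchanging integrals leaves, for each z,
  the kernel correlation with p = z - h - y and q = z - y, a difference of logarithms.\<close>

lemma integral_kernel_vel_diff:
  assumes h: "h \<noteq> 0"
  shows "(\<integral>x. K (x - y) \<bullet> (vel (x + h) - vel x) \<partial>lborel) = (pot y - pot (y + h)) / (2 * pi)"
proof -
  let ?f = "\<lambda>x z. w z * (K (x - y) \<bullet> (K (x + h - z) - K (x - z)))"
  let ?l = "\<lambda>z. (ln (norm (z - y)) - ln (norm (z - (y + h)))) / (2 * pi)"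
  obtain A where A: "A \<ge> 0" "\<And>x. (\<integral>\<^sup>+z. ennreal \<bar>w z\<bar> * ennreal (norm (K (x + h - z) - K (x - z))) \<partial>lborel) \<le> ennreal (A / (1 + norm x)\<^sup>2)"
    using nn_integral_kernel_diff_decay[of "norm h"] by blast
  have f: "integrable (lborel \<Otimes>\<^sub>M lborel) (\<lambda>(x, z). ?f x z)"
  proof (rule integrableI_bounded)
    have "(\<integral>\<^sup>+p. ennreal (norm (case p of (x, z) \<Rightarrow> ?f x z)) \<partial>(lborel \<Otimes>\<^sub>M lborel))
        = (\<integral>\<^sup>+x. \<integral>\<^sup>+z. ennreal (norm (?f x z)) \<partial>lborel \<partial>lborel)"
      by (subst lborel.nn_integral_fst[symmetric]) auto
    also have "\<dots> \<le> (\<integral>\<^sup>+x. ennreal A * (ennreal (1 / norm (x - y)) * ennreal (1 / (1 + norm x)\<^sup>2)) \<partial>lborel)"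
    proof (intro nn_integral_mono)
      fix x :: "real^2"
      have "(\<integral>\<^sup>+z. ennreal (norm (?f x z)) \<partial>lborel)
          \<le> (\<integral>\<^sup>+z. ennreal (1 / norm (x - y)) * (ennreal \<bar>w z\<bar> * ennreal (norm (K (x + h - z) - K (x - z)))) \<partial>lborel)"
      proof (intro nn_integral_mono)
        fix z
        have "norm (?f x z) \<le> \<bar>w z\<bar> * (1 / norm (x - y) * norm (K (x + h - z) - K (x - z)))"
          unfolding real_norm_def abs_mult
          by (intro mult_left_mono order_trans[OF Cauchy_Schwarz_ineq2] mult_right_mono norm_biot_savart_kernel_le) auto
        then have "ennreal (norm (?f x z)) \<le> ennreal (1 / norm (x - y) * (\<bar>w z\<bar> * norm (K (x + h - z) - K (x - z))))"
          by (intro ennreal_leI) (simp add: mult_ac)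
        also have "\<dots> = ennreal (1 / norm (x - y)) * (ennreal \<bar>w z\<bar> * ennreal (norm (K (x + h - z) - K (x - z))))"
          by (simp only: ennreal_mult abs_ge_zero norm_ge_zero mult_nonneg_nonneg divide_nonneg_nonneg zero_le_one)
        finally show "ennreal (norm (?f x z)) \<le> ennreal (1 / norm (x - y)) * (ennreal \<bar>w z\<bar> * ennreal (norm (K (x + h - z) - K (x - z))))" .
      qed
      also have "\<dots> = ennreal (1 / norm (x - y)) * (\<integral>\<^sup>+z. ennreal \<bar>w z\<bar> * ennreal (norm (K (x + h - z) - K (x - z))) \<partial>lborel)"
        by (rule nn_integral_cmult) measurable
      also have "\<dots> \<le> ennreal (1 / norm (x - y)) * ennreal (A * (1 / (1 + norm x)\<^sup>2))"
        using A(2)[of x] by (intro mult_left_mono) auto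
      also have "\<dots> = ennreal A * (ennreal (1 / norm (x - y)) * ennreal (1 / (1 + norm x)\<^sup>2))"
        using A(1) by (subst ennreal_mult) (auto simp: mult_ac)
      finally show "(\<integral>\<^sup>+z. ennreal (norm (?f x z)) \<partial>lborel)
        \<le> ennreal A * (ennreal (1 / norm (x - y)) * ennreal (1 / (1 + norm x)\<^sup>2))" .
    qed
    also have "\<dots> = ennreal A * (\<integral>\<^sup>+x. ennreal (1 / norm (x - y)) * ennreal (1 / (1 + norm x)\<^sup>2) \<partial>lborel)"
      by (rule nn_integral_cmult) measurable
    also have "\<dots> < \<infinity>"
      using kernel_quadratic_decay_integrable[of y] by (simp add: ennreal_mult_less_top)
    finally show "(\<integral>\<^sup>+p. ennreal (norm (case p of (x, z) \<Rightarrow> ?f x z)) \<partial>(lborel \<Otimes>\<^sub>M lborel)) < \<infinity>" .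
  qed measurable
  have inner: "(\<integral>z. ?f x z \<partial>lborel) = K (x - y) \<bullet> (vel (x + h) - vel x)" for x
    using integral_inner_right[where f="\<lambda>z. w z *\<^sub>R (K (x + h - z) - K (x - z))" and c="K (x - y)" and M=lborel]
      integrable_kernel_diff[of x h]
    by (simp add: vel_diff_eq)
  have "(\<integral>x. K (x - y) \<bullet> (vel (x + h) - vel x) \<partial>lborel) = (\<integral>z. \<integral>x. ?f x z \<partial>lborel \<partial>lborel)"
    using lborel_pair.Fubini_integral[OF f] by (simp add: inner)
  also have "\<dots> = (\<integral>z. w z * ?l z \<partial>lborel)"
  proof (rule integral_cong_AE)
    have "AE z in lborel. integrable lborel (\<lambda>x. ?f x z)"
      using lborel_pair.AE_integrable_snd[OF f] by simp
    then show "AE z in lborel. (\<integral>x. ?f x z \<partial>lborel) = w z * ?l z"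
      using AE_lborel_singleton[of y] AE_lborel_singleton[of "y + h"]
    proof eventually_elim
      case (elim z)
      \<comment> \<open>Fubini supplies integrability of the slice including the factor
        \<open>w z\<close>. It can be divided out where \<open>w z\<close> is nonzero; elsewhere
        both sides are 0.\<close>
      show ?case
      proof (cases "w z = 0")
        case False
        let ?g = "\<lambda>x. K x \<bullet> (K (x - (z - h - y)) - K (x - (z - y)))"
        have shift: "K (x + y - y) \<bullet> (K (x + y + h - z) - K (x + y - z)) = ?g x" for x
          by (simp add: algebra_simps)
        have "integrable lborel (\<lambda>x. inverse (w z) * ?f x z)"
          using elim(1) by (rule integrable_mult_right)
        then have "integrable lborel (\<lambda>x. K (x - y) \<bullet> (K (x + h - z) - K (x - z)))"
          using False by (simp add: mult.assoc[symmetric])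
        from integrable_translate[OF this, of y] have "integrable lborel ?g"
          unfolding shift .
        moreover have "z - h - y \<noteq> 0" "z - y \<noteq> 0"
          using elim(2,3) by (auto simp: algebra_simps)
        ultimately have "(\<integral>x. ?g x \<partial>lborel) = (ln (norm (z - y)) - ln (norm (z - h - y))) / (2 * pi)"
          by (intro integral_kernel_inner_difference)
        also have "(\<integral>x. ?g x \<partial>lborel) = (\<integral>x. K (x - y) \<bullet> (K (x + h - z) - K (x - z)) \<partial>lborel)"
          unfolding shift[symmetric]
          by (rule integral_translate[where f="\<lambda>x. K (x - y) \<bullet> (K (x + h - z) - K (x - z))"]) measurable
        finally show ?thesis
          unfolding integral_mult_right_zero by (simp only: diff_diff_eq add.commute[of h y])
      qed simp
    qed
  qed measurable
  also have "\<dots> = (\<integral>z. (w z * ln (norm (z - y)) - w z * ln (norm (z - (y + h)))) / (2 * pi) \<partial>lborel)"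
    by (simp add: right_diff_distrib)
  also have "\<dots> = (pot y - pot (y + h)) / (2 * pi)"
    unfolding pot_def
    by (subst integral_divide_zero, subst Bochner_Integration.integral_diff[OF integrable_w_ln integrable_w_ln]) simp
  finally show ?thesis .
qed

text \<open>With v(x) = u(x + h) - u(x) and v'(x) = u(x) - u(x - h), so that v'(x + h) = v(x), one
  has |v|^2 = u(x + h) \<bullet> v'(x + h) - u \<bullet> v. Each product is integrable although
  |u|^2 need not be. Translating the first gives the integral of u \<bullet> (v' - v), and pairing
  turns this into a second difference of the potential.\<close>

lemma integral_vel_diff_norm_sq:
  "(\<integral>x. (norm (vel (x + h) - vel x))\<^sup>2 \<partial>lborel)
     = (\<integral>y. w y * (pot (y + h) + pot (y - h) - 2 * pot y) / (2 * pi) \<partial>lborel)"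
proof (cases "h = 0")
  case False
  obtain A where A: "A \<ge> 0" "\<And>x h'. norm h' \<le> norm h \<Longrightarrow> norm (vel (x + h') - vel x) \<le> A / (1 + norm x)\<^sup>2"
    using vel_diff_decay[of "norm h"] by blast
  define v where "v x = vel (x + h) - vel x" for x
  define v' where "v' x = vel x - vel (x - h)" for x
  have [measurable]: "v \<in> borel_measurable borel" "v' \<in> borel_measurable borel"
    unfolding v_def[abs_def] v'_def[abs_def] by measurable
  have v: "norm (v x) \<le> A / (1 + norm x)\<^sup>2" "norm (v' x) \<le> A / (1 + norm x)\<^sup>2" for x
    using A(2)[of h x] A(2)[of "- h" x] by (auto simp: v_def v'_def norm_minus_commute)
  have kv: "(\<integral>x. K (x - y) \<bullet> v x \<partial>lborel) = (pot y - pot (y + h)) / (2 * pi)" for y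
    unfolding v_def by (rule integral_kernel_vel_diff[OF False])
  have kv': "(\<integral>x. K (x - y) \<bullet> v' x \<partial>lborel) = (pot (y - h) - pot y) / (2 * pi)" for y
  proof -
    have "(\<integral>x. K (x - y) \<bullet> v' x \<partial>lborel) = (\<integral>x. K ((x + h) - y) \<bullet> v' (x + h) \<partial>lborel)"
      by (rule integral_translate[where f="\<lambda>x. K (x - y) \<bullet> v' x", symmetric]) measurable
    also have "\<dots> = (\<integral>x. K (x - (y - h)) \<bullet> v x \<partial>lborel)"
      by (simp add: v_def v'_def algebra_simps)
    finally show ?thesis by (simp add: kv)
  qed
  note p = pairing[of v A, OF _ v(1) A(1), simplified] and p' = pairing[of v' A, OF _ v(2) A(1), simplified]
  have "(norm (v x))\<^sup>2 = vel (x + h) \<bullet> v' (x + h) - vel x \<bullet> v x" for x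
    unfolding power2_norm_eq_inner by (simp add: v_def v'_def inner_diff_left)
  then have "(\<integral>x. (norm (v x))\<^sup>2 \<partial>lborel) = (\<integral>x. vel (x + h) \<bullet> v' (x + h) \<partial>lborel) - (\<integral>x. vel x \<bullet> v x \<partial>lborel)"
    using integrable_translate[OF p'(1), of h] p(1) by simp
  also have "(\<integral>x. vel (x + h) \<bullet> v' (x + h) \<partial>lborel) = (\<integral>x. vel x \<bullet> v' x \<partial>lborel)"
    by (rule integral_translate[where f="\<lambda>x. vel x \<bullet> v' x"]) measurable
  also have "(\<integral>x. vel x \<bullet> v' x \<partial>lborel) - (\<integral>x. vel x \<bullet> v x \<partial>lborel)
      = (\<integral>y. w y * ((pot (y - h) - pot y) / (2 * pi)) - w y * ((pot y - pot (y + h)) / (2 * pi)) \<partial>lborel)"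
    using p(2) p'(2) unfolding p(3) p'(3) kv kv' by (rule Bochner_Integration.integral_diff[symmetric, rotated])
  also have "\<dots> = (\<integral>y. w y * (pot (y + h) + pot (y - h) - 2 * pot y) / (2 * pi) \<partial>lborel)"
    by (intro Bochner_Integration.integral_cong refl) (simp add: field_simps)
  finally show ?thesis by (simp add: v_def)
qed simp

text \<open>Quadratic decay squared beats the integrable cubic rate. The bound uniform over |h|
  \<le> r is what makes the squared norm integrable in h.\<close>

lemma vel_diff_norm_sq_integrable:
  "integrable lborel (\<lambda>x. (norm (vel (x + h) - vel x))\<^sup>2)"
  "\<exists>M\<ge>0. \<forall>h. norm h \<le> r \<longrightarrow> (\<integral>x. (norm (vel (x + h) - vel x))\<^sup>2 \<partial>lborel) \<le> M"
proof -
  let ?c = "\<lambda>x::real^2. 1 / (1 + norm x) ^ 3"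
  have c: "integrable lborel ?c"
    using cubic_decay_integrable by (intro integrableI_bounded) auto
  have le: "(norm (vel (x + h) - vel x))\<^sup>2 \<le> A\<^sup>2 * ?c x"
    if "A \<ge> 0" "norm (vel (x + h) - vel x) \<le> A / (1 + norm x)\<^sup>2" for A x h
  proof -
    have "(norm (vel (x + h) - vel x))\<^sup>2 \<le> (A / (1 + norm x)\<^sup>2)\<^sup>2"
      using that by (intro power_mono) auto
    also have "\<dots> = A\<^sup>2 * (1 / (1 + norm x) ^ 4)"
      by (simp add: power_divide)
    also have "\<dots> \<le> A\<^sup>2 * ?c x"
      by (intro mult_left_mono divide_left_mono power_increasing) (auto simp: add_nonneg_eq_0_iff add_pos_nonneg)
    finally show ?thesis .
  qed
  have int: "integrable lborel (\<lambda>x. (norm (vel (x + h) - vel x))\<^sup>2)" for h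
  proof -
    obtain A where A: "A \<ge> 0" "\<And>x. norm (vel (x + h) - vel x) \<le> A / (1 + norm x)\<^sup>2"
      using vel_diff_decay[of "norm h"] by blast
    show ?thesis
      by (rule Bochner_Integration.integrable_bound[OF integrable_mult_right[OF c, of "A\<^sup>2"]])
         (use le[OF A(1) A(2)] in \<open>auto simp: abs_of_nonneg\<close>)
  qed
  then show "integrable lborel (\<lambda>x. (norm (vel (x + h) - vel x))\<^sup>2)" .
  obtain A where A: "A \<ge> 0" "\<And>x h. norm h \<le> r \<Longrightarrow> norm (vel (x + h) - vel x) \<le> A / (1 + norm x)\<^sup>2"
    using vel_diff_decay[of r] by blast
  have "(\<integral>x. (norm (vel (x + h) - vel x))\<^sup>2 \<partial>lborel) \<le> (\<integral>x. A\<^sup>2 * ?c x \<partial>lborel)" if "norm h \<le> r" for h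
    by (intro integral_mono int integrable_mult_right c le A that)
  moreover have "0 \<le> (\<integral>x. A\<^sup>2 * ?c x \<partial>lborel)"
    by (intro integral_nonneg_AE) auto
  ultimately show "\<exists>M\<ge>0. \<forall>h. norm h \<le> r \<longrightarrow> (\<integral>x. (norm (vel (x + h) - vel x))\<^sup>2 \<partial>lborel) \<le> M"
    by blast
qed

text \<open>Exchanging integrals reduces the mean of the potential to that of the logarithm over a
  disc, given by \<open>integral_ln_norm_ball\<close> with pole z - y for every z other than
  y.\<close>

lemma integral_pot_ball:
  assumes r: "r > 0"
  shows "integrable lborel (\<lambda>z. w z * log_excess r (z - y))"
    and "(\<integral>h. indicator (ball 0 r) h * pot (y + h) \<partial>lborel) = pi * r\<^sup>2 * (pot y + excess r y)"
proof -
  let ?f = "\<lambda>h z. indicator (ball 0 r) h * (w z * ln (norm (z - (y + h))))"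
  let ?g = "\<lambda>z. w z * (pi * r\<^sup>2 * (ln (norm (z - y)) + log_excess r (z - y)))"
  obtain M where M: "M \<ge> 0" "\<And>y'. norm y' \<le> norm y + r \<Longrightarrow> (\<integral>\<^sup>+z. ennreal (norm (w z * ln (norm (z - y')))) \<partial>lborel) \<le> ennreal M"
    using pot_bound[of "norm y + r"] by blast
  have f: "integrable (lborel \<Otimes>\<^sub>M lborel) (\<lambda>(h, z). ?f h z)"
  proof (rule integrableI_bounded)
    have "(\<integral>\<^sup>+p. ennreal (norm (case p of (h, z) \<Rightarrow> ?f h z)) \<partial>(lborel \<Otimes>\<^sub>M lborel))
        = (\<integral>\<^sup>+h. \<integral>\<^sup>+z. indicator (ball 0 r) h * ennreal (norm (w z * ln (norm (z - (y + h))))) \<partial>lborel \<partial>lborel)"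
      by (subst lborel.nn_integral_fst[symmetric]) (auto intro!: nn_integral_cong split: split_indicator)
    also have "\<dots> \<le> (\<integral>\<^sup>+h. ennreal M * indicator (ball 0 r) (h::real^2) \<partial>lborel)"
    proof (intro nn_integral_mono)
      fix h :: "real^2"
      show "(\<integral>\<^sup>+z. indicator (ball 0 r) h * ennreal (norm (w z * ln (norm (z - (y + h))))) \<partial>lborel) \<le> ennreal M * indicator (ball 0 r) h"
        using M(2)[of "y + h"] norm_triangle_ineq[of y h] by (cases "norm h < r") auto
    qed
    also have "\<dots> < \<infinity>"
      using emeasure_ball_finite[of "0::real^2" r] by (simp add: nn_integral_cmult_indicator ennreal_mult_less_top)
    finally show "(\<integral>\<^sup>+p. ennreal (norm (case p of (h, z) \<Rightarrow> ?f h z)) \<partial>(lborel \<Otimes>\<^sub>M lborel)) < \<infinity>" .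
  qed measurable
  have eq: "(\<integral>h. ?f h z \<partial>lborel) = ?g z" if "z \<noteq> y" for z
  proof -
    have "(\<integral>h. ?f h z \<partial>lborel) = (\<integral>h. w z * (indicator (ball 0 r) h * ln (norm (h - (z - y)))) \<partial>lborel)"
      by (intro Bochner_Integration.integral_cong refl) (simp add: norm_minus_commute algebra_simps)
    also have "\<dots> = ?g z"
      using integral_ln_norm_ball[OF r, of "z - y"] that by simp
    finally show ?thesis .
  qed
  have AE_eq: "AE z in lborel. (\<integral>h. ?f h z \<partial>lborel) = ?g z"
    by (rule eventually_mono[OF AE_lborel_singleton[of y]]) (rule eq)
  have "integrable lborel (\<lambda>z. \<integral>h. ?f h z \<partial>lborel)"
    by (rule lborel_pair.integrable_snd[OF f])
  then have g: "integrable lborel ?g"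
    by (rule integrable_cong_AE_imp) (use AE_eq in auto)
  \<comment> \<open>Integrability of the excess is not estimated but recovered from Fubini: it is
    the disc mean minus the logarithmic term, both integrable against \<open>w\<close>.\<close>
  have "integrable lborel (\<lambda>z. 1 / (pi * r\<^sup>2) * ?g z - w z * ln (norm (z - y)))"
    by (intro Bochner_Integration.integrable_diff integrable_mult_right g integrable_w_ln)
  moreover have "1 / (pi * r\<^sup>2) * ?g z - w z * ln (norm (z - y)) = w z * log_excess r (z - y)" for z
    using r by (simp add: field_simps)
  ultimately show e: "integrable lborel (\<lambda>z. w z * log_excess r (z - y))"
    by simp
  have "(\<integral>h. indicator (ball 0 r) h * pot (y + h) \<partial>lborel) = (\<integral>h. \<integral>z. ?f h z \<partial>lborel \<partial>lborel)"
    by (simp add: pot_def)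
  also have "\<dots> = (\<integral>z. \<integral>h. ?f h z \<partial>lborel \<partial>lborel)"
    using lborel_pair.Fubini_integral[OF f] by simp
  also have "\<dots> = (\<integral>z. ?g z \<partial>lborel)"
    by (rule integral_cong_AE) (use AE_eq in auto)
  also have "\<dots> = (\<integral>z. (pi * r\<^sup>2) * (w z * ln (norm (z - y)) + w z * log_excess r (z - y)) \<partial>lborel)"
    by (intro Bochner_Integration.integral_cong refl) (simp add: algebra_simps)
  also have "\<dots> = pi * r\<^sup>2 * (pot y + excess r y)"
    unfolding integral_mult_right_zero pot_def excess_def
    by (subst Bochner_Integration.integral_add[OF integrable_w_ln e]) simp
  finally show "(\<integral>h. indicator (ball 0 r) h * pot (y + h) \<partial>lborel) = pi * r\<^sup>2 * (pot y + excess r y)" .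
qed

lemma integral_pot_ball_minus:
  assumes r: "r > 0"
  shows "(\<integral>h. indicator (ball 0 r) h * pot (y - h) \<partial>lborel) = pi * r\<^sup>2 * (pot y + excess r y)"
proof -
  have "(\<integral>h. indicator (ball 0 r) h * pot (y - h) \<partial>lborel) = (\<integral>h. indicator (ball 0 r) (0 - h) * pot (y + (0 - h)) \<partial>lborel)"
    by (intro Bochner_Integration.integral_cong refl) (auto split: split_indicator)
  also have "\<dots> = (\<integral>h. indicator (ball 0 r) h * pot (y + h) \<partial>lborel)"
    by (rule integral_reflect[where f="\<lambda>h. indicator (ball 0 r) h * pot (y + h)"]) measurable
  finally show ?thesis by (simp add: integral_pot_ball(2)[OF r])
qed

text \<open>The two shifted potentials contribute \<open>pot y + excess r y\<close> each, and - 2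
  \<open>pot y\<close> removes the potentials. This leaves 2 \<pi> r^2 times the excess, and the 1 /
  (2 \<pi>) of the second difference reduces the factor to r^2.\<close>

lemma integral_ball_vel_diff:
  assumes r: "r > 0"
  shows "(\<integral>h. indicator (ball 0 r) h * (\<integral>x. (norm (vel (x + h) - vel x))\<^sup>2 \<partial>lborel) \<partial>lborel)
     = r\<^sup>2 * (\<integral>y. w y * excess r y \<partial>lborel)"
proof -
  let ?p = "\<lambda>h y. pot (y + h) + pot (y - h) - 2 * pot y"
  let ?f = "\<lambda>h y. indicator (ball 0 r) h * (w y * ?p h y / (2 * pi))"
  let ?I = "\<lambda>h. indicator (ball 0 r) h :: real"
  obtain M where M: "M \<ge> 0" "\<And>y. norm y \<le> \<bar>R\<bar> + r \<Longrightarrow> \<bar>pot y\<bar> \<le> M"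
    using pot_locally_bounded[of "\<bar>R\<bar> + r"] by blast
  \<comment> \<open>The 4 counts the potentials of the second difference with multiplicity; their
    arguments have norm at most |R| + r, where M bounds the potential.\<close>
  have bound: "norm (?f h y) \<le> (C * (4 * M)) * (indicator (ball 0 r) h * indicator (ball 0 R) y)" for h y
  proof (cases "norm h < r \<and> norm y < R")
    case True
    have "norm y \<le> \<bar>R\<bar> + r" "norm (y + h) \<le> \<bar>R\<bar> + r" "norm (y - h) \<le> \<bar>R\<bar> + r"
      using True r norm_triangle_ineq[of y h] norm_triangle_ineq4[of y h] by linarith+
    from this[THEN M(2)] have "\<bar>?p h y\<bar> \<le> 4 * M"
      unfolding abs_le_iff by linarith
    moreover have "\<bar>w y\<bar> \<le> C" using w_bound[of y] True by simp
    ultimately have "\<bar>w y\<bar> * \<bar>?p h y\<bar> \<le> C * (4 * M)"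
      using C_nonneg by (intro mult_mono) auto
    moreover have "\<bar>w y\<bar> * \<bar>?p h y\<bar> / (2 * pi) \<le> \<bar>w y\<bar> * \<bar>?p h y\<bar>"
      using pi_gt3 mult_left_mono[of 1 "2 * pi" "\<bar>w y\<bar> * \<bar>?p h y\<bar>"] by (subst pos_divide_le_eq) auto
    ultimately show ?thesis
      using True by (simp add: abs_mult)
  next
    case False
    then show ?thesis
      using w_bound[of y] by (auto split: split_indicator)
  qed
  have f: "integrable (lborel \<Otimes>\<^sub>M lborel) (\<lambda>(h, y). ?f h y)"
  proof (rule integrableI_bounded)
    have "(\<integral>\<^sup>+p. ennreal (norm (case p of (h, y) \<Rightarrow> ?f h y)) \<partial>(lborel \<Otimes>\<^sub>M lborel))
        = (\<integral>\<^sup>+h. \<integral>\<^sup>+y. ennreal (norm (?f h y)) \<partial>lborel \<partial>lborel)"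
      by (subst lborel.nn_integral_fst[symmetric]) auto
    also have "\<dots> \<le> (\<integral>\<^sup>+h. \<integral>\<^sup>+y. ennreal (C * (4 * M)) * indicator (ball 0 r) (h::real^2) * indicator (ball 0 R) (y::real^2) \<partial>lborel \<partial>lborel)"
    proof (intro nn_integral_mono)
      fix h y :: "real^2"
      show "ennreal (norm (?f h y)) \<le> ennreal (C * (4 * M)) * indicator (ball 0 r) h * indicator (ball 0 R) y"
        using ennreal_leI[OF bound[of h y]] by (auto split: split_indicator)
    qed
    also have "\<dots> = ennreal (C * (4 * M)) * emeasure lborel (ball (0::real^2) r) * emeasure lborel (ball (0::real^2) R)"
      by (simp add: nn_integral_cmult_indicator nn_integral_multc nn_integral_cmult)
    also have "\<dots> < \<infinity>"
      using emeasure_ball_finite[of "0::real^2" r] emeasure_ball_finite[of "0::real^2" R] by (simp add: ennreal_mult_less_top)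
    finally show "(\<integral>\<^sup>+p. ennreal (norm (case p of (h, y) \<Rightarrow> ?f h y)) \<partial>(lborel \<Otimes>\<^sub>M lborel)) < \<infinity>" .
  qed measurable
  \<comment> \<open>The values 1, -1 and 0 of \<open>s\<close> cover the three potentials of the
    second difference.\<close>
  have int_pot: "integrable lborel (\<lambda>h. ?I h * pot (y + s *\<^sub>R h))" if "s \<in> {-1, 0, 1}" for y s
  proof -
    obtain M' where M': "M' \<ge> 0" "\<And>y'. norm y' \<le> norm y + r \<Longrightarrow> \<bar>pot y'\<bar> \<le> M'"
      using pot_locally_bounded[of "norm y + r"] by blast
    have "norm (?I h * pot (y + s *\<^sub>R h)) \<le> norm (M' * ?I h)" for h
      using M'(1) M'(2)[of "y + s *\<^sub>R h"] norm_triangle_ineq[of y "s *\<^sub>R h"] that r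
      by (auto split: split_indicator)
    then show ?thesis
      by (intro Bochner_Integration.integrable_bound[OF integrable_mult_right[OF integrable_indicator_ball[of r], of M']]) auto
  qed
  have ball: "(\<integral>h. ?I (h::real^2) \<partial>lborel) = pi * r\<^sup>2"
    using r content_ball[of r "0::real^2"] by (simp add: unit_ball_vol_2)
  have outer: "(\<integral>h. ?f h y \<partial>lborel) = r\<^sup>2 * (w y * excess r y)" for y
  proof -
    have "(\<integral>h. ?f h y \<partial>lborel)
        = (\<integral>h. (w y / (2 * pi)) * ((?I h * pot (y + h) + ?I h * pot (y - h)) - 2 * (?I h * pot y)) \<partial>lborel)"
      by (intro Bochner_Integration.integral_cong refl) (simp add: field_simps)
    also have "\<dots> = (w y / (2 * pi)) * (((\<integral>h. ?I h * pot (y + h) \<partial>lborel) + (\<integral>h. ?I h * pot (y - h) \<partial>lborel)) - 2 * (\<integral>h. ?I (h::real^2) * pot y \<partial>lborel))"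
      using int_pot[of 1 y] int_pot[of "-1" y] int_pot[of 0 y] by simp
    also have "\<dots> = r\<^sup>2 * (w y * excess r y)"
      unfolding integral_pot_ball(2)[OF r] integral_pot_ball_minus[OF r] integral_mult_left_zero ball
      by (simp add: field_simps)
    finally show ?thesis .
  qed
  have "(\<integral>h. ?I h * (\<integral>x. (norm (vel (x + h) - vel x))\<^sup>2 \<partial>lborel) \<partial>lborel) = (\<integral>h. \<integral>y. ?f h y \<partial>lborel \<partial>lborel)"
    unfolding integral_vel_diff_norm_sq by simp
  also have "\<dots> = (\<integral>y. \<integral>h. ?f h y \<partial>lborel \<partial>lborel)"
    using lborel_pair.Fubini_integral[OF f] by simp
  also have "\<dots> = r\<^sup>2 * (\<integral>y. w y * excess r y \<partial>lborel)"
    unfolding outer by simp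
  finally show ?thesis .
qed

end

section \<open>Weak divergence and curl of the velocity; correlations with integrable
  weights\<close>

lemma inner_perp_perp: "perp x \<bullet> perp y = x \<bullet> y"
  by (simp add: inner_vec2)

context bounded_vorticity
begin

lemma integrable_kernel_inner:
  assumes [measurable]: "v \<in> borel_measurable borel"
    and v: "\<And>x. norm (v x) \<le> B / (1 + norm x)\<^sup>2" and B: "B \<ge> 0"
  shows "integrable lborel (\<lambda>x. K (x - y) \<bullet> v x)"
proof (rule integrableI_bounded)
  have "(\<integral>\<^sup>+x. ennreal (norm (K (x - y) \<bullet> v x)) \<partial>lborel)
      \<le> (\<integral>\<^sup>+x. ennreal B * (ennreal (1 / norm (x - y)) * ennreal (1 / (1 + norm x)\<^sup>2)) \<partial>lborel)"
  proof (intro nn_integral_mono)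
    fix x
    have "norm (K (x - y) \<bullet> v x) \<le> 1 / norm (x - y) * (B / (1 + norm x)\<^sup>2)"
      unfolding real_norm_def
      by (rule order_trans[OF Cauchy_Schwarz_ineq2]) (intro mult_mono norm_biot_savart_kernel_le v; simp)
    also have "\<dots> = B * (1 / norm (x - y) * (1 / (1 + norm x)\<^sup>2))"
      by simp
    finally have "ennreal (norm (K (x - y) \<bullet> v x)) \<le> ennreal (B * (1 / norm (x - y) * (1 / (1 + norm x)\<^sup>2)))"
      by (rule ennreal_leI)
    also have "\<dots> = ennreal B * (ennreal (1 / norm (x - y)) * ennreal (1 / (1 + norm x)\<^sup>2))"
      using B by (simp only: ennreal_mult norm_ge_zero mult_nonneg_nonneg divide_nonneg_nonneg zero_le_one zero_le_power2)
    finally show "ennreal (norm (K (x - y) \<bullet> v x)) \<le> ennreal B * (ennreal (1 / norm (x - y)) * ennreal (1 / (1 + norm x)\<^sup>2))" .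
  qed
  also have "\<dots> = ennreal B * (\<integral>\<^sup>+x. ennreal (1 / norm (x - y)) * ennreal (1 / (1 + norm x)\<^sup>2) \<partial>lborel)"
    by (rule nn_integral_cmult) measurable
  also have "\<dots> < \<infinity>"
    using kernel_quadratic_decay_integrable[of y] by (simp add: ennreal_mult_less_top)
  finally show "(\<integral>\<^sup>+x. ennreal (norm (K (x - y) \<bullet> v x)) \<partial>lborel) < \<infinity>" .
qed measurable

text \<open>With the pole moved to the origin, pairings with the kernel become integrals of perp x
  \<bullet> v over |x|^2, the form treated by the radial and angular identities.\<close>

lemma integral_kernel_translate:
  assumes [measurable]: "v \<in> borel_measurable borel"
    and v: "\<And>x. norm (v x) \<le> B / (1 + norm x)\<^sup>2" and B: "B \<ge> 0"
  shows "integrable lborel (\<lambda>x. (perp x \<bullet> v (x + y)) / (norm x)\<^sup>2)"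
    and "(\<integral>x. K (x - y) \<bullet> v x \<partial>lborel) = (1 / (2 * pi)) * (\<integral>x. (perp x \<bullet> v (x + y)) / (norm x)\<^sup>2 \<partial>lborel)"
proof -
  have eq: "K ((x + y) - y) \<bullet> v (x + y) = (1 / (2 * pi)) * ((perp x \<bullet> v (x + y)) / (norm x)\<^sup>2)" for x
    by (simp add: biot_savart_kernel_def)
  have "integrable lborel (\<lambda>x. K ((x + y) - y) \<bullet> v (x + y))"
    by (rule integrable_translate[OF integrable_kernel_inner[OF assms]])
  then have "integrable lborel (\<lambda>x. (2 * pi) * ((1 / (2 * pi)) * ((perp x \<bullet> v (x + y)) / (norm x)\<^sup>2)))"
    unfolding eq by (rule integrable_mult_right)
  then show "integrable lborel (\<lambda>x. (perp x \<bullet> v (x + y)) / (norm x)\<^sup>2)"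
    by simp
  have "(\<integral>x. K (x - y) \<bullet> v x \<partial>lborel) = (\<integral>x. K ((x + y) - y) \<bullet> v (x + y) \<partial>lborel)"
    by (rule integral_translate[where f="\<lambda>x. K (x - y) \<bullet> v x", symmetric]) measurable
  then show "(\<integral>x. K (x - y) \<bullet> v x \<partial>lborel) = (1 / (2 * pi)) * (\<integral>x. (perp x \<bullet> v (x + y)) / (norm x)\<^sup>2 \<partial>lborel)"
    unfolding eq integral_mult_right_zero .
qed

text \<open>Around the pole y, K(x - y) \<bullet> \<nabla>\<phi> is an angular derivative over 2
  \<pi> |x - y|^2 and integrates to 0. Against - perp \<nabla>\<phi> the two quarter turns cancel,
  which leaves minus a radial derivative and hence \<phi>(y). The field - perp \<nabla>\<phi> =
  (\<partial>_2 \<phi>, - \<partial>_1 \<phi>) is what u is paired with in the weak curl.\<close>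

lemma weak_div_curl:
  assumes \<phi>: "\<And>x. (\<phi> has_derivative (\<lambda>v. v \<bullet> g x)) (at x)" and g: "continuous_on UNIV g"
    and supp: "\<And>x. norm x \<ge> \<rho> \<Longrightarrow> \<phi> x = 0" "\<And>x. norm x \<ge> \<rho> \<Longrightarrow> g x = 0"
  shows "(\<integral>x. vel x \<bullet> g x \<partial>lborel) = 0"
    and "(\<integral>x. vel x \<bullet> (- perp (g x)) \<partial>lborel) = (\<integral>x. w x * \<phi> x \<partial>lborel)"
    and "integrable lborel (\<lambda>x. vel x $ i * g x $ j)"
proof -
  have [measurable]: "g \<in> borel_measurable borel"
    using g by (rule borel_measurable_continuous_onI)
  obtain B where B: "B \<ge> 0" "\<And>x. norm (g x) \<le> B / (1 + norm x)\<^sup>2"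
    using continuous_compact_support_decay[OF g supp(2)] by blast
  have B': "norm (- perp (g x)) \<le> B / (1 + norm x)\<^sup>2" for x
    using B(2) by simp
  have shift: "((\<lambda>x. \<phi> (x + y)) has_derivative (\<lambda>v. v \<bullet> g (x + y))) (at x)" for x y
  proof -
    have "((\<lambda>x. x + y) has_derivative (\<lambda>v. v)) (at x)"
      by (auto intro!: derivative_eq_intros)
    from has_derivative_compose[OF this \<phi>] show ?thesis .
  qed
  have gshift: "continuous_on UNIV (\<lambda>x. g (x + y))" for y
    by (intro continuous_on_compose2[OF g] continuous_intros) auto
  have "(\<integral>x. K (x - y) \<bullet> g x \<partial>lborel) = 0" for y
    using integral_kernel_translate[OF _ B(2) B(1), of y]
      integral_angular_derivative[OF shift gshift, of y] by simp
  then show "(\<integral>x. vel x \<bullet> g x \<partial>lborel) = 0"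
    using pairing(3)[OF _ B(2) B(1)] by simp
  have "(\<integral>x. K (x - y) \<bullet> (- perp (g x)) \<partial>lborel) = \<phi> y" for y
  proof -
    let ?q = "\<lambda>x. x \<bullet> g (x + y)"
    have eq: "(perp x \<bullet> (- perp (g (x + y)))) / (norm x)\<^sup>2 = - (?q x / (norm x)\<^sup>2)" for x
      by (simp add: inner_perp_perp)
    have "integrable lborel (\<lambda>x. - (?q x / (norm x)\<^sup>2))"
      using integral_kernel_translate(1)[OF _ B' B(1), of y] unfolding eq by simp
    then have "integrable lborel (\<lambda>x. ?q x / (norm x)\<^sup>2)"
      using Bochner_Integration.integrable_minus by fastforce
    then have "(\<integral>x. ?q x / (norm x)\<^sup>2 \<partial>lborel) = - 2 * pi * \<phi> (0 + y)"
    proof (rule integral_radial_derivative[where F="\<lambda>x. \<phi> (x + y)" and q="?q"])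
      have deriv: "((\<lambda>t. \<phi> (t *\<^sub>R e + y)) has_real_derivative e \<bullet> g (t *\<^sub>R e + y)) (at t)" for t e
      proof -
        have "((\<lambda>t. t *\<^sub>R e) has_derivative (\<lambda>t. t *\<^sub>R e)) (at t)"
          by (auto intro!: derivative_eq_intros)
        from has_derivative_compose[OF this shift] show ?thesis
          by (simp add: has_field_derivative_def mult_commute_abs)
      qed
      show "AE s in lborel. continuous_on UNIV (\<lambda>t. \<phi> (t *\<^sub>R ray_dir s + y))"
        using DERIV_isCont[OF deriv] by (auto intro!: continuous_at_imp_continuous_on)
      show "AE s in lborel. \<exists>S. finite S \<and> (\<forall>t. t \<notin> S \<longrightarrow>
        ((\<lambda>t. \<phi> (t *\<^sub>R ray_dir s + y)) has_real_derivative ?q (t *\<^sub>R ray_dir s) / t) (at t))"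
      proof (intro always_eventually allI exI[of _ "{0}"] conjI impI)
        fix s t :: real assume "t \<notin> {0}"
        then show "((\<lambda>t. \<phi> (t *\<^sub>R ray_dir s + y)) has_real_derivative ?q (t *\<^sub>R ray_dir s) / t) (at t)"
          using deriv[of "ray_dir s" t] by simp
      qed simp
      have zero: "\<phi> (x + y) = 0" if "norm (y + x) \<ge> \<rho>" for x
        using supp(1) that by (simp add: add.commute)
      show "AE s in lborel. ((\<lambda>t. \<phi> (t *\<^sub>R ray_dir s + y)) \<longlongrightarrow> 0) at_top"
        by (intro always_eventually allI tendsto_eventually eventually_mono[OF filterlim_ray_norm(1)[of \<rho> y]] zero)
      show "AE s in lborel. ((\<lambda>t. \<phi> (t *\<^sub>R ray_dir s + y)) \<longlongrightarrow> 0) at_bot"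
        by (intro always_eventually allI tendsto_eventually eventually_mono[OF filterlim_ray_norm(2)[of \<rho> y]] zero)
    qed
    then show ?thesis
      using integral_kernel_translate(2)[OF _ B' B(1), of y] unfolding eq by simp
  qed
  then show "(\<integral>x. vel x \<bullet> (- perp (g x)) \<partial>lborel) = (\<integral>x. w x * \<phi> x \<partial>lborel)"
    using pairing(3)[OF _ B' B(1)] by simp
  \<comment> \<open>A product of single components is the pairing with a field pointing in direction
    i; this integrability is what allows the distributional sums to be merged into one
    integral.\<close>
  have axis: "axis i (g x $ j) = (g x $ j) *\<^sub>R axis i 1" for x
    by (simp add: vec_eq_iff axis_def)
  have "norm (axis i (g x $ j)) \<le> B / (1 + norm x)\<^sup>2" for x
    using component_le_norm_cart[of "g x" j] B(2)[of x] by (simp add: axis)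
  moreover have "(\<lambda>x. axis i (g x $ j)) \<in> borel_measurable borel"
    unfolding axis by (intro borel_measurable_continuous_onI continuous_intros g)
  ultimately have "integrable lborel (\<lambda>x. vel x \<bullet> axis i (g x $ j))"
    using B(1) by (intro pairing(1))
  then show "integrable lborel (\<lambda>x. vel x $ i * g x $ j)"
    by (simp add: inner_axis)
qed

text \<open>An integrable kernel against a bounded function has a bounded correlation; multiplied by
  \<open>w\<close>, which is bounded and vanishes outside a ball, it is integrable.\<close>

lemma correlation_integrable:
  fixes k :: "real^2 \<Rightarrow> real"
  assumes k: "integrable lborel k"
  shows "integrable lborel (\<lambda>h. k h * w (x + h))"
    and "integrable lborel (\<lambda>x. w x * (\<integral>h. k h * w (x + h) \<partial>lborel))"
proof -
  have [measurable]: "k \<in> borel_measurable borel" using k by auto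
  have wC: "\<bar>w y\<bar> \<le> C" for y
    using w_bound[of y] C_nonneg by (cases "y \<in> ball 0 R") auto
  have le: "norm (k h * w (x + h)) \<le> norm (C * k h)" for x h
    using mult_left_mono[OF wC[of "x + h"], of "\<bar>k h\<bar>"] C_nonneg by (simp add: abs_mult mult.commute)
  show i: "integrable lborel (\<lambda>h. k h * w (x + h))" for x
    by (rule Bochner_Integration.integrable_bound[OF integrable_mult_right[OF k, of C]]) (use le in auto)
  have conv: "\<bar>\<integral>h. k h * w (x + h) \<partial>lborel\<bar> \<le> (\<integral>h. norm (C * k h) \<partial>lborel)" for x
  proof -
    have "\<bar>\<integral>h. k h * w (x + h) \<partial>lborel\<bar> \<le> (\<integral>h. norm (k h * w (x + h)) \<partial>lborel)"
      using integral_norm_bound[of lborel "\<lambda>h. k h * w (x + h)"] by simp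
    also have "\<dots> \<le> (\<integral>h. norm (C * k h) \<partial>lborel)"
      using k by (intro integral_mono integrable_norm i integrable_mult_right le)
    finally show ?thesis .
  qed
  let ?c = "C * (\<integral>h. norm (C * k h) \<partial>lborel)"
  have "norm (w x * (\<integral>h. k h * w (x + h) \<partial>lborel)) \<le> norm (?c * indicator (ball 0 R) x)" for x
  proof (cases "norm x < R")
    case True
    have "\<bar>w x\<bar> * \<bar>\<integral>h. k h * w (x + h) \<partial>lborel\<bar> \<le> ?c"
      using conv C_nonneg wC by (intro mult_mono) auto
    then show ?thesis using True C_nonneg by (simp add: abs_mult)
  next
    case False
    then show ?thesis using w_bound[of x] by simp
  qed
  then show "integrable lborel (\<lambda>x. w x * (\<integral>h. k h * w (x + h) \<partial>lborel))"
    by (intro Bochner_Integration.integrable_bound[OF integrable_mult_right[OF integrable_indicator_ball[of R], of ?c]]) auto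
qed

end

section \<open>The cut-off weights and representatives of the vorticity\<close>

definition Sigma_cutoff :: "real \<Rightarrow> real^2 \<Rightarrow> real" where
  "Sigma_cutoff r h = indicator (cball 0 r) h * Sigma_weight (norm h / r)"

definition log_cutoff :: "real \<Rightarrow> real^2 \<Rightarrow> real" where
  "log_cutoff r h = indicator (ball 0 r) h * \<bar>ln (norm h / r)\<bar>"

lemma Sigma_cutoff_measurable [measurable]: "Sigma_cutoff r \<in> borel_measurable borel"
  unfolding Sigma_cutoff_def[abs_def] Sigma_weight_def by measurable

lemma log_cutoff_measurable [measurable]: "log_cutoff r \<in> borel_measurable borel"
  unfolding log_cutoff_def[abs_def] by measurable

text \<open>This is ln x \<le> x - 1 at x = \<rho>^2.\<close>

lemma Sigma_weight_nonneg:
  assumes "0 < \<rho>" "\<rho> \<le> 1"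
  shows "Sigma_weight \<rho> \<ge> 0"
proof -
  have "ln (\<rho>\<^sup>2) \<le> \<rho>\<^sup>2 - 1"
    using assms by (intro ln_le_minus_one) simp
  then have "0 \<le> \<bar>ln (\<rho>\<^sup>2)\<bar> - 1 + \<rho>\<^sup>2"
    by linarith
  then show ?thesis
    unfolding Sigma_weight_def by (intro mult_nonneg_nonneg) auto
qed

lemma Sigma_cutoff_eq:
  assumes r: "r > 0" and h: "h \<noteq> 0"
  shows "Sigma_cutoff r h = log_excess r h / (2 * pi)"
proof (cases "norm h \<le> r")
  case True
  have le: "(norm h)\<^sup>2 / r\<^sup>2 \<le> 1"
    using True r by (simp add: divide_le_eq power_mono)
  moreover have "0 < (norm h)\<^sup>2 / r\<^sup>2"
    using h r by simp
  ultimately have "\<bar>ln ((norm h)\<^sup>2 / r\<^sup>2)\<bar> = - ln ((norm h)\<^sup>2 / r\<^sup>2)"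
    by (simp add: abs_of_nonpos)
  then show ?thesis
    using True le by (simp add: Sigma_cutoff_def Sigma_weight_def log_excess_def power_divide min_absorb2 field_simps)
next
  case False
  then show ?thesis
    using r by (simp add: Sigma_cutoff_def log_excess_outside)
qed

text \<open>The upper bound drops - 1 + \<rho>^2 \<le> 0, which leaves |ln \<rho>| / \<pi> \<le> |ln
  \<rho>|. The origin is excluded because with \<open>ln 0 = 0\<close> the weight there is - 1 / (4
  \<pi>); a single point is null.\<close>

lemma Sigma_cutoff_bounds:
  assumes r: "r > 0" and h: "h \<noteq> 0"
  shows "0 \<le> Sigma_cutoff r h" "2 * Sigma_cutoff r h \<le> log_cutoff r h"
proof -
  show "0 \<le> Sigma_cutoff r h"
    using r h by (auto simp: Sigma_cutoff_def intro!: Sigma_weight_nonneg split: split_indicator)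
  show "2 * Sigma_cutoff r h \<le> log_cutoff r h"
  proof (cases "norm h < r")
    case True
    define \<rho> where "\<rho> = norm h / r"
    have \<rho>: "0 < \<rho>" "\<rho> \<le> 1"
      using True r h by (auto simp: \<rho>_def)
    have "\<bar>ln (\<rho>\<^sup>2)\<bar> = 2 * \<bar>ln \<rho>\<bar>"
      using \<rho> by (simp add: ln_realpow abs_mult)
    moreover have "\<rho>\<^sup>2 \<le> 1"
      using \<rho> by (simp add: power_le_one)
    ultimately have "2 * Sigma_weight \<rho> \<le> 2 * (1 / (4 * pi) * (2 * \<bar>ln \<rho>\<bar>))"
      unfolding Sigma_weight_def by (intro mult_left_mono) auto
    also have "\<dots> = \<bar>ln \<rho>\<bar> / pi"
      by simp
    also have "\<dots> \<le> \<bar>ln \<rho>\<bar>"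
      using pi_gt3 mult_left_mono[of 1 pi "\<bar>ln \<rho>\<bar>"] by (subst pos_divide_le_eq) auto
    finally show ?thesis
      using True by (simp add: Sigma_cutoff_def log_cutoff_def \<rho>_def)
  next
    case False
    then show ?thesis
      using Sigma_cutoff_eq[OF r h] log_excess_outside[OF r, of h] by (simp add: log_cutoff_def)
  qed
qed

lemma integrable_log_cutoff:
  assumes r: "r > 0"
  shows "integrable lborel (log_cutoff r)"
proof (rule Bochner_Integration.integrable_bound)
  let ?g = "\<lambda>h::real^2. indicator (ball 0 r) h * ln (norm (h - 0)) - ln r * indicator (ball 0 r) h"
  show "integrable lborel ?g"
    by (intro Bochner_Integration.integrable_diff integrable_mult_right integrable_ln_norm integrable_indicator_ball)
  have "norm (log_cutoff r h) \<le> norm (?g h)" if "h \<noteq> 0" for h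
    using that r by (auto simp: log_cutoff_def ln_div split: split_indicator)
  then show "AE h in lborel. norm (log_cutoff r h) \<le> norm (?g h)"
    by (rule eventually_mono[OF AE_lborel_singleton[of 0]])
qed measurable

lemma integrable_Sigma_cutoff:
  assumes r: "r > 0"
  shows "integrable lborel (Sigma_cutoff r)"
proof (rule Bochner_Integration.integrable_bound[OF integrable_log_cutoff[OF r]])
  have "norm (Sigma_cutoff r h) \<le> norm (log_cutoff r h)" if "h \<noteq> 0" for h
    using Sigma_cutoff_bounds[OF r that] by simp
  then show "AE h in lborel. norm (Sigma_cutoff r h) \<le> norm (log_cutoff r h)"
    by (rule eventually_mono[OF AE_lborel_singleton[of 0]])
qed measurable

context bounded_vorticity
begin

text \<open>Substituting z = x + h turns the correlation into the integral defining
  \<open>excess\<close>, up to the factor 2 \<pi> between the two weights.\<close>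

lemma Sigma_correlation:
  assumes r: "r > 0"
  shows "(\<integral>h. Sigma_cutoff r h * w (x + h) \<partial>lborel) = excess r x / (2 * pi)"
proof -
  have "(\<integral>h. Sigma_cutoff r h * w (x + h) \<partial>lborel) = (\<integral>h. Sigma_cutoff r ((h + x) - x) * w (h + x) \<partial>lborel)"
    by (simp add: add.commute)
  also have "\<dots> = (\<integral>z. Sigma_cutoff r (z - x) * w z \<partial>lborel)"
    by (rule integral_translate[where f="\<lambda>z. Sigma_cutoff r (z - x) * w z"]) measurable
  also have "\<dots> = (\<integral>z. w z * log_excess r (z - x) / (2 * pi) \<partial>lborel)"
  proof (rule integral_cong_AE)
    have "Sigma_cutoff r (z - x) * w z = w z * log_excess r (z - x) / (2 * pi)" if "z \<noteq> x" for z
      using that by (simp add: Sigma_cutoff_eq[OF r])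
    then show "AE z in lborel. Sigma_cutoff r (z - x) * w z = w z * log_excess r (z - x) / (2 * pi)"
      by (rule eventually_mono[OF AE_lborel_singleton[of x]])
  qed measurable
  also have "\<dots> = excess r x / (2 * pi)"
    by (simp add: excess_def)
  finally show ?thesis .
qed

text \<open>Makes the integrability of correlations available for |w|, which the logarithmic bound
  involves.\<close>

lemma abs_bounded_vorticity: "bounded_vorticity (\<lambda>x. \<bar>w x\<bar>) C R"
  by unfold_locales (use C_nonneg w_bound in auto)

lemma Sigma_correlation_le:
  assumes r: "r > 0"
  shows "2 * (\<integral>x. w x * (\<integral>h. Sigma_cutoff r h * w (x + h) \<partial>lborel) \<partial>lborel)
     \<le> (\<integral>x. \<bar>w x\<bar> * (\<integral>h. log_cutoff r h * \<bar>w (x + h)\<bar> \<partial>lborel) \<partial>lborel)"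
proof -
  interpret abs: bounded_vorticity "\<lambda>x. \<bar>w x\<bar>" C R
    by (rule abs_bounded_vorticity)
  note S = integrable_Sigma_cutoff[OF r] and L = integrable_log_cutoff[OF r]
  have "2 * \<bar>\<integral>h. Sigma_cutoff r h * w (x + h) \<partial>lborel\<bar> \<le> (\<integral>h. log_cutoff r h * \<bar>w (x + h)\<bar> \<partial>lborel)" for x
  proof -
    have "2 * \<bar>\<integral>h. Sigma_cutoff r h * w (x + h) \<partial>lborel\<bar> = norm (\<integral>h. 2 * (Sigma_cutoff r h * w (x + h)) \<partial>lborel)"
      by (simp add: abs_mult)
    also have "\<dots> \<le> (\<integral>h. norm (2 * (Sigma_cutoff r h * w (x + h))) \<partial>lborel)"
      by (rule integral_norm_bound)
    also have "\<dots> \<le> (\<integral>h. log_cutoff r h * \<bar>w (x + h)\<bar> \<partial>lborel)"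
    proof (rule integral_mono_AE)
      show "integrable lborel (\<lambda>h. norm (2 * (Sigma_cutoff r h * w (x + h))))"
        by (intro integrable_norm integrable_mult_right correlation_integrable(1) S)
      show "integrable lborel (\<lambda>h. log_cutoff r h * \<bar>w (x + h)\<bar>)"
        by (rule abs.correlation_integrable(1)[OF L])
      have "norm (2 * (Sigma_cutoff r h * w (x + h))) \<le> log_cutoff r h * \<bar>w (x + h)\<bar>" if "h \<noteq> 0" for h
        using mult_right_mono[OF Sigma_cutoff_bounds(2)[OF r that], of "\<bar>w (x + h)\<bar>"] Sigma_cutoff_bounds(1)[OF r that]
        by (simp add: abs_mult)
      then show "AE h in lborel. norm (2 * (Sigma_cutoff r h * w (x + h))) \<le> log_cutoff r h * \<bar>w (x + h)\<bar>"
        by (rule eventually_mono[OF AE_lborel_singleton[of 0]])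
    qed
    finally show ?thesis .
  qed
  note pointwise = this
  have "2 * (w x * (\<integral>h. Sigma_cutoff r h * w (x + h) \<partial>lborel)) \<le> \<bar>w x\<bar> * (\<integral>h. log_cutoff r h * \<bar>w (x + h)\<bar> \<partial>lborel)" for x
  proof -
    let ?a = "\<integral>h. Sigma_cutoff r h * w (x + h) \<partial>lborel"
    have "2 * (w x * ?a) \<le> \<bar>w x\<bar> * (2 * \<bar>?a\<bar>)"
      using abs_ge_self[of "w x * ?a"] by (simp add: abs_mult)
    also have "\<dots> \<le> \<bar>w x\<bar> * (\<integral>h. log_cutoff r h * \<bar>w (x + h)\<bar> \<partial>lborel)"
      by (intro mult_left_mono pointwise) auto
    finally show ?thesis .
  qed
  then have "(\<integral>x. 2 * (w x * (\<integral>h. Sigma_cutoff r h * w (x + h) \<partial>lborel)) \<partial>lborel)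
     \<le> (\<integral>x. \<bar>w x\<bar> * (\<integral>h. log_cutoff r h * \<bar>w (x + h)\<bar> \<partial>lborel) \<partial>lborel)"
    by (intro integral_mono integrable_mult_right correlation_integrable(2) abs.correlation_integrable(2) S L)
  then show ?thesis by simp
qed

end

section \<open>From Borel representatives to Lebesgue measurable vorticities\<close>

lemma lebesgue_AE_eq:
  fixes f g :: "'a::euclidean_space \<Rightarrow> 'b::euclidean_space"
  assumes [measurable]: "g \<in> borel_measurable borel" and ae: "AE x in lborel. f x = g x"
  shows "integrable lebesgue f \<longleftrightarrow> integrable lborel g" and "integral\<^sup>L lebesgue f = integral\<^sup>L lborel g"
proof -
  have g: "g \<in> borel_measurable lebesgue"
    by (rule measurable_completion) simp
  have ae': "AE x in lebesgue. f x = g x"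
    using ae by (rule AE_completion)
  have f: "f \<in> borel_measurable lebesgue"
    by (rule borel_measurable_AE[OF g]) (use ae' in auto)
  show "integrable lebesgue f \<longleftrightarrow> integrable lborel g"
    using integrable_cong_AE[OF f g ae'] by (simp add: integrable_completion)
  show "integral\<^sup>L lebesgue f = integral\<^sup>L lborel g"
    using integral_cong_AE[OF f g ae'] by (simp add: integral_completion)
qed

text \<open>The complement of the essential support is a union of possibly uncountably many open
  sets; the Lindelof property leaves countably many, and countable unions of null sets are
  null.\<close>

lemma AE_zero_outside_ess_support: "AE x in lebesgue. x \<notin> ess_support f \<longrightarrow> f x = 0"
proof -
  define F where "F = {U. open U \<and> (AE x in lebesgue. x \<in> U \<longrightarrow> f x = 0)}"
  obtain F' where F': "F' \<subseteq> F" "countable F'" "\<Union>F' = \<Union>F"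
    by (rule Lindelof[of F]) (auto simp: F_def)
  have "AE x in lebesgue. \<forall>U\<in>F'. x \<in> U \<longrightarrow> f x = 0"
    using F' by (subst AE_ball_countable) (auto simp: F_def)
  then show ?thesis
    by eventually_elim (use F'(3) in \<open>auto simp: ess_support_def F_def\<close>)
qed

lemma bounded_vorticity_representative:
  fixes \<omega> :: "real^2 \<Rightarrow> real"
  assumes int: "integrable lebesgue \<omega>" and bdd: "\<exists>C. AE x in lebesgue. \<bar>\<omega> x\<bar> \<le> C"
    and supp: "compact (ess_support \<omega>)"
  obtains w C R where "bounded_vorticity w C R" "AE x in lborel. \<omega> x = w x"
proof -
  obtain w' where [measurable]: "w' \<in> borel_measurable borel" and w': "AE x in lborel. \<omega> x = w' x"
    using completion_ex_borel_measurable_real[OF borel_measurable_integrable[OF int]] by auto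
  obtain C where C: "AE x in lborel. \<bar>\<omega> x\<bar> \<le> C"
    using bdd by (auto simp: AE_completion_iff)
  obtain R where R: "ess_support \<omega> \<subseteq> ball 0 R"
    using bounded_subset_ballD[OF compact_imp_bounded[OF supp], of 0] by blast
  \<comment> \<open>Truncation in space and in height changes \<open>w'\<close> only on a null set
    and makes both bounds hold everywhere; |C| is nonnegative by construction, as the locale
    demands.\<close>
  define w where "w x = (if norm x < R \<and> \<bar>w' x\<bar> \<le> \<bar>C\<bar> then w' x else 0)" for x
  have "AE x in lborel. x \<notin> ess_support \<omega> \<longrightarrow> \<omega> x = 0"
    using AE_zero_outside_ess_support by (simp add: AE_completion_iff)
  with w' C have "AE x in lborel. \<omega> x = w x"
    by eventually_elim (use R in \<open>auto simp: w_def\<close>)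
  moreover have "bounded_vorticity w \<bar>C\<bar> R"
  proof
    show "w \<in> borel_measurable borel"
      unfolding w_def[abs_def] by measurable
  qed (auto simp: w_def)
  ultimately show ?thesis by (rule that[rotated])
qed

theorem lemma2p8:
  fixes \<omega> :: "real^2 \<Rightarrow> real" and u :: "real^2 \<Rightarrow> real^2"
  assumes "integrable lebesgue \<omega>"
    and "\<exists>C. AE x in lebesgue. \<bar>\<omega> x\<bar> \<le> C"
    and "compact (ess_support \<omega>)"
    and "u = biot_savart \<omega>"
  shows "(\<forall>x. integrable lebesgue (\<lambda>y. \<omega> y *\<^sub>R biot_savart_kernel (x - y)))
       \<and> locally_integrable u
       \<and> (\<forall>\<phi>. test_function \<phi> \<longrightarrow> distr_div u \<phi> = 0)
       \<and> (\<forall>\<phi>. test_function \<phi> \<longrightarrow> distr_curl u \<phi> = distr_of \<omega> \<phi>)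
       \<and> (\<forall>\<rho>. 0 < \<rho> \<and> \<rho> \<le> 1 \<longrightarrow> Sigma_weight \<rho> \<ge> 0)
       \<and> (\<forall>r>0.
            (\<forall>h. integrable lebesgue (\<lambda>x. (norm (u (x + h) - u x))\<^sup>2))
          \<and> set_integrable lebesgue (ball 0 r)
              (\<lambda>h. LINT x|lebesgue. (norm (u (x + h) - u x))\<^sup>2)
          \<and> (\<forall>x. set_integrable lebesgue (cball 0 r)
                   (\<lambda>h. Sigma_weight (norm h / r) * \<omega> x * \<omega> (x + h)))
          \<and> integrable lebesgue
              (\<lambda>x. LINT h:cball 0 r|lebesgue. Sigma_weight (norm h / r) * \<omega> x * \<omega> (x + h))
          \<and> (\<forall>x. set_integrable lebesgue (ball 0 r)
                   (\<lambda>h. \<bar>ln (norm h / r)\<bar> * \<bar>\<omega> x\<bar> * \<bar>\<omega> (x + h)\<bar>))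
          \<and> integrable lebesgue
              (\<lambda>x. LINT h:ball 0 r|lebesgue. \<bar>ln (norm h / r)\<bar> * \<bar>\<omega> x\<bar> * \<bar>\<omega> (x + h)\<bar>)
          \<and> 1 / measure lebesgue (ball (0::real^2) r)
              * (LINT h:ball 0 r|lebesgue. LINT x|lebesgue. (norm (u (x + h) - u x))\<^sup>2)
            = 2 * (LINT x|lebesgue. (LINT h:cball 0 r|lebesgue.
                     Sigma_weight (norm h / r) * \<omega> x * \<omega> (x + h)))
          \<and> 1 / measure lebesgue (ball (0::real^2) r)
              * (LINT h:ball 0 r|lebesgue. LINT x|lebesgue. (norm (u (x + h) - u x))\<^sup>2)
            \<le> (LINT x|lebesgue. (LINT h:ball 0 r|lebesgue.
                 \<bar>ln (norm h / r)\<bar> * \<bar>\<omega> x\<bar> * \<bar>\<omega> (x + h)\<bar>)))"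
proof -
  obtain w C R where "bounded_vorticity w C R" and ae: "AE x in lborel. \<omega> x = w x"
    using bounded_vorticity_representative[OF assms(1-3)] .
  interpret bounded_vorticity w C R by fact
  interpret abs: bounded_vorticity "\<lambda>x. \<bar>w x\<bar>" C R
    by (rule abs_bounded_vorticity)
  have ae_shift: "AE h in lborel. \<omega> (x + h) = w (x + h)" for x
    using AE_translate[OF ae, of x] by (simp add: add.commute)

  have kernel: "integrable lebesgue (\<lambda>y. \<omega> y *\<^sub>R K (x - y))"
    "(LINT y|lebesgue. \<omega> y *\<^sub>R K (x - y)) = vel x" for x
  proof -
    have m: "(\<lambda>y. w y *\<^sub>R K (x - y)) \<in> borel_measurable borel"
      by measurable
    have eq: "AE y in lborel. \<omega> y *\<^sub>R K (x - y) = w y *\<^sub>R K (x - y)"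
      using ae by eventually_elim simp
    show "integrable lebesgue (\<lambda>y. \<omega> y *\<^sub>R K (x - y))"
      using lebesgue_AE_eq(1)[OF m eq] integrable_kernel by simp
    show "(LINT y|lebesgue. \<omega> y *\<^sub>R K (x - y)) = vel x"
      using lebesgue_AE_eq(2)[OF m eq] by (simp add: vel_def)
  qed
  \<comment> \<open>Equality holds at every point and not just almost everywhere, since null sets in
    y do not affect the integral at any fixed x.\<close>
  have u: "u = vel"
    unfolding assms(4) biot_savart_def[abs_def] using kernel(2) by auto

  have loc: "locally_integrable u"
    unfolding locally_integrable_def u
  proof (intro allI impI)
    fix S :: "(real^2) set" assume S: "compact S"
    have [measurable]: "S \<in> sets borel"
      using S by (intro borel_compact)
    obtain B where B: "B \<ge> 0" "\<And>x. norm (vel x) \<le> B"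
      using vel_bounded by blast
    have "integrable lborel (indicator S :: real^2 \<Rightarrow> real)"
      using emeasure_bounded_finite[OF compact_imp_bounded[OF S]] by (intro integrable_real_indicator) auto
    then have "integrable lborel (\<lambda>x. indicator S x *\<^sub>R vel x)"
      by (rule Bochner_Integration.integrable_bound[OF integrable_mult_right[of B]])
         (use B in \<open>auto split: split_indicator\<close>)
    then show "set_integrable lebesgue S vel"
      unfolding set_integrable_def by (subst integrable_completion) auto
  qed

  have div_curl: "distr_div u \<phi> = 0" "distr_curl u \<phi> = distr_of \<omega> \<phi>" if \<phi>: "test_function \<phi>" for \<phi>
  proof -
    obtain g \<rho> where g: "\<And>x. (\<phi> has_derivative (\<lambda>v. v \<bullet> g x)) (at x)" "continuous_on UNIV g"
      "\<And>x. norm x \<ge> \<rho> \<Longrightarrow> \<phi> x = 0" "\<And>x. norm x \<ge> \<rho> \<Longrightarrow> g x = 0" "\<And>x i. g x $ i = partial_deriv i \<phi> x"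
      using test_function_gradient[OF \<phi>] by metis
    note dc = weak_div_curl[OF g(1-4)]
    have "continuous_on UNIV \<phi>"
      by (intro continuous_at_imp_continuous_on ballI has_derivative_continuous[OF g(1)])
    then have [measurable]: "\<phi> \<in> borel_measurable borel"
      by (rule borel_measurable_continuous_onI)
    have leb: "(LINT x|lebesgue. vel x $ i * partial_deriv j \<phi> x) = (\<integral>x. vel x $ i * g x $ j \<partial>lborel)" for i j
      unfolding g(5)[symmetric] using dc(3)[where i=i and j=j] by (intro integral_completion) auto
    have "distr_div u \<phi> = - (\<integral>x. vel x $ 1 * g x $ 1 + vel x $ 2 * g x $ 2 \<partial>lborel)"
      unfolding distr_div_def distr_partial_def distr_of_def u leb by (simp add: dc(3))
    also have "\<dots> = - (\<integral>x. vel x \<bullet> g x \<partial>lborel)"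
      by (simp add: inner_vec2)
    finally show "distr_div u \<phi> = 0"
      using dc(1) by simp
    have "distr_curl u \<phi> = (\<integral>x. vel x $ 1 * g x $ 2 - vel x $ 2 * g x $ 1 \<partial>lborel)"
      unfolding distr_curl_def distr_partial_def distr_of_def u leb by (simp add: dc(3))
    also have "\<dots> = (\<integral>x. vel x \<bullet> (- perp (g x)) \<partial>lborel)"
      by (simp add: inner_vec2)
    also have "\<dots> = (\<integral>x. w x * \<phi> x \<partial>lborel)"
      by (rule dc(2))
    also have "\<dots> = distr_of \<omega> \<phi>"
      unfolding distr_of_def using ae by (intro lebesgue_AE_eq(2)[symmetric]) auto
    finally show "distr_curl u \<phi> = distr_of \<omega> \<phi>" .
  qed

  have main: "(\<forall>h. integrable lebesgue (\<lambda>x. (norm (u (x + h) - u x))\<^sup>2))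
          \<and> set_integrable lebesgue (ball 0 r)
              (\<lambda>h. LINT x|lebesgue. (norm (u (x + h) - u x))\<^sup>2)
          \<and> (\<forall>x. set_integrable lebesgue (cball 0 r)
                   (\<lambda>h. Sigma_weight (norm h / r) * \<omega> x * \<omega> (x + h)))
          \<and> integrable lebesgue
              (\<lambda>x. LINT h:cball 0 r|lebesgue. Sigma_weight (norm h / r) * \<omega> x * \<omega> (x + h))
          \<and> (\<forall>x. set_integrable lebesgue (ball 0 r)
                   (\<lambda>h. \<bar>ln (norm h / r)\<bar> * \<bar>\<omega> x\<bar> * \<bar>\<omega> (x + h)\<bar>))
          \<and> integrable lebesgue
              (\<lambda>x. LINT h:ball 0 r|lebesgue. \<bar>ln (norm h / r)\<bar> * \<bar>\<omega> x\<bar> * \<bar>\<omega> (x + h)\<bar>)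
          \<and> 1 / measure lebesgue (ball (0::real^2) r)
              * (LINT h:ball 0 r|lebesgue. LINT x|lebesgue. (norm (u (x + h) - u x))\<^sup>2)
            = 2 * (LINT x|lebesgue. (LINT h:cball 0 r|lebesgue.
                     Sigma_weight (norm h / r) * \<omega> x * \<omega> (x + h)))
          \<and> 1 / measure lebesgue (ball (0::real^2) r)
              * (LINT h:ball 0 r|lebesgue. LINT x|lebesgue. (norm (u (x + h) - u x))\<^sup>2)
            \<le> (LINT x|lebesgue. (LINT h:ball 0 r|lebesgue.
                 \<bar>ln (norm h / r)\<bar> * \<bar>\<omega> x\<bar> * \<bar>\<omega> (x + h)\<bar>))"
    if r: "r > 0" for r
  proof -
    let ?D = "\<lambda>h. \<integral>x. (norm (vel (x + h) - vel x))\<^sup>2 \<partial>lborel"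
    let ?S = "\<lambda>x. \<integral>h. Sigma_cutoff r h * w (x + h) \<partial>lborel"
    let ?L = "\<lambda>x. \<integral>h. log_cutoff r h * \<bar>w (x + h)\<bar> \<partial>lborel"
    note S = integrable_Sigma_cutoff[OF r] and L = integrable_log_cutoff[OF r]

    have D_int: "integrable lebesgue (\<lambda>x. (norm (u (x + h) - u x))\<^sup>2)"
      and D: "(LINT x|lebesgue. (norm (u (x + h) - u x))\<^sup>2) = ?D h" for h
      unfolding u using vel_diff_norm_sq_integrable(1)[of h]
      by (auto simp: integrable_completion intro!: integral_completion)

    have D_ball: "set_integrable lebesgue (ball 0 r) (\<lambda>h. LINT x|lebesgue. (norm (u (x + h) - u x))\<^sup>2)"
    proof -
      obtain M where M: "M \<ge> 0" "\<And>h. norm h \<le> r \<Longrightarrow> ?D h \<le> M"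
        using vel_diff_norm_sq_integrable(2)[of r] by blast
      have "?D h \<ge> 0" for h
        by (intro integral_nonneg_AE) auto
      then have "norm (indicator (ball 0 r) h *\<^sub>R ?D h) \<le> norm (M * indicator (ball 0 r) h)" for h
        using M by (auto split: split_indicator)
      then have "integrable lborel (\<lambda>h. indicator (ball 0 r) h *\<^sub>R ?D h)"
        by (intro Bochner_Integration.integrable_bound[OF integrable_mult_right[OF integrable_indicator_ball[of r], of M]]) auto
      then show ?thesis
        unfolding set_integrable_def D by (subst integrable_completion) auto
    qed

    \<comment> \<open>The area \<pi> r^2 cancels the r^2 of the disc integral and leaves 1 /
      \<pi>.\<close>
    have D_avg: "1 / measure lebesgue (ball (0::real^2) r)
        * (LINT h:ball 0 r|lebesgue. LINT x|lebesgue. (norm (u (x + h) - u x))\<^sup>2)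
        = (\<integral>y. w y * excess r y \<partial>lborel) / pi"
    proof -
      have "(LINT h:ball 0 r|lebesgue. LINT x|lebesgue. (norm (u (x + h) - u x))\<^sup>2)
          = (\<integral>h. indicator (ball 0 r) h * ?D h \<partial>lborel)"
        unfolding set_lebesgue_integral_def D real_scaleR_def by (rule integral_completion) measurable
      moreover have "measure lebesgue (ball (0::real^2) r) = pi * r\<^sup>2"
        using r content_ball[of r "0::real^2"] by (simp add: unit_ball_vol_2)
      ultimately show ?thesis
        using r integral_ball_vel_diff[OF r] by simp
    qed

    \<comment> \<open>As x is fixed, \<omega>(x) and w(x) may differ, so only the shifted factor is
      replaced by the representative; \<omega>(x) is exchanged for w(x) in the outer
      integral.\<close>
    have Sigma: "set_integrable lebesgue (cball 0 r) (\<lambda>h. Sigma_weight (norm h / r) * \<omega> x * \<omega> (x + h))"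
      "(LINT h:cball 0 r|lebesgue. Sigma_weight (norm h / r) * \<omega> x * \<omega> (x + h)) = \<omega> x * ?S x" for x
    proof -
      have m: "(\<lambda>h. \<omega> x * (Sigma_cutoff r h * w (x + h))) \<in> borel_measurable borel"
        by measurable
      have eq: "AE h in lborel. indicator (cball 0 r) h *\<^sub>R (Sigma_weight (norm h / r) * \<omega> x * \<omega> (x + h))
          = \<omega> x * (Sigma_cutoff r h * w (x + h))"
        using ae_shift[of x] by eventually_elim (simp add: Sigma_cutoff_def)
      show "set_integrable lebesgue (cball 0 r) (\<lambda>h. Sigma_weight (norm h / r) * \<omega> x * \<omega> (x + h))"
        unfolding set_integrable_def lebesgue_AE_eq(1)[OF m eq]
        by (intro integrable_mult_right correlation_integrable(1) S)
      show "(LINT h:cball 0 r|lebesgue. Sigma_weight (norm h / r) * \<omega> x * \<omega> (x + h)) = \<omega> x * ?S x"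
        unfolding set_lebesgue_integral_def lebesgue_AE_eq(2)[OF m eq] by simp
    qed
    have log: "set_integrable lebesgue (ball 0 r) (\<lambda>h. \<bar>ln (norm h / r)\<bar> * \<bar>\<omega> x\<bar> * \<bar>\<omega> (x + h)\<bar>)"
      "(LINT h:ball 0 r|lebesgue. \<bar>ln (norm h / r)\<bar> * \<bar>\<omega> x\<bar> * \<bar>\<omega> (x + h)\<bar>) = \<bar>\<omega> x\<bar> * ?L x" for x
    proof -
      have m: "(\<lambda>h. \<bar>\<omega> x\<bar> * (log_cutoff r h * \<bar>w (x + h)\<bar>)) \<in> borel_measurable borel"
        by measurable
      have eq: "AE h in lborel. indicator (ball 0 r) h *\<^sub>R (\<bar>ln (norm h / r)\<bar> * \<bar>\<omega> x\<bar> * \<bar>\<omega> (x + h)\<bar>)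
          = \<bar>\<omega> x\<bar> * (log_cutoff r h * \<bar>w (x + h)\<bar>)"
        using ae_shift[of x] by eventually_elim (simp add: log_cutoff_def)
      show "set_integrable lebesgue (ball 0 r) (\<lambda>h. \<bar>ln (norm h / r)\<bar> * \<bar>\<omega> x\<bar> * \<bar>\<omega> (x + h)\<bar>)"
        unfolding set_integrable_def lebesgue_AE_eq(1)[OF m eq]
        by (intro integrable_mult_right abs.correlation_integrable(1) L)
      show "(LINT h:ball 0 r|lebesgue. \<bar>ln (norm h / r)\<bar> * \<bar>\<omega> x\<bar> * \<bar>\<omega> (x + h)\<bar>) = \<bar>\<omega> x\<bar> * ?L x"
        unfolding set_lebesgue_integral_def lebesgue_AE_eq(2)[OF m eq] by simp
    qed

    have mS: "(\<lambda>x. w x * ?S x) \<in> borel_measurable borel" and mL: "(\<lambda>x. \<bar>w x\<bar> * ?L x) \<in> borel_measurable borel"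
      by measurable
    have eqS: "AE x in lborel. \<omega> x * ?S x = w x * ?S x" and eqL: "AE x in lborel. \<bar>\<omega> x\<bar> * ?L x = \<bar>w x\<bar> * ?L x"
      using ae by (eventually_elim, simp)+
    \<comment> \<open>The 2 against the 1 / (2 \<pi>) of \<open>Sigma_correlation\<close> matches
      the 1 / \<pi> of \<open>D_avg\<close>.\<close>
    have "2 * (\<integral>x. w x * ?S x \<partial>lborel) = (\<integral>y. w y * excess r y \<partial>lborel) / pi"
      by (simp add: Sigma_correlation[OF r])
    then show ?thesis
      unfolding Sigma(2) log(2) D_avg lebesgue_AE_eq[OF mS eqS] lebesgue_AE_eq[OF mL eqL]
      using D_int D_ball Sigma(1) log(1) correlation_integrable(2)[OF S] abs.correlation_integrable(2)[OF L]
        Sigma_correlation_le[OF r] by simp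
  qed

  show ?thesis
    using kernel(1) loc div_curl Sigma_weight_nonneg main by blast
qed

end
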